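(* There exists a positive integer $N$ such that for every integer $n\ge N$ and every nonempty proper subset $I$ of $\{2,3,\ldots,n-1,n\}$ with $|I\cap\{n-1,n\}|\neq 1$, the normal Cayley graph $\mathrm{Cay}(S_n,T(n,I))$ has the Aldous property if and only if $I\cap\{n-1,n\}=\emptyset$, where $T(n,I)=\{\sigma\in S_n : |\mathrm{supp}(\sigma)|\in I\}$.
   Context: $S_n$ is the symmetric group on $[n]=\{1,2,\ldots,n\}$, $n\ge 3$. The support of $\sigma\in S_n$ is $\mathrm{supp}(\sigma)=\{i\in[n] : \sigma(i)\neq i\}$. For a finite group $G$ with identity $e$ and an inverse-closed subset $S\subseteq G\setminus\{e\}$, the Cayley graph $\mathrm{Cay}(G,S)$ is the simple undirected $|S|$-regular graph with vertex set $G$ and edge set $\{\{g,gs\} : g\in G, s\in S\}$. It is called a normal Cayley graph if $S$ is closed under conjugation in $G$. The eigenvalues of a graph are those of its adjacency matrix, listed with multiplicity in non-ascending order $\lambda_1\ge\lambda_2\ge\cdots$; similarly $\lambda_1(M)$ denotes the largest eigenvalue of a matrix $M$ with real eigenvalues. The standard representation $\rho_{(n-1,1)}$ of $S_n$ is the irreducible complex representation (Specht module) corresponding to the partition $(n-1,1)$ of $n$; it has dimension $n-1$ and character $\chi_{(n-1,1)}(\sigma)=(\text{number of fixed points of }\sigma)-1$. For $S\subseteq S_n$ put $\rho_{(n-1,1)}(S)=\sum_{s\in S}\rho_{(n-1,1)}(s)$. Aldous property: $\mathrm{Cay}(S_n,S)$ has the Aldous property if its strictly second largest eigenvalue (the largest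 eigenvalue strictly smaller than the degree $|S|$) is attained by the standard representation, that is, $\lambda_{t+1}(\mathrm{Cay}(S_n,S))=\lambda_1(\rho_{(n-1,1)}(S))$, where $t=[S_n:\langle S\rangle]$ is the index in $S_n$ of the subgroup generated by $S$. (When $S$ is closed under conjugation, $\rho_{(n-1,1)}(S)$ is a scalar matrix and $\lambda_1(\rho_{(n-1,1)}(S))=\sum_{\sigma\in S}\chi_{(n-1,1)}(\sigma)/(n-1)$.) *)

theory Defs
  imports
    "HOL-Algebra.Sym_Groups"
    "HOL-Library.Countable_Set"
    "Jordan_Normal_Form.Char_Poly"
begin

subsection \<open>Cayley graphs and graph eigenvalues\<close>

text \<open>A graph is a pair of its vertex set and its set of undirected edges.\<close>

type_synonym 'a graph = "'a set \<times> 'a set set"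

definition cayley_graph :: "('a, 'b) monoid_scheme \<Rightarrow> 'a set \<Rightarrow> 'a graph" where
  "cayley_graph G S = (carrier G, {{g, g \<otimes>\<^bsub>G\<^esub> s} | g s. g \<in> carrier G \<and> s \<in> S})"

definition is_normal_connection_set :: "('a, 'b) monoid_scheme \<Rightarrow> 'a set \<Rightarrow> bool" where
  "is_normal_connection_set G S \<longleftrightarrow>
     S \<subseteq> carrier G - {\<one>\<^bsub>G\<^esub>} \<and>
     (\<forall>s\<in>S. inv\<^bsub>G\<^esub> s \<in> S) \<and>
     (\<forall>g\<in>carrier G. \<forall>s\<in>S. g \<otimes>\<^bsub>G\<^esub> s \<otimes>\<^bsub>G\<^esub> inv\<^bsub>G\<^esub> g \<in> S)"

text \<open>
  The library function \<^const>\<open>from_nat_into\<close> enumerates a finite set \<open>V\<close> bijectively by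
  \<open>0, \<dots>, card V - 1\<close>.  Another enumeration would conjugate the adjacency matrix by a
  permutation matrix, so the eigenvalues below do not depend on it.
\<close>

definition adjacency_matrix :: "'a graph \<Rightarrow> real mat" where
  "adjacency_matrix \<Gamma> = (case \<Gamma> of (V, E) \<Rightarrow>
     mat (card V) (card V)
       (\<lambda>(i, j). of_bool ({from_nat_into V i, from_nat_into V j} \<in> E)))"

text \<open>
  Real roots of the characteristic polynomial, repeated according to multiplicity, in
  non-ascending order.  A real symmetric matrix has only real eigenvalues, so none is omitted.
\<close>

definition graph_eigenvalues :: "'a graph \<Rightarrow> real list" where
  "graph_eigenvalues \<Gamma> =
     rev (sorted_list_of_multiset (proots (char_poly (adjacency_matrix \<Gamma>))))"

text \<open>The index \<open>k\<close> of \<open>\<lambda>\<^sub>k\<close> starts at 1, whereas list positions start at 0.\<close>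

definition graph_eigenvalue :: "'a graph \<Rightarrow> nat \<Rightarrow> real" where
  "graph_eigenvalue \<Gamma> k = graph_eigenvalues \<Gamma> ! (k - 1)"


subsection \<open>The standard representation of the symmetric group\<close>

text \<open>
  A tabloid of shape \<open>(n - 1, 1)\<close> is determined by the entry of its second row, so the
  permutation module on tabloids is \<open>\<complex>\<^sup>n\<close> with basis \<open>e\<^sub>1, \<dots>, e\<^sub>n\<close>.  The standard
  polytabloids \<open>e\<^sub>j - e\<^sub>1\<close> for \<open>2 \<le> j \<le> n\<close> form a basis of the Specht module, and
  \[ \sigma (e_j - e_1) = (e_{\sigma j} - e_1) - (e_{\sigma 1} - e_1). \]
  The matrix of \<open>\<sigma>\<close> in this basis is given below; row and column \<open>i\<close> (counted from 0)
  correspond to \<open>e\<^sub>i\<^sub>+\<^sub>2 - e\<^sub>1\<close>.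
\<close>

definition standard_rep :: "nat \<Rightarrow> (nat \<Rightarrow> nat) \<Rightarrow> complex mat" where
  "standard_rep n \<sigma> =
     mat (n - 1) (n - 1) (\<lambda>(i, j). of_bool (\<sigma> (j + 2) = i + 2) - of_bool (\<sigma> 1 = i + 2))"

definition standard_rep_sum :: "nat \<Rightarrow> (nat \<Rightarrow> nat) set \<Rightarrow> complex mat" where
  "standard_rep_sum n S =
     mat (n - 1) (n - 1) (\<lambda>(i, j). \<Sum>\<sigma>\<in>S. standard_rep n \<sigma> $$ (i, j))"

text \<open>Intended for matrices all of whose eigenvalues are real.\<close>

definition largest_eigenvalue :: "complex mat \<Rightarrow> real" where
  "largest_eigenvalue A = Max {x. eigenvalue A (complex_of_real x)}"


subsection \<open>The Aldous property\<close>

definition aldous_property :: "nat \<Rightarrow> (nat \<Rightarrow> nat) set \<Rightarrow> bool" where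
  "aldous_property n S \<longleftrightarrow>
     (let t = card (rcosets\<^bsub>sym_group n\<^esub> (generate (sym_group n) S))
      in graph_eigenvalue (cayley_graph (sym_group n) S) (t + 1)
         = largest_eigenvalue (standard_rep_sum n S))"

definition perm_support :: "nat \<Rightarrow> (nat \<Rightarrow> nat) \<Rightarrow> nat set" where
  "perm_support n \<sigma> = {i \<in> {1..n}. \<sigma> i \<noteq> i}"

definition T :: "nat \<Rightarrow> nat set \<Rightarrow> (nat \<Rightarrow> nat) set" where
  "T n I = {\<sigma> \<in> carrier (sym_group n). card (perm_support n \<sigma>) \<in> I}"


subsection \<open>Consistency checks\<close>

lemma standard_rep_one: "standard_rep n id = 1\<^sub>m (n - 1)"
  by (rule eq_matI) (auto simp: standard_rep_def)

lemma standard_rep_mult: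
  assumes s: "\<sigma> permutes {1..n}" and t: "\<tau> permutes {1..n}"
  shows "standard_rep n (\<sigma> \<circ> \<tau>) = standard_rep n \<sigma> * standard_rep n \<tau>"
proof (rule eq_matI)
  fix i j assume "i < dim_row (standard_rep n \<sigma> * standard_rep n \<tau>)"
    and "j < dim_col (standard_rep n \<sigma> * standard_rep n \<tau>)"
  then have i: "i < n - 1" and j: "j < n - 1" by (auto simp: standard_rep_def)
  define f :: "nat \<Rightarrow> complex" where
    "f a = of_bool (\<sigma> a = i + 2) - of_bool (\<sigma> 1 = i + 2)" for a
  have key: "(\<Sum>k<n - 1. f (k + 2) * of_bool (a = k + 2)) = f a" if "a \<in> {1..n}" for a
  proof (cases "a = 1")
    case True
    then show ?thesis by (simp add: f_def)
  next
    case False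
    then have a: "a - 2 < n - 1" "a - 2 + 2 = a" using that by auto
    have "(\<Sum>k<n - 1. f (k + 2) * of_bool (a = k + 2)) =
          (\<Sum>k<n - 1. if k = a - 2 then f a else 0)"
      using a by (intro sum.cong) auto
    also have "\<dots> = f a" using a by simp
    finally show ?thesis .
  qed
  have "\<tau> (j + 2) \<in> {1..n}" "\<tau> 1 \<in> {1..n}"
    using j permutes_in_image[OF t] by auto
  note k = key[OF this(1)] key[OF this(2)]
  have "(standard_rep n \<sigma> * standard_rep n \<tau>) $$ (i, j) =
        (\<Sum>k<n - 1. f (k + 2) * (of_bool (\<tau> (j + 2) = k + 2) - of_bool (\<tau> 1 = k + 2)))"
    using i j by (simp add: standard_rep_def scalar_prod_def f_def lessThan_atLeast0)
  also have "\<dots> = f (\<tau> (j + 2)) - f (\<tau> 1)"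
    using k by (simp only: right_diff_distrib sum_subtractf)
  also have "\<dots> = standard_rep n (\<sigma> \<circ> \<tau>) $$ (i, j)"
    using i j by (simp add: standard_rep_def f_def)
  finally show "standard_rep n (\<sigma> \<circ> \<tau>) $$ (i, j) =
    (standard_rep n \<sigma> * standard_rep n \<tau>) $$ (i, j)" ..
qed (auto simp: standard_rep_def)

lemma standard_rep_character:
  assumes s: "\<sigma> permutes {1..n}" and n: "n \<ge> 1"
  shows "(\<Sum>i<n - 1. standard_rep n \<sigma> $$ (i, i)) = of_nat (card {i \<in> {1..n}. \<sigma> i = i}) - 1"
proof -
  have 1: "\<sigma> 1 \<in> {1..n}" using n permutes_in_image[OF s] by auto
  have shift: "(\<Sum>i<n - 1. g (i + 2)) = (\<Sum>i\<in>{2..n}. g i)" for g :: "nat \<Rightarrow> complex"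
    by (rule sum.reindex_bij_witness[of _ "\<lambda>i. i - 2" "\<lambda>i. i + 2"]) auto
  have split: "(\<Sum>i\<in>{1..n}. g i) = g 1 + (\<Sum>i\<in>{2..n}. g i)" for g :: "nat \<Rightarrow> complex"
    using n by (simp add: sum.atLeast_Suc_atMost numeral_2_eq_2)
  have "(\<Sum>i<n - 1. standard_rep n \<sigma> $$ (i, i)) =
        (\<Sum>i<n - 1. of_bool (\<sigma> (i + 2) = i + 2) - of_bool (\<sigma> 1 = i + 2))"
    by (rule sum.cong) (auto simp: standard_rep_def)
  also have "\<dots> = (\<Sum>i\<in>{2..n}. of_bool (\<sigma> i = i) - of_bool (\<sigma> 1 = i))"
    by (rule shift)
  also have "\<dots> = (\<Sum>i\<in>{1..n}. of_bool (\<sigma> i = i) - of_bool (\<sigma> 1 = i))"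
    by (subst split) simp
  also have "\<dots> = (\<Sum>i\<in>{1..n}. of_bool (\<sigma> i = i)) - (\<Sum>i\<in>{1..n}. if i = \<sigma> 1 then 1 else 0)"
    unfolding sum_subtractf by (intro arg_cong2[where f = "(-)"] sum.cong) auto
  also have "(\<Sum>i\<in>{1..n}. if i = \<sigma> 1 then 1 else (0::complex)) = 1"
    using 1 by simp
  also have "(\<Sum>i\<in>{1..n}. of_bool (\<sigma> i = i)) = (of_nat (card {i \<in> {1..n}. \<sigma> i = i}) :: complex)"
    by (simp add: of_bool_def sum.If_cases Int_def conj_commute)
  finally show ?thesis .
qed

lemma sym_group_inv_eq:
  assumes "p permutes {1..n}"
  shows "inv\<^bsub>sym_group n\<^esub> p = Hilbert_Choice.inv p"
proof -
  interpret group "sym_group n" by (rule sym_group_is_group)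
  show ?thesis
    using assms permutes_inv[OF assms] permutes_inv_o[OF assms]
    by (intro inv_equality) (auto simp: sym_group_carrier sym_group_mult sym_group_one)
qed

text \<open>In particular, the Cayley graph of \<open>T n I\<close> is a normal Cayley graph.\<close>

lemma T_is_normal_connection_set:
  assumes "I \<subseteq> {2..n}"
  shows "is_normal_connection_set (sym_group n) (T n I)"
  unfolding is_normal_connection_set_def
proof (intro conjI ballI)
  interpret group "sym_group n" by (rule sym_group_is_group)
  show "T n I \<subseteq> carrier (sym_group n) - {\<one>\<^bsub>sym_group n\<^esub>}"
    using assms by (auto simp: T_def sym_group_one perm_support_def)
  fix s assume s: "s \<in> T n I"
  then have sp: "s permutes {1..n}" by (simp add: T_def sym_group_carrier)
  have "perm_support n (Hilbert_Choice.inv s) = perm_support n s"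
    using permutes_inv_eq[OF sp] by (auto simp: perm_support_def)
  then show "inv\<^bsub>sym_group n\<^esub> s \<in> T n I"
    using s permutes_inv[OF sp] by (simp add: T_def sym_group_inv_eq[OF sp] sym_group_carrier)
  fix g assume "g \<in> carrier (sym_group n)"
  then have gp: "g permutes {1..n}" by (simp add: sym_group_carrier)
  have "perm_support n (g \<circ> s \<circ> Hilbert_Choice.inv g) = g ` perm_support n s"
  proof (intro equalityI subsetI)
    fix x assume x: "x \<in> perm_support n (g \<circ> s \<circ> Hilbert_Choice.inv g)"
    let ?y = "Hilbert_Choice.inv g x"
    have "?y \<in> {1..n}" "g ?y = x" "s ?y \<noteq> ?y"
      using x permutes_in_image[OF permutes_inv[OF gp], of x] permutes_inverses(1)[OF gp]
      by (auto simp: perm_support_def)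
    then have "?y \<in> perm_support n s" by (simp add: perm_support_def)
    then show "x \<in> g ` perm_support n s" using \<open>g ?y = x\<close> by (metis imageI)
  next
    fix x assume "x \<in> g ` perm_support n s"
    then obtain y where "x = g y" "y \<in> {1..n}" "s y \<noteq> y" by (auto simp: perm_support_def)
    then show "x \<in> perm_support n (g \<circ> s \<circ> Hilbert_Choice.inv g)"
      using permutes_in_image[OF gp, of y] permutes_inverses(2)[OF gp]
        inj_eq[OF permutes_inj[OF gp]]
      by (simp add: perm_support_def)
  qed
  then have "card (perm_support n (g \<circ> s \<circ> Hilbert_Choice.inv g)) = card (perm_support n s)"
    using permutes_inj[OF gp] by (simp add: card_image inj_on_subset)
  moreover have "(g \<circ> s \<circ> Hilbert_Choice.inv g) permutes {1..n}"
    by (intro permutes_compose sp gp permutes_inv)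
  ultimately show "g \<otimes>\<^bsub>sym_group n\<^esub> s \<otimes>\<^bsub>sym_group n\<^esub> inv\<^bsub>sym_group n\<^esub> g \<in> T n I"
    using s by (simp add: T_def sym_group_carrier sym_group_mult sym_group_inv_eq[OF gp])
qed

end

theory Submission
  imports Defs "Jordan_Normal_Form.Schur_Decomposition"
begin

text \<open>
  Let \<open>P\<^sub>S\<close> be the operator that averages a function on \<open>S\<^sub>n\<close> over its right translates by the
  permutations of \<open>S\<close>.  It is an orthogonal projection.  For a fixed function \<open>f\<close> let \<open>q m\<close> be the mean
  of the inner products of \<open>f\<close> with \<open>P\<^sub>S f\<close> over all \<open>S\<close> with \<open>m\<close> elements; these are the levels of \<open>f\<close>.
  Inclusion--exclusion expresses the quadratic form of the sum of all permutations with support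
  size \<open>k\<close> as \<open>n! / (n - k)!\<close> times the sum of \<open>(-1)\<^sup>j / j! * q (k - j)\<close> over \<open>j \<le> k\<close>
  (\<open>support_mean_eq_sum_level\<close>).

  The proof rests on the convexity of \<open>q\<close> from 1 on (\<open>level_convex\<close>).  It holds because the invariants
  of \<open>Sym (S \<union> {x})\<close> and of \<open>Sym (S \<union> {y})\<close> are two subspaces of the invariants of \<open>Sym S\<close> that meet in
  the invariants of \<open>Sym (S \<union> {x, y})\<close>.  If \<open>f\<close> is orthogonal to the constants, then \<open>q n = 0\<close>, so the
  differences \<open>q m - q (m + 1)\<close> form a nonnegative decreasing sequence with sum \<open>q 1\<close>, the squared norm
  of \<open>f\<close>.  Every such sequence is a mixture of sequences that are constant up to some \<open>s\<close> and vanish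
  afterwards, and the standard representation is the case \<open>s = n - 1\<close>.  Comparing it with the other
  values of \<open>s\<close> is a question about the numbers \<open>B\<^sub>i\<close>, the sums of \<open>(-1)\<^sup>j / j!\<close> over \<open>j \<le> i\<close>
  (\<open>deficiency_bound\<close>, \<open>convex_levels_bound\<close>).  For support sizes up to \<open>n - 2\<close> the
  standard representation wins for each size separately, except for size 3 at \<open>s = 1\<close>.  This exception
  is the sign representation, and any further element of \<open>I\<close> makes up for it.

  The case \<open>I = {3}\<close> is left.  Here the generated subgroup is the alternating group, and \<open>f\<close> has to be
  taken orthogonal to the sign as well.  Comparing the levels of \<open>f\<close> with those of \<open>f\<close> multiplied by the
  sign gives the sharp bound for the 3-cycles (\<open>four_projections_bessel\<close>, \<open>support_mean_3_bound\<close>).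

  Such bounds for the quadratic form on the orthogonal complement of the characters that are trivial
  on the connection set determine both the index \<open>t\<close> and the eigenvalue \<open>\<lambda>\<^sub>t\<^sub>+\<^sub>1\<close>
  (\<open>graph_eigenvalue_after_top\<close>, \<open>aldous_criterion\<close>), by diagonalisation of real symmetric matrices.

  Conversely, if \<open>n - 1\<close> and \<open>n\<close> belong to \<open>I\<close>, then the complement \<open>J\<close> of \<open>I\<close> in \<open>{2..n}\<close> lies in
  \<open>{2..n - 2}\<close>.  The value of the standard representation for \<open>I\<close> is \<open>- 1\<close> minus the value for \<open>J\<close>, hence
  at most \<open>- 1\<close>, and since the adjacency matrix has trace 0, the second eigenvalue is larger
  (\<open>not_aldous_property_T\<close>).
\<close>

section \<open>Diagonalisation of real symmetric matrices\<close>

text \<open>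
  A complex root of the characteristic polynomial exists, and it is real because the Hermitian form of
  a real symmetric matrix takes only real values; \<open>R\<close> below is its value at an eigenvector.  A real
  root of the real characteristic polynomial then has a real eigenvector.
\<close>

lemma real_symmetric_has_eigenvector:
  fixes A :: "real mat"
  assumes A: "A \<in> carrier_mat n n" and sym: "transpose_mat A = A" and n: "n > 0"
  obtains e v where "v \<in> carrier_vec n" "v \<noteq> 0\<^sub>v n" "A *\<^sub>v v = e \<cdot>\<^sub>v v"
proof -
  let ?A = "map_mat complex_of_real A"
  have A': "?A \<in> carrier_mat n n" using A by simp
  from char_poly_factorized[OF A'] obtain as where
    as: "char_poly ?A = (\<Prod>a\<leftarrow>as. [:- a, 1:])" "length as = n" by auto
  with n obtain z where "z \<in> set as" by (cases as) auto
  then have "poly (char_poly ?A) z = 0"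
    unfolding as poly_prod_list by (auto simp: prod_list_zero_iff)
  then have "eigenvalue ?A z" using eigenvalue_root_char_poly[OF A'] by simp
  then obtain w where w: "w \<in> carrier_vec n" "w \<noteq> 0\<^sub>v n" "?A *\<^sub>v w = z \<cdot>\<^sub>v w"
    using A unfolding eigenvalue_def eigenvector_def by auto
  have comp: "(\<Sum>j<n. of_real (A $$ (i, j)) * w $ j) = z * w $ i" if "i < n" for i
  proof -
    have "(?A *\<^sub>v w) $ i = z * w $ i" using w that by simp
    then show ?thesis using w(1) A that
      by (simp add: scalar_prod_def lessThan_atLeast0)
  qed
  have symm: "A $$ (i, j) = A $$ (j, i)" if "i < n" "j < n" for i j
    using A that arg_cong[OF sym, of "\<lambda>M. M $$ (i, j)"] by simp
  define S where "S = (\<Sum>i<n. cnj (w $ i) * w $ i)"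
  define R where "R = (\<Sum>i<n. \<Sum>j<n. of_real (A $$ (i, j)) * w $ j * cnj (w $ i))"
  have "R = (\<Sum>i<n. cnj (w $ i) * (\<Sum>j<n. of_real (A $$ (i, j)) * w $ j))"
    unfolding R_def by (simp add: sum_distrib_left mult_ac)
  also have "\<dots> = z * S"
    unfolding S_def sum_distrib_left[of z] by (rule sum.cong) (auto simp: comp)
  finally have RS: "R = z * S" .
  have "cnj R = (\<Sum>i<n. \<Sum>j<n. of_real (A $$ (i, j)) * w $ i * cnj (w $ j))"
    unfolding R_def by (simp add: mult_ac)
  also have "\<dots> = (\<Sum>j<n. \<Sum>i<n. of_real (A $$ (i, j)) * w $ i * cnj (w $ j))"
    by (rule sum.swap)
  also have "\<dots> = R" unfolding R_def by (intro sum.cong refl) (auto simp: symm)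
  finally have R_real: "cnj R = R" .
  have S: "S = of_real (\<Sum>i<n. (cmod (w $ i))\<^sup>2)"
    unfolding S_def of_real_sum by (rule sum.cong) (auto simp: complex_norm_square mult_ac simp del: of_real_power)
  have "\<exists>i<n. w $ i \<noteq> 0"
    using w(1,2) by (metis carrier_vecD eq_vecI index_zero_vec)
  then obtain i where i: "i < n" "w $ i \<noteq> 0" by auto
  have "0 < (\<Sum>i<n. (cmod (w $ i))\<^sup>2)"
    by (rule sum_pos2[of _ i]) (use i in auto)
  then have "S \<noteq> 0" by (metis S of_real_eq_0_iff less_irrefl)
  moreover have "cnj z * S = z * S" using R_real unfolding RS S by simp
  ultimately have "cnj z = z" by simp
  then have z: "z = of_real (Re z)" by (simp add: complex_eq_iff)
  have "poly (map_poly complex_of_real (char_poly A)) z = 0"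
    using \<open>poly (char_poly ?A) z = 0\<close> of_real_hom.char_poly_hom[OF A] by metis
  then have "poly (map_poly complex_of_real (char_poly A)) (of_real (Re z)) = 0" using z by metis
  then have "poly (char_poly A) (Re z) = 0" by simp
  then have "eigenvalue A (Re z)" using eigenvalue_root_char_poly[OF A] by simp
  then show ?thesis using that A unfolding eigenvalue_def eigenvector_def by auto
qed

text \<open>
  Gram--Schmidt produces orthogonal vectors that need not have length 1.  They are normalised here,
  because only then the inverse of \<open>W\<close> is its transpose, so that passing to the new basis preserves
  the symmetry of a matrix.
\<close>

lemma orthonormal_columns_extending:
  fixes v :: "real vec"
  assumes v: "v \<in> carrier_vec n" "v \<noteq> 0\<^sub>v n" and n: "n > 0"
  obtains W c where "W \<in> carrier_mat n n" "transpose_mat W * W = 1\<^sub>m n" "col W 0 = c \<cdot>\<^sub>v v"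
proof -
  interpret cof_vec_space n "TYPE(real)" .
  define b where "b = gram_schmidt n (basis_completion v)"
  note bc = basis_completion[OF v]
  note gs = gram_schmidt_result[OF bc(2,4,5) b_def]
  have hd: "hd b = v" unfolding b_def using bc(6,7) n
    by (cases "basis_completion v") (auto simp: v)
  have len: "length b = n" using gs bc(6) by simp
  define nrm :: "real vec \<Rightarrow> real" where "nrm w = 1 / sqrt (w \<bullet> w)" for w
  define W where "W = mat_of_cols n (map (\<lambda>w. nrm w \<cdot>\<^sub>v w) b)"
  have W: "W \<in> carrier_mat n n" unfolding W_def
    using len mat_of_cols_carrier(1)[of n "map (\<lambda>w. nrm w \<cdot>\<^sub>v w) b"] by simp
  have bi: "b ! i \<in> carrier_vec n" if "i < n" for i using gs(3) len that by (simp add: subset_iff)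
  have cW: "col W i = nrm (b ! i) \<cdot>\<^sub>v b ! i" if "i < n" for i
    unfolding W_def using that len bi[OF that] by (subst col_mat_of_cols) auto
  have conj: "conjugate w = w" for w :: "real vec" by (auto simp: conjugate_vec_def)
  have orth: "b ! i \<bullet> b ! j = 0 \<longleftrightarrow> i \<noteq> j" if "i < n" "j < n" for i j
    using gs(2) that len unfolding corthogonal_def by (auto simp: conj)
  have "transpose_mat W * W = 1\<^sub>m n"
  proof (rule eq_matI)
    fix i j assume "i < dim_row (1\<^sub>m n :: real mat)" "j < dim_col (1\<^sub>m n :: real mat)"
    then have ij: "i < n" "j < n" by auto
    have nn: "b ! i \<bullet> b ! i > 0"
      using orth[OF ij(1,1)] conjugate_square_ge_0_vec[of "b ! i"] by (simp add: less_le conj)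
    have "(transpose_mat W * W) $$ (i, j) = col W i \<bullet> col W j" using W ij by simp
    also have "\<dots> = nrm (b ! i) * nrm (b ! j) * (b ! i \<bullet> b ! j)"
      using bi[OF ij(1)] bi[OF ij(2)]
      by (simp add: cW ij smult_scalar_prod_distrib[of _ n] scalar_prod_smult_distrib[of _ n])
    also have "\<dots> = 1\<^sub>m n $$ (i, j)"
    proof (cases "i = j")
      case True
      then show ?thesis using nn ij by (simp add: nrm_def)
    next
      case False
      then show ?thesis using orth[OF ij] ij by simp
    qed
    finally show "(transpose_mat W * W) $$ (i, j) = 1\<^sub>m n $$ (i, j)" .
  qed (use W in auto)
  moreover have "col W 0 = nrm v \<cdot>\<^sub>v v"
    using cW[OF n] hd len n by (cases b) auto
  ultimately show ?thesis using that W by blast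
qed

text \<open>
  In an orthonormal basis that starts with an eigenvector, the first column vanishes below the
  diagonal.  By symmetry the first row vanishes as well, and the induction goes on with the symmetric
  block that is left.
\<close>

theorem real_symmetric_orthogonally_diagonalizable:
  fixes A :: "real mat"
  assumes "A \<in> carrier_mat n n" and "transpose_mat A = A"
  shows "\<exists>P D. P \<in> carrier_mat n n \<and> D \<in> carrier_mat n n \<and> diagonal_mat D \<and>
    transpose_mat P * P = 1\<^sub>m n \<and> A * P = P * D"
  using assms
proof (induction n arbitrary: A)
  case 0
  then show ?case by (intro exI[of _ "1\<^sub>m 0"]) (auto simp: diagonal_mat_def)
next
  case (Suc m)
  let ?n = "Suc m"
  note A = Suc.prems(1) and sym = Suc.prems(2)
  obtain e v where v: "v \<in> carrier_vec ?n" "v \<noteq> 0\<^sub>v ?n" "A *\<^sub>v v = e \<cdot>\<^sub>v v"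
    by (rule real_symmetric_has_eigenvector[OF A sym zero_less_Suc])
  obtain W c where W: "W \<in> carrier_mat ?n ?n" and WW: "transpose_mat W * W = 1\<^sub>m ?n"
    and W0: "col W 0 = c \<cdot>\<^sub>v v"
    using orthonormal_columns_extending[OF v(1,2)] by auto
  have Wt: "transpose_mat W \<in> carrier_mat ?n ?n" using W by simp
  have WW': "W * transpose_mat W = 1\<^sub>m ?n" using mat_mult_left_right_inverse[OF Wt W WW] .
  define A' where "A' = transpose_mat W * (A * W)"
  have A': "A' \<in> carrier_mat ?n ?n" using W A by (simp add: A'_def)
  have WA': "W * A' = A * W"
  proof -
    have "W * A' = (W * transpose_mat W) * (A * W)"
      unfolding A'_def using W A by (subst assoc_mult_mat[of _ ?n ?n _ ?n]) auto
    then show ?thesis using WW' W A by simp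
  qed
  have symA': "transpose_mat A' = A'"
  proof -
    have "transpose_mat A' = transpose_mat (A * W) * transpose_mat (transpose_mat W)"
      unfolding A'_def using W A by (subst transpose_mult[of _ ?n ?n _ ?n]) auto
    also have "\<dots> = (transpose_mat W * A) * W"
      using W A sym by (subst transpose_mult[of _ ?n ?n _ ?n]) auto
    also have "\<dots> = A'" unfolding A'_def using W A by (subst assoc_mult_mat[of _ ?n ?n _ ?n]) auto
    finally show ?thesis .
  qed
  have col0: "A' $$ (i, 0) = (if i = 0 then e else 0)" if i: "i < ?n" for i
  proof -
    have "A' $$ (i, 0) = col W i \<bullet> (A *\<^sub>v col W 0)"
      unfolding A'_def using W A i by (simp add: col_mult2[of _ ?n ?n _ ?n] mult_mat_vec_def)
    also have "A *\<^sub>v col W 0 = e \<cdot>\<^sub>v col W 0"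
      unfolding W0 using v A by (auto simp: mult_mat_vec smult_smult_assoc mult.commute)
    also have "col W i \<bullet> (e \<cdot>\<^sub>v col W 0) = e * (transpose_mat W * W) $$ (i, 0)"
      using W i by simp
    also have "\<dots> = (if i = 0 then e else 0)" unfolding WW using i by simp
    finally show ?thesis .
  qed
  have row0: "A' $$ (0, i) = (if i = 0 then e else 0)" if i: "i < ?n" for i
    using col0[OF i] arg_cong[OF symA', of "\<lambda>M. M $$ (i, 0)"] A' i by simp
  define A3 where "A3 = mat m m (\<lambda>(i, j). A' $$ (Suc i, Suc j))"
  have A3: "A3 \<in> carrier_mat m m" by (simp add: A3_def)
  have symA3: "transpose_mat A3 = A3"
  proof (rule eq_matI)
    fix i j assume "i < dim_row A3" "j < dim_col A3"
    then have ij: "i < m" "j < m" using A3 by auto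
    then show "transpose_mat A3 $$ (i, j) = A3 $$ (i, j)"
      using arg_cong[OF symA', of "\<lambda>M. M $$ (Suc i, Suc j)"] A' by (simp add: A3_def)
  qed (use A3 in auto)
  let ?E = "e \<cdot>\<^sub>m 1\<^sub>m 1 :: real mat" and ?O = "0\<^sub>m 1 m :: real mat" and ?O' = "0\<^sub>m m 1 :: real mat"
  have block: "A' = four_block_mat ?E ?O ?O' A3"
  proof (rule eq_matI)
    fix i j assume "i < dim_row (four_block_mat ?E ?O ?O' A3)"
      "j < dim_col (four_block_mat ?E ?O ?O' A3)"
    then have "i < ?n" "j < ?n" using A3 by auto
    then show "A' $$ (i, j) = four_block_mat ?E ?O ?O' A3 $$ (i, j)"
      using A3 col0[of i] row0[of j] by (cases i; cases j) (auto simp: A3_def)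
  qed (use A' A3 in auto)
  from Suc.IH[OF A3 symA3] obtain P3 D3 where P3: "P3 \<in> carrier_mat m m"
    and D3: "D3 \<in> carrier_mat m m" "diagonal_mat D3"
    and PP3: "transpose_mat P3 * P3 = 1\<^sub>m m" and AP3: "A3 * P3 = P3 * D3" by blast
  define F where "F = four_block_mat (1\<^sub>m 1) ?O ?O' P3"
  define D where "D = four_block_mat ?E ?O ?O' D3"
  have F: "F \<in> carrier_mat ?n ?n" and D: "D \<in> carrier_mat ?n ?n"
    unfolding F_def D_def using P3 D3 by auto
  have FF: "transpose_mat F * F = 1\<^sub>m ?n"
    unfolding F_def using P3 PP3
    by (subst transpose_four_block_mat[of _ 1 1 _ m _ m], simp, simp, simp, simp,
        subst mult_four_block_mat[of _ 1 1 _ m _ m _ _ 1 _ m]) auto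
  have A'F: "A' * F = F * D"
    unfolding F_def D_def block using P3 D3 A3 AP3
    by (subst (1 2) mult_four_block_mat[of _ 1 1 _ m _ m _ _ 1 _ m]) auto
  define P where "P = W * F"
  have P: "P \<in> carrier_mat ?n ?n" using W F by (simp add: P_def)
  have "transpose_mat P * P = transpose_mat F * ((transpose_mat W * W) * F)"
    unfolding P_def using W F
    by (simp add: transpose_mult[of _ ?n ?n _ ?n] assoc_mult_mat[of _ ?n ?n _ ?n _ ?n])
  also have "\<dots> = 1\<^sub>m ?n" using WW FF F by simp
  finally have 1: "transpose_mat P * P = 1\<^sub>m ?n" .
  have "A * P = (A * W) * F" unfolding P_def using A W F by (simp add: assoc_mult_mat[of _ ?n ?n _ ?n _ ?n])
  also have "\<dots> = W * (A' * F)" unfolding WA'[symmetric] using A' W F by (simp add: assoc_mult_mat[of _ ?n ?n _ ?n _ ?n])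
  also have "\<dots> = P * D" unfolding A'F P_def using W F D by (simp add: assoc_mult_mat[of _ ?n ?n _ ?n _ ?n])
  finally have 2: "A * P = P * D" .
  have "diagonal_mat D"
    unfolding D_def diagonal_mat_def using D3 by (auto simp: diagonal_mat_def)
  then show ?case using P D 1 2 by blast
qed

lemma orthogonal_diagonalization_char_poly:
  fixes A :: "real mat"
  assumes A: "A \<in> carrier_mat n n" and P: "P \<in> carrier_mat n n" and D: "D \<in> carrier_mat n n"
    and diag: "diagonal_mat D" and PP: "transpose_mat P * P = 1\<^sub>m n" and AP: "A * P = P * D"
  shows "proots (char_poly A) = mset (map (\<lambda>i. D $$ (i, i)) [0..<n])"
    and "P * transpose_mat P = 1\<^sub>m n"
proof -
  have Pt: "transpose_mat P \<in> carrier_mat n n" using P by simp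
  show PP': "P * transpose_mat P = 1\<^sub>m n" using mat_mult_left_right_inverse[OF Pt P PP] .
  have "P * D * transpose_mat P = A * (P * transpose_mat P)"
    unfolding AP[symmetric] by (rule assoc_mult_mat[OF A P Pt])
  then have "A = P * D * transpose_mat P" unfolding PP' right_mult_one_mat[OF A] by simp
  then have "similar_mat A D"
    using A P D Pt PP PP' by (intro similar_matI[of _ _ P "transpose_mat P" n]) auto
  then have "char_poly A = char_poly D" by (rule char_poly_similar)
  also have "\<dots> = (\<Prod>a\<leftarrow>diag_mat D. [:- a, 1:])"
    using D diag by (intro char_poly_upper_triangular[of _ n]) (auto simp: diagonal_mat_def upper_triangular_def)
  also have "proots \<dots> = mset (diag_mat D)"
  proof -
    have "proots (\<Prod>a\<leftarrow>as. [:- a, 1:]) = mset as" for as :: "real list"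
    proof (induction as)
      case (Cons a as)
      have "(\<Prod>a\<leftarrow>as. [:- a, 1:]) \<noteq> 0" by (auto simp: prod_list_zero_iff)
      then have "proots ([:- a, 1:] * (\<Prod>a\<leftarrow>as. [:- a, 1:])) =
        proots [:- a, 1:] + proots (\<Prod>a\<leftarrow>as. [:- a, 1:])"
        by (intro proots_mult) auto
      then show ?case using Cons.IH by (simp del: mult_pCons_left)
    qed simp
    then show ?thesis .
  qed
  finally show "proots (char_poly A) = mset (map (\<lambda>i. D $$ (i, i)) [0..<n])"
    using D by (simp add: diag_mat_def)
qed


section \<open>Eigenvalues of graphs\<close>

text \<open>
  The action of the adjacency matrix on functions on the vertices.
\<close>

definition neighbour_sum :: "'a graph \<Rightarrow> ('a \<Rightarrow> real) \<Rightarrow> 'a \<Rightarrow> real" where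
  "neighbour_sum \<Gamma> f x = (\<Sum>y\<in>fst \<Gamma>. of_bool ({x, y} \<in> snd \<Gamma>) * f y)"

text \<open>
  Diagonalisation restated for functions on the vertices, which removes the enumeration of the
  vertices from everything that follows.  The last property is \<open>P P\<^sup>T = 1\<close>; it is used as Parseval's
  identity.
\<close>

theorem graph_eigenbasis:
  assumes fin: "finite (fst \<Gamma>)"
  obtains e :: "nat \<Rightarrow> real" and \<phi> :: "nat \<Rightarrow> 'a \<Rightarrow> real"
  where "graph_eigenvalues \<Gamma> = rev (sort (map e [0..<card (fst \<Gamma>)]))"
    and "\<And>i x. i < card (fst \<Gamma>) \<Longrightarrow> x \<in> fst \<Gamma> \<Longrightarrow> neighbour_sum \<Gamma> (\<phi> i) x = e i * \<phi> i x"
    and "\<And>i. i < card (fst \<Gamma>) \<Longrightarrow> (\<Sum>x\<in>fst \<Gamma>. \<phi> i x * \<phi> i x) = 1"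
    and "\<And>x y. x \<in> fst \<Gamma> \<Longrightarrow> y \<in> fst \<Gamma> \<Longrightarrow> (\<Sum>i<card (fst \<Gamma>). \<phi> i x * \<phi> i y) = of_bool (x = y)"
proof -
  obtain V E where \<Gamma>: "\<Gamma> = (V, E)" by (cases \<Gamma>)
  let ?n = "card V" and ?h = "from_nat_into V"
  have finV: "finite V" using fin \<Gamma> by simp
  have h: "bij_betw ?h {..<?n} V" using bij_betw_from_nat_into_finite[OF finV] .
  define k where "k = inv_into {..<?n} ?h"
  have k: "k x < ?n" "?h (k x) = x" if "x \<in> V" for x
    using that h inv_into_into[of x ?h "{..<?n}"] f_inv_into_f[of x ?h "{..<?n}"]
    by (auto simp: k_def bij_betw_def)
  have kh: "k (?h a) = a" if "a < ?n" for a
    using h that by (simp add: k_def bij_betw_def inv_into_f_f)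
  define A where "A = adjacency_matrix \<Gamma>"
  have A: "A \<in> carrier_mat ?n ?n" and Aij: "A $$ (i, j) = of_bool ({?h i, ?h j} \<in> E)"
    if "i < ?n" "j < ?n" for i j
    using that by (auto simp: A_def adjacency_matrix_def \<Gamma>)
  have A: "A \<in> carrier_mat ?n ?n" by (simp add: A_def adjacency_matrix_def \<Gamma>)
  have "transpose_mat A = A"
    using A by (intro eq_matI) (auto simp: Aij insert_commute)
  from real_symmetric_orthogonally_diagonalizable[OF A this] obtain P D where
    P: "P \<in> carrier_mat ?n ?n" and D: "D \<in> carrier_mat ?n ?n" and diag: "diagonal_mat D"
    and PP: "transpose_mat P * P = 1\<^sub>m ?n" and AP: "A * P = P * D" by blast
  note cp = orthogonal_diagonalization_char_poly[OF A P D diag PP AP]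
  define e where "e i = D $$ (i, i)" for i
  define \<phi> where "\<phi> i x = P $$ (k x, i)" for i x
  have reindex: "(\<Sum>x\<in>V. g x) = (\<Sum>a<?n. g (?h a))" for g :: "'a \<Rightarrow> real"
    using sum.reindex_bij_betw[OF h, of g] by simp
  show ?thesis
  proof (rule that[of e \<phi>])
    show "graph_eigenvalues \<Gamma> = rev (sort (map e [0..<card (fst \<Gamma>)]))"
      unfolding graph_eigenvalues_def A_def[symmetric] cp(1) sorted_list_of_multiset_mset by (simp add: e_def[abs_def] \<Gamma>)
    fix i assume i: "i < card (fst \<Gamma>)"
    then have i': "i < ?n" by (simp add: \<Gamma>)
    show "(\<Sum>x\<in>fst \<Gamma>. \<phi> i x * \<phi> i x) = 1"
    proof -
      have "(transpose_mat P * P) $$ (i, i) = (\<Sum>a<?n. P $$ (a, i) * P $$ (a, i))"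
        using P i' by (simp add: scalar_prod_def lessThan_atLeast0)
      then show ?thesis using PP i' by (simp add: reindex \<Gamma> \<phi>_def kh)
    qed
    fix x assume x: "x \<in> fst \<Gamma>"
    then have x': "x \<in> V" by (simp add: \<Gamma>)
    have "(A * P) $$ (k x, i) = (\<Sum>a<?n. A $$ (k x, a) * P $$ (a, i))"
      using P A i' k[OF x'] by (simp add: scalar_prod_def lessThan_atLeast0)
    also have "\<dots> = (\<Sum>a<?n. of_bool ({x, ?h a} \<in> E) * P $$ (a, i))"
      using k[OF x'] by (intro sum.cong refl) (simp add: Aij)
    also have "\<dots> = neighbour_sum \<Gamma> (\<phi> i) x"
      by (simp add: neighbour_sum_def \<Gamma> reindex \<phi>_def kh)
    also have "(A * P) $$ (k x, i) = (\<Sum>a<?n. P $$ (k x, a) * D $$ (a, i))"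
      unfolding AP using P D i' k[OF x'] by (simp add: scalar_prod_def lessThan_atLeast0)
    also have "\<dots> = (\<Sum>a<?n. if a = i then P $$ (k x, i) * D $$ (i, i) else 0)"
      using D diag i' by (intro sum.cong refl) (auto simp: diagonal_mat_def)
    also have "\<dots> = e i * \<phi> i x" using i' by (simp add: e_def \<phi>_def)
    finally show "neighbour_sum \<Gamma> (\<phi> i) x = e i * \<phi> i x" ..
  next
    fix x y assume "x \<in> fst \<Gamma>" "y \<in> fst \<Gamma>"
    then have xy: "x \<in> V" "y \<in> V" by (simp_all add: \<Gamma>)
    have "(P * transpose_mat P) $$ (k x, k y) = (\<Sum>i<?n. P $$ (k x, i) * P $$ (k y, i))"
      using P k xy by (simp add: scalar_prod_def lessThan_atLeast0)
    moreover have "k x = k y \<longleftrightarrow> x = y" using k(2) xy by metis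
    ultimately show "(\<Sum>i<card (fst \<Gamma>). \<phi> i x * \<phi> i y) = of_bool (x = y)"
      using cp(2) k xy by (auto simp: \<phi>_def \<Gamma> split: if_splits)
  qed
qed

lemma nth_rev_sort_after_top:
  fixes xs :: "real list"
  assumes t: "length (filter (\<lambda>x. x = d) xs) = t"
    and le: "\<And>x. x \<in> set xs \<Longrightarrow> x \<noteq> d \<Longrightarrow> x \<le> \<theta>" and \<theta>: "\<theta> < d" "\<theta> \<in> set xs"
  shows "rev (sort xs) ! t = \<theta>"
proof -
  define ys where "ys = sort (filter (\<lambda>x. x \<noteq> d) xs)"
  have ys: "set ys = {x \<in> set xs. x \<noteq> d}" "sorted ys" by (auto simp: ys_def)
  have ne: "ys \<noteq> []" using \<theta> ys(1) by fastforce
  have "sort xs = ys @ replicate t d"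
  proof (rule properties_for_sort)
    have "filter (\<lambda>x. x = d) xs = replicate t d"
      using t replicate_length_filter[of d xs] by (simp add: eq_commute)
    then have "mset (replicate t d) = filter_mset (\<lambda>x. x = d) (mset xs)" by (metis mset_filter)
    then show "mset (ys @ replicate t d) = mset xs"
      using multiset_partition[of "mset xs" "\<lambda>x. x \<noteq> d"] by (simp add: ys_def)
    show "sorted (ys @ replicate t d)"
      using ys le \<theta> by (fastforce simp: sorted_append)
  qed
  then have "rev (sort xs) ! t = last ys" using ne by (simp add: nth_append rev_nth last_conv_nth)
  moreover have "last ys = \<theta>"
  proof (rule antisym)
    show "last ys \<le> \<theta>" using ne le ys(1) last_in_set[OF ne] by auto
    obtain i where "i < length ys" "ys ! i = \<theta>" using \<theta> ys(1) by (metis (mono_tags, lifting) in_set_conv_nth less_irrefl mem_Collect_eq)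
    then show "\<theta> \<le> last ys" using ne ys(2) by (auto simp: last_conv_nth intro: sorted_nth_mono)
  qed
  ultimately show ?thesis by simp
qed

context
  fixes \<Gamma> :: "'a graph"
  assumes fin: "finite (fst \<Gamma>)"
begin

abbreviation vsum :: "('a \<Rightarrow> real) \<Rightarrow> ('a \<Rightarrow> real) \<Rightarrow> real" where
  "vsum f h \<equiv> (\<Sum>x\<in>fst \<Gamma>. f x * h x)"

lemma neighbour_sum_self_adjoint: "vsum (neighbour_sum \<Gamma> f) h = vsum f (neighbour_sum \<Gamma> h)"
proof -
  have "vsum (neighbour_sum \<Gamma> f) h = (\<Sum>x\<in>fst \<Gamma>. \<Sum>y\<in>fst \<Gamma>. of_bool ({x, y} \<in> snd \<Gamma>) * f y * h x)"
    by (simp add: neighbour_sum_def sum_distrib_right)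
  also have "\<dots> = (\<Sum>y\<in>fst \<Gamma>. \<Sum>x\<in>fst \<Gamma>. of_bool ({x, y} \<in> snd \<Gamma>) * f y * h x)"
    by (rule sum.swap)
  also have "\<dots> = vsum f (neighbour_sum \<Gamma> h)"
    by (simp add: neighbour_sum_def sum_distrib_left insert_commute mult_ac)
  finally show ?thesis .
qed

text \<open>
  Members \<open>\<phi> i\<close> of the eigenbasis with eigenvalue \<open>d\<close> lie in the span of the \<open>u j\<close>: the component
  orthogonal to that span is again an eigenfunction for \<open>d\<close>, and the gap forces it to vanish.  The
  others are orthogonal to the \<open>u j\<close>, so their eigenvalues are at most \<open>\<theta>\<close>.  The multiplicity of \<open>d\<close> is
  \<open>t\<close>, as one sees by summing the squares of the inner products of the \<open>\<phi> i\<close> with the \<open>u j\<close> in both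
  orders.
\<close>

theorem graph_eigenvalue_after_top:
  fixes u :: "nat \<Rightarrow> 'a \<Rightarrow> real"
  assumes on: "\<And>i j. i < t \<Longrightarrow> j < t \<Longrightarrow> vsum (u i) (u j) = of_bool (i = j)"
    and top: "\<And>j x. j < t \<Longrightarrow> x \<in> fst \<Gamma> \<Longrightarrow> neighbour_sum \<Gamma> (u j) x = d * u j x"
    and gap: "\<And>f. (\<And>j. j < t \<Longrightarrow> vsum f (u j) = 0) \<Longrightarrow> vsum f (neighbour_sum \<Gamma> f) \<le> \<theta> * vsum f f"
    and \<theta>: "\<theta> < d"
    and att: "\<And>x. x \<in> fst \<Gamma> \<Longrightarrow> neighbour_sum \<Gamma> g x = \<theta> * g x" "z \<in> fst \<Gamma>" "g z \<noteq> 0"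
  shows "graph_eigenvalue \<Gamma> (t + 1) = \<theta>"
proof -
  let ?n = "card (fst \<Gamma>)"
  obtain e \<phi> where ev: "graph_eigenvalues \<Gamma> = rev (sort (map e [0..<?n]))"
    and eig: "\<And>i x. i < ?n \<Longrightarrow> x \<in> fst \<Gamma> \<Longrightarrow> neighbour_sum \<Gamma> (\<phi> i) x = e i * \<phi> i x"
    and nrm: "\<And>i. i < ?n \<Longrightarrow> vsum (\<phi> i) (\<phi> i) = 1"
    and compl: "\<And>x y. x \<in> fst \<Gamma> \<Longrightarrow> y \<in> fst \<Gamma> \<Longrightarrow> (\<Sum>i<?n. \<phi> i x * \<phi> i y) = of_bool (x = y)"
    by (rule graph_eigenbasis[OF fin]) blast
  have parseval: "(\<Sum>i<?n. (vsum (\<phi> i) f)\<^sup>2) = vsum f f" for f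
  proof -
    have "(\<Sum>i<?n. (vsum (\<phi> i) f)\<^sup>2) = (\<Sum>i<?n. \<Sum>x\<in>fst \<Gamma>. \<Sum>y\<in>fst \<Gamma>. f x * f y * (\<phi> i x * \<phi> i y))"
      by (simp add: power2_eq_square sum_product mult_ac)
    also have "\<dots> = (\<Sum>x\<in>fst \<Gamma>. \<Sum>i<?n. \<Sum>y\<in>fst \<Gamma>. f x * f y * (\<phi> i x * \<phi> i y))"
      by (rule sum.swap)
    also have "\<dots> = (\<Sum>x\<in>fst \<Gamma>. \<Sum>y\<in>fst \<Gamma>. \<Sum>i<?n. f x * f y * (\<phi> i x * \<phi> i y))"
      by (intro sum.cong refl sum.swap)
    also have "\<dots> = (\<Sum>x\<in>fst \<Gamma>. \<Sum>y\<in>fst \<Gamma>. if y = x then f x * f x else 0)"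
      unfolding sum_distrib_left[symmetric] by (intro sum.cong refl) (auto simp: compl)
    also have "\<dots> = vsum f f" using fin by simp
    finally show ?thesis .
  qed
  have orth: "vsum (\<phi> i) f = 0"
    if i: "i < ?n" and f: "\<And>x. x \<in> fst \<Gamma> \<Longrightarrow> neighbour_sum \<Gamma> f x = c * f x" and c: "e i \<noteq> c" for i f c
  proof -
    have "e i * vsum (\<phi> i) f = vsum (neighbour_sum \<Gamma> (\<phi> i)) f"
      by (simp add: sum_distrib_left eig[OF i] mult.assoc)
    also have "\<dots> = c * vsum (\<phi> i) f"
      unfolding neighbour_sum_self_adjoint by (simp add: sum_distrib_left f mult_ac)
    finally show ?thesis using c by simp
  qed
  have low: "e i \<le> \<theta>" if i: "i < ?n" "e i \<noteq> d" for i
  proof -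
    have "vsum (\<phi> i) (neighbour_sum \<Gamma> (\<phi> i)) \<le> \<theta> * vsum (\<phi> i) (\<phi> i)"
      by (intro gap orth[OF i(1) _ i(2)] top)
    moreover have "vsum (\<phi> i) (neighbour_sum \<Gamma> (\<phi> i)) = e i * vsum (\<phi> i) (\<phi> i)"
      by (simp add: sum_distrib_left eig[OF i(1)] mult_ac)
    ultimately show ?thesis using nrm[OF i(1)] by simp
  qed
  have high: "(\<Sum>j<t. (vsum (\<phi> i) (u j))\<^sup>2) = 1" if i: "i < ?n" "e i = d" for i
  proof -
    define c where "c j = vsum (\<phi> i) (u j)" for j
    define r where "r x = \<phi> i x - (\<Sum>j<t. c j * u j x)" for x
    have ru: "vsum r (u j) = 0" if j: "j < t" for j
    proof -
      have "vsum (\<lambda>x. \<Sum>l<t. c l * u l x) (u j) = (\<Sum>l<t. c l * vsum (u l) (u j))"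
        unfolding sum_distrib_left sum_distrib_right by (subst sum.swap) (simp add: mult.assoc)
      also have "\<dots> = (\<Sum>l<t. if l = j then c j else 0)"
        by (intro sum.cong refl) (auto simp: on j)
      also have "\<dots> = c j" using j by simp
      finally show ?thesis by (simp add: r_def left_diff_distrib sum_subtractf c_def)
    qed
    have Ar: "neighbour_sum \<Gamma> r x = d * r x" if x: "x \<in> fst \<Gamma>" for x
    proof -
      have "neighbour_sum \<Gamma> r x = neighbour_sum \<Gamma> (\<phi> i) x - (\<Sum>j<t. c j * neighbour_sum \<Gamma> (u j) x)"
        unfolding neighbour_sum_def r_def right_diff_distrib sum_subtractf sum_distrib_left
        by (subst (2) sum.swap) (simp add: mult_ac)
      then show ?thesis using eig[OF i(1) x] i(2) top x
        by (simp add: r_def right_diff_distrib sum_distrib_left mult_ac)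
    qed
    have "vsum r (neighbour_sum \<Gamma> r) \<le> \<theta> * vsum r r" by (intro gap ru)
    moreover have "vsum r (neighbour_sum \<Gamma> r) = d * vsum r r"
      by (simp add: Ar sum_distrib_left mult_ac)
    moreover have nonneg: "vsum r r \<ge> 0" by (intro sum_nonneg) simp
    ultimately have "(d - \<theta>) * vsum r r \<le> 0" by (simp add: left_diff_distrib)
    then have rr: "vsum r r = 0" using \<theta> nonneg by (simp add: mult_le_0_iff)
    have "vsum r (\<phi> i) = 0"
      using rr fin by (subst (asm) sum_nonneg_eq_0_iff) auto
    moreover have "vsum r (\<phi> i) = vsum (\<phi> i) (\<phi> i) - (\<Sum>j<t. c j * vsum (u j) (\<phi> i))"
      unfolding r_def left_diff_distrib sum_subtractf sum_distrib_left sum_distrib_right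
      by (subst (2) sum.swap) (simp add: mult_ac)
    ultimately show ?thesis using nrm[OF i(1)]
      by (simp add: c_def power2_eq_square mult.commute)
  qed
  have count: "card {i. i < ?n \<and> e i = d} = t"
  proof -
    have "real (card {i. i < ?n \<and> e i = d}) = (\<Sum>i | i < ?n \<and> e i = d. \<Sum>j<t. (vsum (\<phi> i) (u j))\<^sup>2)"
      by (simp add: high)
    also have "\<dots> = (\<Sum>j<t. \<Sum>i | i < ?n \<and> e i = d. (vsum (\<phi> i) (u j))\<^sup>2)" by (rule sum.swap)
    also have "\<dots> = (\<Sum>j<t. \<Sum>i<?n. (vsum (\<phi> i) (u j))\<^sup>2)"
    proof (rule sum.cong[OF refl])
      fix j assume "j \<in> {..<t}"
      then have "vsum (\<phi> i) (u j) = 0" if "i < ?n" "e i \<noteq> d" for i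
        using that by (intro orth[of i "u j" d] top) auto
      then show "(\<Sum>i | i < ?n \<and> e i = d. (vsum (\<phi> i) (u j))\<^sup>2) = (\<Sum>i<?n. (vsum (\<phi> i) (u j))\<^sup>2)"
        by (intro sum.mono_neutral_left) auto
    qed
    also have "\<dots> = real t" by (simp add: parseval on)
    finally show ?thesis by simp
  qed
  have mem: "\<theta> \<in> e ` {..<?n}"
  proof (rule ccontr)
    assume "\<theta> \<notin> e ` {..<?n}"
    then have "vsum (\<phi> i) g = 0" if "i < ?n" for i using orth[OF that att(1)] that by auto
    then have "vsum g g = 0" using parseval[of g] by simp
    then show False using att(2,3) fin by (subst (asm) sum_nonneg_eq_0_iff) auto
  qed
  have "length (filter (\<lambda>x. x = d) (map e [0..<?n])) = t"
    using count by (simp add: filter_map o_def length_filter_conv_card cong: conj_cong)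
  then have "rev (sort (map e [0..<?n])) ! t = \<theta>"
    using low mem \<theta> by (intro nth_rev_sort_after_top[where d = d]) auto
  then show ?thesis by (simp add: graph_eigenvalue_def ev)
qed

text \<open>
  Without loops the trace is 0, and no eigenvalue exceeds the degree.  So the eigenvalues after the
  first one, none of which exceeds the second, sum to at least \<open>- d\<close>.
\<close>

theorem trace_bound_second_eigenvalue:
  assumes loopless: "\<And>x. x \<in> fst \<Gamma> \<Longrightarrow> {x} \<notin> snd \<Gamma>"
    and reg: "\<And>x. x \<in> fst \<Gamma> \<Longrightarrow> neighbour_sum \<Gamma> (\<lambda>y. 1) x = d"
    and n: "card (fst \<Gamma>) \<ge> 2"
  shows "0 \<le> d + (real (card (fst \<Gamma>)) - 1) * graph_eigenvalue \<Gamma> 2"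
proof -
  let ?n = "card (fst \<Gamma>)" and ?K = "\<lambda>x y. of_bool ({x, y} \<in> snd \<Gamma>) :: real"
  obtain e \<phi> where ev: "graph_eigenvalues \<Gamma> = rev (sort (map e [0..<?n]))"
    and eig: "\<And>i x. i < ?n \<Longrightarrow> x \<in> fst \<Gamma> \<Longrightarrow> neighbour_sum \<Gamma> (\<phi> i) x = e i * \<phi> i x"
    and nrm: "\<And>i. i < ?n \<Longrightarrow> vsum (\<phi> i) (\<phi> i) = 1"
    and compl: "\<And>x y. x \<in> fst \<Gamma> \<Longrightarrow> y \<in> fst \<Gamma> \<Longrightarrow> (\<Sum>i<?n. \<phi> i x * \<phi> i y) = of_bool (x = y)"
    by (rule graph_eigenbasis[OF fin]) blast
  have e: "e i = (\<Sum>x\<in>fst \<Gamma>. \<Sum>y\<in>fst \<Gamma>. ?K x y * (\<phi> i x * \<phi> i y))" if i: "i < ?n" for i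
  proof -
    have "vsum (\<phi> i) (neighbour_sum \<Gamma> (\<phi> i)) = e i * vsum (\<phi> i) (\<phi> i)"
      by (simp add: sum_distrib_left eig[OF i] mult_ac)
    then show ?thesis using nrm[OF i] by (simp add: neighbour_sum_def sum_distrib_left mult_ac)
  qed
  have "(\<Sum>i<?n. e i) = (\<Sum>i<?n. \<Sum>x\<in>fst \<Gamma>. \<Sum>y\<in>fst \<Gamma>. ?K x y * (\<phi> i x * \<phi> i y))"
    by (simp add: e)
  also have "\<dots> = (\<Sum>x\<in>fst \<Gamma>. \<Sum>i<?n. \<Sum>y\<in>fst \<Gamma>. ?K x y * (\<phi> i x * \<phi> i y))"
    by (rule sum.swap)
  also have "\<dots> = (\<Sum>x\<in>fst \<Gamma>. \<Sum>y\<in>fst \<Gamma>. ?K x y * (\<Sum>i<?n. \<phi> i x * \<phi> i y))"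
    unfolding sum_distrib_left by (intro sum.cong refl sum.swap)
  also have "\<dots> = 0"
    using loopless by (intro sum.neutral ballI) (auto simp: compl)
  finally have trace: "(\<Sum>i<?n. e i) = 0" .
  have le_d: "e i \<le> d" if i: "i < ?n" for i
  proof -
    have am: "a * b \<le> (a\<^sup>2 + b\<^sup>2) / 2" for a b :: real
      using zero_le_power2[of "a - b"] by (simp add: power2_eq_square algebra_simps)
    have deg: "(\<Sum>y\<in>fst \<Gamma>. ?K x y) = d" if "x \<in> fst \<Gamma>" for x
      using reg[OF that] by (simp add: neighbour_sum_def)
    have "e i \<le> (\<Sum>x\<in>fst \<Gamma>. \<Sum>y\<in>fst \<Gamma>. ?K x y * ((\<phi> i x)\<^sup>2 / 2) + ?K y x * ((\<phi> i y)\<^sup>2 / 2))"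
      unfolding e[OF i]
    proof (intro sum_mono)
      fix x y
      show "?K x y * (\<phi> i x * \<phi> i y) \<le> ?K x y * ((\<phi> i x)\<^sup>2 / 2) + ?K y x * ((\<phi> i y)\<^sup>2 / 2)"
        using am[of "\<phi> i x" "\<phi> i y"] by (simp add: insert_commute)
    qed
    also have "\<dots> = (\<Sum>x\<in>fst \<Gamma>. \<Sum>y\<in>fst \<Gamma>. ?K x y * ((\<phi> i x)\<^sup>2 / 2)) +
      (\<Sum>y\<in>fst \<Gamma>. \<Sum>x\<in>fst \<Gamma>. ?K y x * ((\<phi> i y)\<^sup>2 / 2))"
      unfolding sum.distrib by (subst (3) sum.swap) simp
    also have "\<dots> = (\<Sum>x\<in>fst \<Gamma>. d * ((\<phi> i x)\<^sup>2 / 2)) + (\<Sum>x\<in>fst \<Gamma>. d * ((\<phi> i x)\<^sup>2 / 2))"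
      unfolding sum_distrib_right[symmetric] by (simp add: deg)
    also have "\<dots> = d * vsum (\<phi> i) (\<phi> i)"
      unfolding sum.distrib[symmetric] sum_distrib_left by (simp add: power2_eq_square)
    finally show ?thesis using nrm[OF i] by simp
  qed
  define L where "L = rev (sort (map e [0..<?n]))"
  have "sum_list L = sum_list (map e [0..<?n])"
    by (metis L_def mset_rev mset_sort sum_mset_sum_list)
  also have "\<dots> = 0" using trace by (simp add: interv_sum_list_conv_sum_set_nat lessThan_atLeast0)
  finally have L: "length L = ?n" "set L = e ` {..<?n}" "sum_list L = 0"
    by (auto simp: L_def)
  obtain a b M where abM: "L = a # b # M"
    using L(1) n by (cases L; cases "tl L") auto
  have "sorted (rev L)" by (simp add: L_def)
  then have M: "x \<le> b" if "x \<in> set M" for x using that by (auto simp: abM sorted_append)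
  have "a \<in> e ` {..<?n}" using L(2) abM by (metis list.set_intros(1))
  then have "a \<le> d" using le_d by auto
  have "sum_list M \<le> sum_list (map (\<lambda>_. b) M)"
    using sum_list_mono[of M "\<lambda>x. x" "\<lambda>_. b"] M by simp
  then have "sum_list M \<le> real (length M) * b" by (simp add: sum_list_triv)
  then have "0 \<le> a + (real (length M) + 1) * b" using L(3) by (simp add: abM algebra_simps)
  moreover have "real (length M) + 1 = real ?n - 1" using L(1) by (simp add: abM)
  moreover have "graph_eigenvalue \<Gamma> 2 = b" by (simp add: graph_eigenvalue_def ev L_def[symmetric] abM)
  ultimately show ?thesis using \<open>a \<le> d\<close> by simp
qed

end


section \<open>Averages over sets of permutations\<close>

definition sending :: "'a set \<Rightarrow> 'a \<Rightarrow> 'a \<Rightarrow> ('a \<Rightarrow> 'a) set" where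
  "sending R j i = {g. g permutes R \<and> g j = i}"

definition perms :: "'a set \<Rightarrow> ('a \<Rightarrow> 'a) set" where
  "perms R = {g. g permutes R}"

lemma finite_perms [simp]: "finite R \<Longrightarrow> finite (perms R)"
  by (simp add: perms_def finite_permutations)

lemma sending_subset: "sending R j i \<subseteq> perms R"
  by (auto simp: sending_def perms_def)

lemma finite_sending [simp]: "finite R \<Longrightarrow> finite (sending R j i)"
  by (rule finite_subset[OF sending_subset]) simp

lemma sending_disjoint_to: "i \<noteq> i' \<Longrightarrow> sending R j i \<inter> sending R j i' = {}"
  by (auto simp: sending_def)

lemma sending_disjoint_from: "j \<noteq> j' \<Longrightarrow> sending R j i \<inter> sending R j' i = {}"
  by (auto simp: sending_def) (metis permutes_inverses(2))

lemma perms_UN_to: "j \<in> R \<Longrightarrow> perms R = (\<Union>i\<in>R. sending R j i)"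
  by (auto simp: perms_def sending_def permutes_in_image)

lemma perms_UN_from:
  assumes i: "i \<in> R"
  shows "perms R = (\<Union>j\<in>R. sending R j i)"
proof (intro equalityI subsetI)
  fix g assume g: "g \<in> perms R"
  then have "g permutes R" by (simp add: perms_def)
  then have "Hilbert_Choice.inv g i \<in> R" "g (Hilbert_Choice.inv g i) = i"
    using i permutes_in_image[OF permutes_inv] permutes_inverses(1) by metis+
  then show "g \<in> (\<Union>j\<in>R. sending R j i)"
    using g by (intro UN_I[of "Hilbert_Choice.inv g i"]) (simp_all add: perms_def sending_def)
qed (auto simp: perms_def sending_def)

lemma perms_mono: "S \<subseteq> R \<Longrightarrow> perms S \<subseteq> perms R"
  by (auto simp: perms_def intro: permutes_subset)

lemma id_in_perms [simp]: "id \<in> perms R" by (simp add: perms_def permutes_id)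

lemma perms_remove: "i \<in> R \<Longrightarrow> perms (R - {i}) = sending R i i"
proof -
  assume i: "i \<in> R"
  have "g permutes R - {i} \<longleftrightarrow> g permutes R \<and> g i = i" for g
  proof
    assume "g permutes R - {i}"
    then show "g permutes R \<and> g i = i"
      by (meson DiffE Diff_subset insertI1 permutes_not_in permutes_subset)
  next
    assume "g permutes R \<and> g i = i"
    then show "g permutes R - {i}" by (auto intro: permutes_superset[of g R "R - {i}"])
  qed
  then show ?thesis by (simp add: perms_def sending_def)
qed

lemma image_comp_perms:
  assumes c: "c \<in> perms R"
  shows "(\<circ>) c ` perms R = perms R"
proof (intro equalityI subsetI)
  fix g assume "g \<in> (\<circ>) c ` perms R"
  then show "g \<in> perms R" using c by (auto simp: perms_def intro: permutes_compose)
next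
  fix g assume g: "g \<in> perms R"
  have "Hilbert_Choice.inv c \<circ> g \<in> perms R" using c g by (auto simp: perms_def intro: permutes_compose permutes_inv)
  moreover have "g = c \<circ> (Hilbert_Choice.inv c \<circ> g)"
    using c by (simp add: perms_def o_assoc permutes_inv_o)
  ultimately show "g \<in> (\<circ>) c ` perms R" by blast
qed

lemma image_comp_sending:
  assumes c: "c \<in> perms R"
  shows "(\<circ>) c ` sending R k j = sending R k (c j)"
proof (intro equalityI subsetI)
  fix g assume "g \<in> (\<circ>) c ` sending R k j"
  then show "g \<in> sending R k (c j)"
    using c by (auto simp: perms_def sending_def intro: permutes_compose)
next
  fix g assume g: "g \<in> sending R k (c j)"
  have "Hilbert_Choice.inv c \<circ> g \<in> sending R k j"
    using c g by (auto simp: perms_def sending_def intro: permutes_compose permutes_inv permutes_inverses)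
  moreover have "g = c \<circ> (Hilbert_Choice.inv c \<circ> g)"
    using c by (simp add: perms_def o_assoc permutes_inv_o)
  ultimately show "g \<in> (\<circ>) c ` sending R k j" by blast
qed

lemma inv_image_sending: "Hilbert_Choice.inv ` sending R j i = sending R i j"
proof -
  have *: "Hilbert_Choice.inv g \<in> sending R i j" if "g \<in> sending R j i" for g i j
    using that permutes_inv[of g R] permutes_inverses(2)[of g R]
    by (auto simp: sending_def)
  show ?thesis
  proof (intro equalityI subsetI)
    fix g assume g: "g \<in> sending R i j"
    then have "Hilbert_Choice.inv (Hilbert_Choice.inv g) = g" using permutes_inv_inv by (auto simp: sending_def)
    then show "g \<in> Hilbert_Choice.inv ` sending R j i" using *[OF g] by (metis imageI)
  qed (use * in auto)
qed

lemma inv_image_perms: "Hilbert_Choice.inv ` perms R = perms R"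
proof -
  have *: "Hilbert_Choice.inv g \<in> perms R" if "g \<in> perms R" for g
    using that permutes_inv[of g R] by (auto simp: perms_def)
  show ?thesis
  proof (intro equalityI subsetI)
    fix g assume g: "g \<in> perms R"
    then have "Hilbert_Choice.inv (Hilbert_Choice.inv g) = g" using permutes_inv_inv by (auto simp: perms_def)
    then show "g \<in> Hilbert_Choice.inv ` perms R" using *[OF g] by (metis imageI)
  qed (use * in auto)
qed

lemma inj_on_comp: "c permutes R \<Longrightarrow> inj_on ((\<circ>) c) D"
  by (rule inj_onI) (metis comp_assoc comp_id id_comp permutes_inv_o(2))

lemma transpose_sending: "i \<in> R \<Longrightarrow> j \<in> R \<Longrightarrow> Transposition.transpose i j \<in> sending R j i"
  by (auto simp: sending_def permutes_swap_id)

lemma card_sending_eq: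
  assumes "i \<in> R" "i' \<in> R"
  shows "card (sending R j i) = card (sending R j i')"
proof -
  let ?t = "Transposition.transpose i' i"
  have t: "?t \<in> perms R" using transpose_sending[OF assms(2,1)] by (auto simp: sending_def perms_def)
  have "card ((\<circ>) ?t ` sending R j i) = card (sending R j i)"
    using t by (intro card_image inj_on_comp[of _ R]) (simp add: perms_def)
  then show ?thesis unfolding image_comp_sending[OF t] by simp
qed

lemma card_sending:
  assumes R: "finite R" and "i \<in> R" "j \<in> R"
  shows "card R * card (sending R j i) = card (perms R)"
proof -
  have "card (perms R) = (\<Sum>a\<in>R. card (sending R j a))"
    unfolding perms_UN_to[OF assms(3)]
    by (rule card_UN_disjoint) (simp_all add: R sending_disjoint_to)
  also have "\<dots> = (\<Sum>a\<in>R. card (sending R j i))"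
    using assms(2) by (intro sum.cong refl card_sending_eq) auto
  finally show ?thesis by simp
qed

lemma card_perms_pos: "finite R \<Longrightarrow> card (perms R) > 0"
  using id_in_perms[of R] finite_perms[of R] by (auto simp: card_gt_0_iff simp del: id_in_perms)

lemma card_sending_pos: "finite R \<Longrightarrow> i \<in> R \<Longrightarrow> j \<in> R \<Longrightarrow> card (sending R j i) > 0"
  using transpose_sending[of i R j] by (auto simp: card_gt_0_iff)


definition avg :: "('a \<Rightarrow> 'a) set \<Rightarrow> (('a \<Rightarrow> 'a) \<Rightarrow> real) \<Rightarrow> ('a \<Rightarrow> 'a) \<Rightarrow> real" where
  "avg C f x = (\<Sum>g\<in>C. f (x \<circ> g)) / card C"

lemma perms_nonempty [simp]: "perms R \<noteq> {}"
  using id_in_perms by blast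

lemma sending_nonempty: "i \<in> R \<Longrightarrow> j \<in> R \<Longrightarrow> sending R j i \<noteq> {}"
  using transpose_sending by fast

text \<open>
  All composition laws for averages over subgroups and cosets of the symmetric group are instances of
  this one: the products of an element of \<open>C\<close> with the elements of \<open>D\<close> are the elements of \<open>E\<close>.
\<close>

lemma avg_avg:
  assumes R: "finite R" and C: "C \<subseteq> perms R" "C \<noteq> {}"
    and E: "\<And>c. c \<in> C \<Longrightarrow> (\<circ>) c ` D = E"
  shows "avg C (avg D f) = avg E f"
proof
  fix x
  have *: "avg D f (x \<circ> c) = avg E f x" if c: "c \<in> C" for c
  proof -
    have inj: "inj_on ((\<circ>) c) D" using C c inj_on_comp by (auto simp: perms_def)
    have "(\<Sum>e\<in>E. f (x \<circ> e)) = (\<Sum>g\<in>D. f (x \<circ> (c \<circ> g)))"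
      using E[OF c] sum.reindex[OF inj, of "\<lambda>e. f (x \<circ> e)"] by (auto simp: o_def)
    moreover have "card E = card D" using E[OF c] card_image[OF inj] by auto
    ultimately show ?thesis by (simp add: avg_def o_assoc)
  qed
  have "avg C (avg D f) x = (\<Sum>c\<in>C. avg E f x) / card C"
    unfolding avg_def[of C] using * by simp
  moreover have "finite C" using finite_subset[OF C(1)] R by simp
  ultimately show "avg C (avg D f) x = avg E f x" using C by simp
qed

lemma avg_perms_avg_perms:
  assumes "finite R" "S \<subseteq> R"
  shows "avg (perms S) (avg (perms R) f) = avg (perms R) f"
  using perms_mono[OF assms(2)]
  by (intro avg_avg[OF assms(1)] image_comp_perms) auto

lemma avg_sending_avg_perms:
  assumes "finite R" "i \<in> R" "j \<in> R"
  shows "avg (sending R j i) (avg (perms R) f) = avg (perms R) f"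
  using sending_subset[of R j i] sending_nonempty[OF assms(2,3)]
  by (intro avg_avg[OF assms(1)] image_comp_perms) auto

lemma avg_sending_avg_sending:
  assumes "finite R" "i \<in> R" "j \<in> R"
  shows "avg (sending R j i) (avg (sending R k j) f) = avg (sending R k i) f"
proof (rule avg_avg[OF assms(1) sending_subset sending_nonempty[OF assms(2,3)]])
  fix c assume "c \<in> sending R j i"
  then show "(\<circ>) c ` sending R k j = sending R k i"
    using image_comp_sending[of c R k j] by (auto simp: perms_def sending_def)
qed

lemma avg_perms_avg_sending:
  assumes "finite R" "S \<subseteq> R" "i \<notin> S"
  shows "avg (perms S) (avg (sending R k i) f) = avg (sending R k i) f"
proof (rule avg_avg[OF assms(1) perms_mono[OF assms(2)] perms_nonempty])
  fix c assume c: "c \<in> perms S"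
  then have "c i = i" using assms(3) by (auto simp: perms_def permutes_def)
  then show "(\<circ>) c ` sending R k i = sending R k i"
    using image_comp_sending[of c R k i] c perms_mono[OF assms(2)] by auto
qed

lemma sum_avg_sending_to:
  assumes R: "finite R" and j: "j \<in> R"
  shows "(\<Sum>i\<in>R. avg (sending R j i) f x) = card R * avg (perms R) f x"
proof -
  have "(\<Sum>g\<in>perms R. f (x \<circ> g)) = (\<Sum>i\<in>R. \<Sum>g\<in>sending R j i. f (x \<circ> g))"
    unfolding perms_UN_to[OF j]
    by (rule sum.UNION_disjoint) (simp_all add: R sending_disjoint_to)
  moreover have "avg (sending R j i) f x = card R * (\<Sum>g\<in>sending R j i. f (x \<circ> g)) / card (perms R)"
    if "i \<in> R" for i
    using card_sending[OF R that j, symmetric] R that by (auto simp: avg_def card_gt_0_iff)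
  ultimately show ?thesis by (simp add: avg_def sum_distrib_left sum_divide_distrib)
qed

lemma sum_avg_sending_from:
  assumes R: "finite R" and i: "i \<in> R"
  shows "(\<Sum>j\<in>R. avg (sending R j i) f x) = card R * avg (perms R) f x"
proof -
  have "(\<Sum>g\<in>perms R. f (x \<circ> g)) = (\<Sum>j\<in>R. \<Sum>g\<in>sending R j i. f (x \<circ> g))"
    unfolding perms_UN_from[OF i]
    by (rule sum.UNION_disjoint) (simp_all add: R sending_disjoint_from)
  moreover have "avg (sending R j i) f x = card R * (\<Sum>g\<in>sending R j i. f (x \<circ> g)) / card (perms R)"
    if "j \<in> R" for j
    using card_sending[OF R i that, symmetric] R that by (auto simp: avg_def card_gt_0_iff)
  ultimately show ?thesis by (simp add: avg_def sum_distrib_left sum_divide_distrib)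
qed

text \<open>
  Double transitivity enters here.  If \<open>c\<close> sends \<open>j\<close> to \<open>i\<close> and \<open>d\<close> sends \<open>l\<close> to \<open>k \<noteq> j\<close>, then \<open>c \<circ> d\<close>
  sends \<open>l\<close> to \<open>c k\<close>, which is uniformly distributed on \<open>R - {i}\<close>.
\<close>

lemma avg_sending_avg_sending_neq:
  assumes R: "finite R" and ij: "i \<in> R" "j \<in> R" "k \<in> R" "l \<in> R" and jk: "j \<noteq> k"
  shows "avg (sending R j i) (avg (sending R l k) f) x =
    (card R * avg (perms R) f x - avg (sending R l i) f x) / (real (card R) - 1)"
proof -
  let ?C = "sending R j i"
  define N where "N a = {c \<in> ?C. c k = a}" for a
  have fin: "finite ?C" using R by simp
  have inner: "avg (sending R l k) f (x \<circ> c) = avg (sending R l (c k)) f x" if "c \<in> ?C" for c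
  proof -
    have c: "c \<in> perms R" using that by (simp add: sending_def perms_def)
    have "avg {c} (avg (sending R l k) f) = avg (sending R l (c k)) f"
      using c image_comp_sending[OF c, of l k] by (intro avg_avg[OF R]) auto
    moreover have "avg {c} h x = h (x \<circ> c)" for h by (simp add: avg_def)
    ultimately show ?thesis by metis
  qed
  have eq: "card (N a) = card (N a')" if a: "a \<in> R - {i}" "a' \<in> R - {i}" for a a'
  proof -
    let ?t = "Transposition.transpose a a'"
    have t: "?t permutes R" using a by (auto intro: permutes_swap_id)
    have tt: "?t \<circ> (?t \<circ> g) = g" for g by (simp add: o_assoc)
    have ti: "?t i = i" using a by (auto simp: transpose_def)
    have mem: "?t \<circ> g \<in> N b'" if "g \<in> N b" "?t b = b'" for g b b'
      using that t ti permutes_compose[OF _ t, of g] by (auto simp: N_def sending_def)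
    have "bij_betw ((\<circ>) ?t) (N a) (N a')"
    proof (rule bij_betw_byWitness[where f' = "(\<circ>) ?t"])
      show "(\<circ>) ?t ` N a \<subseteq> N a'" using mem by auto
      show "(\<circ>) ?t ` N a' \<subseteq> N a" using mem by auto
    qed (simp_all add: tt)
    then show ?thesis by (rule bij_betw_same_card)
  qed
  have C: "?C = (\<Union>a\<in>R - {i}. N a)"
  proof (intro equalityI subsetI)
    fix c assume c: "c \<in> ?C"
    then have "c k \<in> R" "c k \<noteq> i"
      using ij jk permutes_in_image[of c R k] permutes_inj[of c R]
      by (auto simp: sending_def inj_eq)
    then show "c \<in> (\<Union>a\<in>R - {i}. N a)" using c by (auto simp: N_def)
  qed (auto simp: N_def)
  have disj: "\<forall>a\<in>R - {i}. \<forall>b\<in>R - {i}. a \<noteq> b \<longrightarrow> N a \<inter> N b = {}" by (auto simp: N_def)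
  have finN: "finite (N a)" for a using fin by (simp add: N_def)
  have M: "real (card R) - 1 = card (R - {i})"
  proof -
    have "card R > 0" using R ij by (auto simp: card_gt_0_iff)
    then show ?thesis using R ij by (simp add: card_Diff_singleton of_nat_diff)
  qed
  have cardC: "card ?C = (real (card R) - 1) * card (N a)" if "a \<in> R - {i}" for a
  proof -
    have "card ?C = (\<Sum>b\<in>R - {i}. card (N b))"
      unfolding C using R disj finN by (intro card_UN_disjoint) auto
    also have "\<dots> = (\<Sum>b\<in>R - {i}. card (N a))" by (intro sum.cong refl eq) (use that in auto)
    finally have "card ?C = card (R - {i}) * card (N a)" by simp
    then show ?thesis unfolding M by (metis of_nat_mult)
  qed
  have "(\<Sum>c\<in>?C. avg (sending R l k) f (x \<circ> c)) = (\<Sum>c\<in>?C. avg (sending R l (c k)) f x)"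
    using inner by simp
  also have "\<dots> = (\<Sum>a\<in>R - {i}. \<Sum>c\<in>N a. avg (sending R l (c k)) f x)"
    unfolding C using R disj finN by (subst sum.UNION_disjoint) auto
  also have "\<dots> = (\<Sum>a\<in>R - {i}. card (N a) * avg (sending R l a) f x)"
    by (intro sum.cong refl) (simp add: N_def)
  finally have S: "(\<Sum>c\<in>?C. avg (sending R l k) f (x \<circ> c)) =
    (\<Sum>a\<in>R - {i}. card (N a) * avg (sending R l a) f x)" .
  have pos: "card ?C > 0" using card_sending_pos[OF R ij(1,2)] .
  have "avg ?C (avg (sending R l k) f) x = (\<Sum>a\<in>R - {i}. card (N a) * avg (sending R l a) f x / card ?C)"
    unfolding avg_def[of ?C] S by (simp add: sum_divide_distrib)
  also have "\<dots> = (\<Sum>a\<in>R - {i}. avg (sending R l a) f x / (real (card R) - 1))"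
  proof (intro sum.cong refl)
    fix a assume a: "a \<in> R - {i}"
    then have "real (card R) - 1 \<noteq> 0" "real (card (N a)) \<noteq> 0" using cardC[OF a] pos by (metis mult_eq_0_iff of_nat_eq_0_iff less_irrefl)+
    then show "card (N a) * avg (sending R l a) f x / card ?C = avg (sending R l a) f x / (real (card R) - 1)"
      unfolding cardC[OF a] by simp
  qed
  also have "\<dots> = ((\<Sum>a\<in>R. avg (sending R l a) f x) - avg (sending R l i) f x) / (real (card R) - 1)"
    using R ij by (simp add: sum_divide_distrib sum_diff1 diff_divide_distrib)
  finally show ?thesis using sum_avg_sending_to[OF R ij(4)] by simp
qed


section \<open>Invariants after the removal of two points\<close>

locale perm_functions =
  fixes X :: "'a set"
  assumes finite_X: "finite X"
begin

definition inn :: "(('a \<Rightarrow> 'a) \<Rightarrow> real) \<Rightarrow> (('a \<Rightarrow> 'a) \<Rightarrow> real) \<Rightarrow> real" where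
  "inn f h = (\<Sum>x\<in>perms X. f x * h x)"

lemma inn_commute: "inn f h = inn h f"
  by (simp add: inn_def mult.commute)

lemma inn_add_left: "inn (\<lambda>x. f x + f' x) h = inn f h + inn f' h"
  and inn_diff_left: "inn (\<lambda>x. f x - f' x) h = inn f h - inn f' h"
  and inn_scale_left: "inn (\<lambda>x. c * f x) h = c * inn f h"
  and inn_sum_left: "inn (\<lambda>x. \<Sum>i\<in>I. F i x) h = (\<Sum>i\<in>I. inn (F i) h)"
  by (simp_all add: inn_def sum.distrib sum_subtractf sum_distrib_left sum_distrib_right
      distrib_right left_diff_distrib mult.assoc sum.swap[of _ I])

lemma inn_add_right: "inn h (\<lambda>x. f x + f' x) = inn h f + inn h f'"
  and inn_diff_right: "inn h (\<lambda>x. f x - f' x) = inn h f - inn h f'"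
  and inn_scale_right: "inn h (\<lambda>x. c * f x) = c * inn h f"
  and inn_sum_right: "inn h (\<lambda>x. \<Sum>i\<in>I. F i x) = (\<Sum>i\<in>I. inn h (F i))"
  by (simp_all add: inn_commute[of h] inn_add_left inn_diff_left inn_scale_left inn_sum_left)

lemmas inn_bilinear = inn_add_left inn_diff_left inn_scale_left inn_sum_left
  inn_add_right inn_diff_right inn_scale_right inn_sum_right

lemma inn_nonneg: "inn f f \<ge> 0"
  unfolding inn_def by (intro sum_nonneg) simp

lemma inn_translate:
  assumes g: "g \<in> perms X"
  shows "inn (\<lambda>x. f (x \<circ> g)) h = inn f (\<lambda>x. h (x \<circ> Hilbert_Choice.inv g))"
proof -
  have g': "g permutes X" using g by (simp add: perms_def)
  show ?thesis unfolding inn_def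
  proof (rule sum.reindex_bij_witness[of _ "\<lambda>x. x \<circ> Hilbert_Choice.inv g" "\<lambda>x. x \<circ> g"])
    fix x assume "x \<in> perms X"
    then show "x \<circ> g \<in> perms X" "x \<circ> Hilbert_Choice.inv g \<in> perms X"
      using g' by (auto simp: perms_def intro: permutes_compose permutes_inv)
    show "x \<circ> g \<circ> Hilbert_Choice.inv g = x" "x \<circ> Hilbert_Choice.inv g \<circ> g = x"
      by (simp_all add: comp_assoc permutes_inv_o[OF g'])
  qed (simp_all add: comp_assoc permutes_inv_o[OF g'])
qed

lemma inn_avg:
  assumes C: "C \<subseteq> perms X"
  shows "inn (avg C f) h = inn f (avg (Hilbert_Choice.inv ` C) h)"
proof -
  have inj: "inj_on Hilbert_Choice.inv C"
    by (rule inj_onI) (metis C mem_Collect_eq perms_def permutes_inv_inv subsetD)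
  have eq: "avg C f = (\<lambda>x. (1 / card C) * (\<Sum>g\<in>C. f (x \<circ> g)))"
    "avg (Hilbert_Choice.inv ` C) h = (\<lambda>x. (1 / card C) * (\<Sum>g\<in>C. h (x \<circ> Hilbert_Choice.inv g)))"
    by (auto simp: avg_def card_image[OF inj] sum.reindex[OF inj])
  show ?thesis unfolding eq inn_scale_left inn_scale_right inn_sum_left inn_sum_right
    using C by (intro arg_cong[where f = "\<lambda>s. _ * s"] sum.cong refl inn_translate) auto
qed

lemma inn_avg_perms:
  assumes "R \<subseteq> X"
  shows "inn (avg (perms R) f) h = inn f (avg (perms R) h)"
  using inn_avg[OF perms_mono[OF assms]] by (simp add: inv_image_perms)

lemma inn_avg_sending:
  assumes "R \<subseteq> X"
  shows "inn (avg (sending R j i) f) h = inn f (avg (sending R i j) h)"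
  using inn_avg[OF order_trans[OF sending_subset perms_mono[OF assms]]] by (simp add: inv_image_sending)

definition proj_form :: "(('a \<Rightarrow> 'a) \<Rightarrow> real) \<Rightarrow> 'a set \<Rightarrow> real" where
  "proj_form f R = inn f (avg (perms R) f)"

lemma proj_form_eq_norm:
  assumes "R \<subseteq> X"
  shows "proj_form f R = inn (avg (perms R) f) (avg (perms R) f)"
  using assms finite_subset[OF assms finite_X]
  by (simp add: inn_avg_perms proj_form_def avg_perms_avg_perms)

end

locale perm_functions_on = perm_functions X for X :: "'a set" +
  fixes R :: "'a set" and f :: "('a \<Rightarrow> 'a) \<Rightarrow> real"
  assumes RX: "R \<subseteq> X"
begin

lemma finite_R: "finite R" using RX finite_X finite_subset by blast

definition centred :: "'a \<Rightarrow> 'a \<Rightarrow> ('a \<Rightarrow> 'a) \<Rightarrow> real" where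
  "centred i j = (\<lambda>x. avg (sending R j i) f x - avg (perms R) f x)"

definition kappa :: "'a \<Rightarrow> 'a \<Rightarrow> real" where
  "kappa i j = inn f (centred i j)"

lemma kappa_eq: "kappa i j = inn f (avg (sending R j i) f) - proj_form f R"
  unfolding kappa_def centred_def inn_diff_right proj_form_def ..

lemma kappa_commute: "kappa i j = kappa j i"
  unfolding kappa_eq using inn_avg_sending[OF RX, of i j f f] by (simp add: inn_commute)

lemma kappa_diag: "i \<in> R \<Longrightarrow> kappa i i = proj_form f (R - {i}) - proj_form f R"
  unfolding kappa_eq by (simp add: proj_form_def perms_remove)

lemma sum_kappa:
  assumes "i \<in> R" shows "(\<Sum>j\<in>R. kappa i j) = 0"
proof -
  have "(\<Sum>j\<in>R. inn f (avg (sending R j i) f)) = inn f (\<lambda>x. \<Sum>j\<in>R. avg (sending R j i) f x)"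
    by (simp add: inn_sum_right)
  also have "\<dots> = card R * proj_form f R"
    using sum_avg_sending_from[OF finite_R assms] by (simp add: inn_scale_right proj_form_def)
  finally show ?thesis by (simp add: kappa_eq sum_subtractf)
qed

lemma inn_centred_avg_perms:
  assumes "i \<in> R" "j \<in> R"
  shows "inn (avg (perms R) f) (centred i j) = 0"
proof -
  have "inn (avg (perms R) f) (avg (sending R j i) f) = inn (avg (sending R i j) (avg (perms R) f)) f"
    using inn_avg_sending[OF RX, of i j] by simp
  also have "\<dots> = proj_form f R"
    using assms finite_R by (simp add: avg_sending_avg_perms proj_form_def inn_commute)
  finally show ?thesis
    by (simp add: centred_def inn_diff_right proj_form_eq_norm[OF RX])
qed

text \<open>
  For fixed \<open>j\<close> the functions \<open>centred i j\<close>, \<open>i \<in> R\<close>, are the vertices of a regular simplex with centre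
  0.  The angle between two vertices is the source of the constant \<open>- 1 / (card R - 1)\<close>.
\<close>

lemma inn_centred:
  assumes "i \<in> R" "j \<in> R" "k \<in> R" "l \<in> R"
  shows "inn (centred i j) (centred k l) =
    (if i = k then kappa j l else - kappa j l / (real (card R) - 1))"
proof -
  let ?c = "proj_form f R" and ?M = "real (card R)"
  have 1: "inn (centred i j) (centred k l) = inn (avg (sending R j i) f) (avg (sending R l k) f) - ?c"
    using inn_centred_avg_perms[OF assms(3,4)] inn_centred_avg_perms[OF assms(1,2)]
      proj_form_eq_norm[OF RX, of f]
    by (simp add: centred_def inn_bilinear inn_commute)
  have 2: "inn (avg (sending R j i) f) (avg (sending R l k) f) =
    inn f (avg (sending R i j) (avg (sending R l k) f))"
    by (rule inn_avg_sending[OF RX])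
  show ?thesis
  proof (cases "i = k")
    case True
    then show ?thesis using assms finite_R
      unfolding 1 2 by (simp add: avg_sending_avg_sending kappa_eq)
  next
    case False
    have "card R \<ge> card {i, k}" using assms finite_R by (intro card_mono) auto
    then have M: "?M - 1 > 0" using False by simp
    have "avg (sending R i j) (avg (sending R l k) f) =
      (\<lambda>x. (1 / (?M - 1)) * (?M * avg (perms R) f x - avg (sending R l j) f x))"
      using avg_sending_avg_sending_neq[OF finite_R assms(2,1,3,4) False] by auto
    then have "inn f (avg (sending R i j) (avg (sending R l k) f)) =
      (1 / (?M - 1)) * (?M * ?c - inn f (avg (sending R l j) f))"
      by (simp only: inn_bilinear proj_form_def)
    also have "\<dots> = (1 / (?M - 1)) * (?M * ?c - (kappa j l + ?c))" by (simp add: kappa_eq)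
    finally show ?thesis using False M unfolding 1 2 by (simp add: field_simps)
  qed
qed

text \<open>
  The function \<open>w\<close> below is the part of \<open>f\<close> that is invariant under the permutations of \<open>R - {i, j}\<close>,
  without the part invariant under all permutations of \<open>R\<close>.  The parts invariant under the
  permutations of \<open>R - {i}\<close> and of \<open>R - {j}\<close> live in two subspaces at a constant angle with cosine
  \<open>\<bar>\<alpha>\<bar> < 1\<close>.  The orthogonal projection of \<open>w\<close> to the sum of these subspaces is \<open>v\<close> divided by
  \<open>1 - \<alpha>\<^sup>2\<close>, and the claim is that it is not longer than \<open>w\<close>.
\<close>

lemma pair_inequality:
  assumes ij: "i \<in> R" "j \<in> R" "i \<noteq> j" and M: "card R \<ge> 3"
  defines "\<alpha> \<equiv> - 1 / (real (card R) - 1)"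
  shows "(1 - \<alpha>\<^sup>2) * (proj_form f (R - {i, j}) - proj_form f R) \<ge>
    kappa i i + kappa j j - 2 * \<alpha> * kappa i j"
proof -
  let ?S = "R - {i, j}"
  define \<beta> where "\<beta> = 1 / (1 - \<alpha>\<^sup>2)"
  define w where "w = (\<lambda>x. avg (perms ?S) f x - avg (perms R) f x)"
  define v where "v = (\<lambda>x. (centred i i x + centred j j x) - \<alpha> * (centred i j x + centred j i x))"
  have "\<bar>\<alpha>\<bar> < 1" unfolding \<alpha>_def using M by (simp add: field_simps)
  then have pos: "1 - \<alpha>\<^sup>2 > 0" by (simp add: abs_square_less_1)
  have SX: "?S \<subseteq> X" using RX by auto
  have wu: "inn w (centred a b) = kappa a b" if ab: "a \<in> {i, j}" "b \<in> {i, j}" for a b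
  proof -
    have "inn (avg (perms ?S) f) (avg (sending R b a) f) = inn f (avg (sending R b a) f)"
      using ab finite_R unfolding inn_avg_perms[OF SX] by (subst avg_perms_avg_sending) auto
    moreover have "inn (avg (perms ?S) f) (avg (perms R) f) = proj_form f R"
      unfolding inn_avg_perms[OF SX] proj_form_def
      using finite_R by (subst avg_perms_avg_perms) auto
    moreover have "inn (avg (perms R) f) (centred a b) = 0"
      using ab ij by (intro inn_centred_avg_perms) auto
    ultimately show ?thesis
      by (simp add: w_def inn_diff_left kappa_eq) (simp add: centred_def inn_diff_right)
  qed
  have ww: "inn w w = proj_form f ?S - proj_form f R"
  proof -
    have "inn (avg (perms ?S) f) (avg (perms R) f) = proj_form f R"
      unfolding inn_avg_perms[OF SX] proj_form_def
      using finite_R by (subst avg_perms_avg_perms) auto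
    then show ?thesis
      using proj_form_eq_norm[OF SX, of f] proj_form_eq_norm[OF RX, of f]
        inn_commute[of "avg (perms R) f" "avg (perms ?S) f"]
      by (simp add: w_def inn_bilinear)
  qed
  let ?K = "kappa i i + kappa j j - 2 * \<alpha> * kappa i j"
  have wv: "inn w v = ?K"
    unfolding v_def inn_bilinear using wu kappa_commute[of j i] by (simp add: algebra_simps)
  have cc: "inn (centred a b) (centred c d) = (if a = c then kappa b d else \<alpha> * kappa b d)"
    if "a \<in> {i, j}" "b \<in> {i, j}" "c \<in> {i, j}" "d \<in> {i, j}" for a b c d
    using that ij inn_centred[of a b c d] by (auto simp: \<alpha>_def)
  have vv: "inn v v = (1 - \<alpha>\<^sup>2) * ?K"
    unfolding v_def inn_bilinear using cc ij kappa_commute[of j i]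
    by (simp add: algebra_simps power2_eq_square)
  have "0 \<le> inn (\<lambda>x. w x - \<beta> * v x) (\<lambda>x. w x - \<beta> * v x)" by (rule inn_nonneg)
  also have "\<dots> = inn w w - 2 * \<beta> * inn w v + \<beta> * (\<beta> * inn v v)"
    unfolding inn_bilinear inn_commute[of v w] by (simp add: algebra_simps)
  also have "\<dots> = inn w w - 2 * \<beta> * ?K + \<beta> * (\<beta> * ((1 - \<alpha>\<^sup>2) * ?K))"
    unfolding wv vv ..
  also have "\<beta> * (\<beta> * ((1 - \<alpha>\<^sup>2) * ?K)) = \<beta> * ?K" using pos by (simp add: \<beta>_def)
  finally have "\<beta> * ?K \<le> inn w w" by simp
  then have "?K \<le> (1 - \<alpha>\<^sup>2) * inn w w" using pos by (simp add: \<beta>_def field_simps)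
  then show ?thesis unfolding ww .
qed

text \<open>
  Since \<open>kappa i\<close> sums to 0, the mixed terms add up to \<open>- kappa i i\<close>, and the factor \<open>1 - \<alpha>\<^sup>2\<close> cancels.
  What remains is a quantitative form of a dimension count: in a representation, the invariants of the
  permutations of \<open>R - {i, j}\<close> contain those for \<open>R - {i}\<close> and those for \<open>R - {j}\<close>; these two spaces have
  the same dimension and meet in the invariants of the permutations of \<open>R\<close>.
\<close>

lemma summed_pair_inequality:
  assumes M: "card R \<ge> 3"
  shows "2 * (real (card R) - 1) * (\<Sum>i\<in>R. proj_form f (R - {i}) - proj_form f R) \<le>
    (\<Sum>i\<in>R. \<Sum>j\<in>R - {i}. proj_form f (R - {i} - {j}) - proj_form f R)"
proof -
  let ?M = "real (card R)"
  define \<alpha> where "\<alpha> = - 1 / (?M - 1)"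
  define K where "K = (\<Sum>i\<in>R. kappa i i)"
  have "\<bar>\<alpha>\<bar> < 1" unfolding \<alpha>_def using M by (simp add: field_simps)
  then have pos: "1 - \<alpha>\<^sup>2 > 0" by (simp add: abs_square_less_1)
  have M1: "(\<Sum>j\<in>R - {i}. c) = (?M - 1) * c" if "i \<in> R" for i and c :: real
  proof -
    have "card R > 0" using M by simp
    then show ?thesis using that finite_R by (simp add: card_Diff_singleton of_nat_diff)
  qed
  have off: "(\<Sum>j\<in>R - {i}. kappa i j) = - kappa i i" if "i \<in> R" for i
    using sum_kappa[OF that] that finite_R by (simp add: sum_diff1)
  have diag: "(\<Sum>j\<in>R - {i}. kappa j j) = K - kappa i i" if "i \<in> R" for i
    using that finite_R by (simp add: sum_diff1 K_def)
  have "2 * (?M - 1) * (1 - \<alpha>\<^sup>2) * K = 2 * (?M - 1) * K + 2 * \<alpha> * K"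
  proof -
    define r where "r = ?M - 1"
    have "r \<noteq> 0" using M by (simp add: r_def)
    then show ?thesis unfolding \<alpha>_def r_def[symmetric] by (simp add: power2_eq_square field_simps)
  qed
  also have "\<dots> = (\<Sum>i\<in>R. (?M - 1) * kappa i i + (K - kappa i i) + 2 * \<alpha> * kappa i i)"
    by (simp add: sum.distrib sum_subtractf K_def[symmetric] sum_distrib_left[symmetric] algebra_simps)
  also have "\<dots> = (\<Sum>i\<in>R. \<Sum>j\<in>R - {i}. kappa i i + kappa j j - 2 * \<alpha> * kappa i j)"
    by (intro sum.cong refl)
       (simp add: sum.distrib sum_subtractf M1 diag sum_distrib_left[symmetric] off del: sum_constant)
  also have "\<dots> \<le> (\<Sum>i\<in>R. \<Sum>j\<in>R - {i}. (1 - \<alpha>\<^sup>2) * (proj_form f (R - {i} - {j}) - proj_form f R))"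
  proof (intro sum_mono)
    fix i j assume "i \<in> R" "j \<in> R - {i}"
    moreover have "R - {i} - {j} = R - {i, j}" by auto
    ultimately show "kappa i i + kappa j j - 2 * \<alpha> * kappa i j
      \<le> (1 - \<alpha>\<^sup>2) * (proj_form f (R - {i} - {j}) - proj_form f R)"
      using pair_inequality[of i j] M unfolding \<alpha>_def by auto
  qed
  also have "\<dots> = (1 - \<alpha>\<^sup>2) * (\<Sum>i\<in>R. \<Sum>j\<in>R - {i}. proj_form f (R - {i} - {j}) - proj_form f R)"
    by (simp add: sum_distrib_left)
  finally have "(1 - \<alpha>\<^sup>2) * (2 * (?M - 1) * K) \<le>
    (1 - \<alpha>\<^sup>2) * (\<Sum>i\<in>R. \<Sum>j\<in>R - {i}. proj_form f (R - {i} - {j}) - proj_form f R)"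
    by (simp add: mult_ac)
  then have "2 * (?M - 1) * K \<le> (\<Sum>i\<in>R. \<Sum>j\<in>R - {i}. proj_form f (R - {i} - {j}) - proj_form f R)"
    using pos by simp
  then show ?thesis by (simp add: K_def kappa_diag)
qed

end


section \<open>Levels and support sizes\<close>

lemma sum_removals:
  assumes X: "finite (X :: 'a set)"
  shows "(\<Sum>R | R \<subseteq> X \<and> card R = Suc m. \<Sum>i\<in>R. \<Phi> (R - {i})) =
    real (card X - m) * (\<Sum>S | S \<subseteq> X \<and> card S = m. \<Phi> S)"
proof -
  let ?A = "{R. R \<subseteq> X \<and> card R = Suc m}" and ?B = "{S. S \<subseteq> X \<and> card S = m}"
  have fin: "finite ?A" "finite ?B" using X by auto
  have sub: "finite S" if "S \<subseteq> X" for S using that X finite_subset by blast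
  have "(\<Sum>R\<in>?A. \<Sum>i\<in>R. \<Phi> (R - {i})) = (\<Sum>(R, i)\<in>(SIGMA R:?A. R). \<Phi> (R - {i}))"
    using fin sub by (intro sum.Sigma) auto
  also have "\<dots> = (\<Sum>(S, i)\<in>(SIGMA S:?B. X - S). \<Phi> S)"
  proof (rule sum.reindex_bij_witness[of _ "\<lambda>(S, i). (insert i S, i)" "\<lambda>(R, i). (R - {i}, i)"])
    fix a assume "a \<in> (SIGMA R:?A. R)"
    then obtain R i where a: "a = (R, i)" "R \<subseteq> X" "card R = Suc m" "i \<in> R" by auto
    then show "(case a of (R, i) \<Rightarrow> (R - {i}, i)) \<in> (SIGMA S:?B. X - S)"
      using sub[of R] by auto
    show "(case case a of (R, i) \<Rightarrow> (R - {i}, i) of (S, i) \<Rightarrow> (insert i S, i)) = a"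
      using a by auto
    show "(case case a of (R, i) \<Rightarrow> (R - {i}, i) of (S, i) \<Rightarrow> \<Phi> S) = (case a of (R, i) \<Rightarrow> \<Phi> (R - {i}))"
      using a by simp
  next
    fix b assume "b \<in> (SIGMA S:?B. X - S)"
    then obtain S i where b: "b = (S, i)" "S \<subseteq> X" "card S = m" "i \<in> X" "i \<notin> S" by auto
    then show "(case b of (S, i) \<Rightarrow> (insert i S, i)) \<in> (SIGMA R:?A. R)"
      using sub[of S] by auto
    show "(case case b of (S, i) \<Rightarrow> (insert i S, i) of (R, i) \<Rightarrow> (R - {i}, i)) = b"
      using b by auto
  qed
  also have "\<dots> = (\<Sum>S\<in>?B. \<Sum>i\<in>X - S. \<Phi> S)"
    using fin X by (intro sum.Sigma[symmetric]) auto
  also have "\<dots> = (\<Sum>S\<in>?B. real (card X - m) * \<Phi> S)"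
    by (intro sum.cong refl) (use sub in \<open>simp add: card_Diff_subset\<close>)
  finally show ?thesis by (simp add: sum_distrib_left)
qed

lemma binomial_step: "real (Suc k) * real (n choose Suc k) = real (n - k) * real (n choose k)"
  using binomial_absorption[of k n] binomial_absorb_comp[of n k] by (metis of_nat_mult)

context perm_functions
begin

definition level_sum :: "(('a \<Rightarrow> 'a) \<Rightarrow> real) \<Rightarrow> nat \<Rightarrow> real" where
  "level_sum f m = (\<Sum>S | S \<subseteq> X \<and> card S = m. proj_form f S)"

text \<open>
  For \<open>f\<close> in the isotypic component of an irreducible representation \<open>V\<close>, this is \<open>inn f f\<close> times the
  fraction of the dimension of \<open>V\<close> that is taken up by the vectors invariant under the permutations of
  an \<open>m\<close>-element set.
\<close>

definition level :: "(('a \<Rightarrow> 'a) \<Rightarrow> real) \<Rightarrow> nat \<Rightarrow> real" where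
  "level f m = level_sum f m / real (card X choose m)"

lemma card_subsets: "card {S. S \<subseteq> X \<and> card S = m} = card X choose m"
  using n_subsets[OF finite_X] by simp

lemma level_sum_eq: "m \<le> card X \<Longrightarrow> level_sum f m = real (card X choose m) * level f m"
  by (simp add: level_def)

lemma sum_sum_proj_form:
  assumes "m < card X"
  shows "(\<Sum>R | R \<subseteq> X \<and> card R = Suc m. \<Sum>i\<in>R. proj_form f (R - {i})) =
    real (Suc m) * real (card X choose Suc m) * level f m"
  using binomial_step[of m "card X"] assms
  by (simp add: sum_removals[OF finite_X] level_sum_def[symmetric] level_sum_eq)

text \<open>
  The mean of the pair inequality over all \<open>R\<close> with \<open>m + 2\<close> elements.  Convexity cannot
  start at 0, where the decreasing sequence of levels is constant for one step; correspondingly, the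
  angle in the pair inequality degenerates when \<open>R\<close> has only two elements.
\<close>

theorem level_convex:
  assumes m: "1 \<le> m" "m + 2 \<le> card X"
  shows "level f m - 2 * level f (m + 1) + level f (m + 2) \<ge> 0"
proof -
  let ?B = "real (card X choose (m + 2))"
  let ?R = "{R. R \<subseteq> X \<and> card R = Suc (Suc m)}"
  have B: "?B > 0" using m by simp
  have cardR: "real (card ?R) = ?B" using card_subsets[of "Suc (Suc m)"] by simp
  have s2: "(\<Sum>R\<in>?R. proj_form f R) = ?B * level f (m + 2)"
    using level_sum_eq[of "m + 2" f] m by (simp add: level_sum_def)
  have s2': "(\<Sum>R\<in>?R. c * proj_form f R) = c * (?B * level f (m + 2))" for c
    unfolding s2[symmetric] by (rule sum_distrib_left[symmetric])
  have s1: "(\<Sum>R\<in>?R. \<Sum>i\<in>R. proj_form f (R - {i})) = (m + 2) * ?B * level f (m + 1)"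
    using sum_sum_proj_form[of "Suc m" f] m by simp
  have s0: "(\<Sum>R\<in>?R. \<Sum>i\<in>R. \<Sum>j\<in>R - {i}. proj_form f (R - {i} - {j})) =
    (m + 1) * ((m + 2) * ?B) * level f m"
  proof -
    have "(\<Sum>R\<in>?R. \<Sum>i\<in>R. \<Sum>j\<in>R - {i}. proj_form f (R - {i} - {j})) =
      real (card X - Suc m) * (real (Suc m) * real (card X choose Suc m) * level f m)"
      using sum_removals[OF finite_X, of "\<lambda>S. \<Sum>j\<in>S. proj_form f (S - {j})" "Suc m"]
        sum_sum_proj_form[of m f] m by simp
    also have "\<dots> = real (Suc m) * (real (card X - Suc m) * real (card X choose Suc m)) * level f m"
      by simp
    finally show ?thesis unfolding binomial_step[of "Suc m", symmetric] by simp
  qed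
  have "(\<Sum>R\<in>?R. 2 * real (m + 1) * (\<Sum>i\<in>R. proj_form f (R - {i}) - proj_form f R)) \<le>
    (\<Sum>R\<in>?R. \<Sum>i\<in>R. \<Sum>j\<in>R - {i}. proj_form f (R - {i} - {j}) - proj_form f R)"
  proof (rule sum_mono)
    fix R assume R: "R \<in> ?R"
    then interpret perm_functions_on X R f by unfold_locales auto
    show "2 * real (m + 1) * (\<Sum>i\<in>R. proj_form f (R - {i}) - proj_form f R) \<le>
      (\<Sum>i\<in>R. \<Sum>j\<in>R - {i}. proj_form f (R - {i} - {j}) - proj_form f R)"
      using summed_pair_inequality R m by simp
  qed
  also have "(\<Sum>R\<in>?R. 2 * real (m + 1) * (\<Sum>i\<in>R. proj_form f (R - {i}) - proj_form f R)) =
    2 * real (m + 1) * ((\<Sum>R\<in>?R. \<Sum>i\<in>R. proj_form f (R - {i})) - (\<Sum>R\<in>?R. real (m + 2) * proj_form f R))"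
    by (simp add: sum_subtractf sum_distrib_left[symmetric])
  also have "\<dots> = 2 * (m + 1) * ((m + 2) * ?B * level f (m + 1) - (m + 2) * ?B * level f (m + 2))"
    unfolding s1 s2' by simp
  also have "(\<Sum>R\<in>?R. \<Sum>i\<in>R. \<Sum>j\<in>R - {i}. proj_form f (R - {i} - {j}) - proj_form f R) =
    (\<Sum>R\<in>?R. \<Sum>i\<in>R. \<Sum>j\<in>R - {i}. proj_form f (R - {i} - {j})) -
    (\<Sum>R\<in>?R. real (m + 1) * real (m + 2) * proj_form f R)"
  proof -
    have "(\<Sum>i\<in>R. \<Sum>j\<in>R - {i}. proj_form f R) = real (m + 1) * real (m + 2) * proj_form f R"
      if "R \<in> ?R" for R
    proof -
      have "finite R" using that finite_X finite_subset by blast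
      then have "(\<Sum>i\<in>R. \<Sum>j\<in>R - {i}. proj_form f R) = (\<Sum>i\<in>R. real (m + 1) * proj_form f R)"
        using that by (intro sum.cong refl) simp
      then show ?thesis using that by simp
    qed
    then show ?thesis by (simp only: sum_subtractf cong: sum.cong)
  qed
  also have "\<dots> = (m + 1) * ((m + 2) * ?B) * level f m - (m + 1) * (m + 2) * (?B * level f (m + 2))"
    unfolding s0 s2' by (simp add: algebra_simps)
  finally have "((m + 1) * ((m + 2) * ?B)) * (2 * (level f (m + 1) - level f (m + 2))) \<le>
    ((m + 1) * ((m + 2) * ?B)) * (level f m - level f (m + 2))"
    by (simp add: algebra_simps)
  then have "2 * (level f (m + 1) - level f (m + 2)) \<le> level f m - level f (m + 2)"
    using B mult_le_cancel_left_pos[of "(m + 1) * ((m + 2) * ?B)"] by simp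
  then show ?thesis by simp
qed

lemma level_nonneg: "level f m \<ge> 0"
  unfolding level_def level_sum_def
  by (intro divide_nonneg_nonneg sum_nonneg) (auto simp: proj_form_eq_norm inn_nonneg)

lemma proj_form_full: "proj_form f X = (\<Sum>x\<in>perms X. f x)\<^sup>2 / real (card (perms X))"
proof -
  have "(\<Sum>g\<in>perms X. f (x \<circ> g)) = (\<Sum>g\<in>perms X. f g)" if x: "x \<in> perms X" for x
    using sum.reindex[OF inj_on_comp[of x X "perms X"], of f] x image_comp_perms[OF x]
    by (simp add: perms_def o_def)
  then have "proj_form f X = (\<Sum>x\<in>perms X. f x * ((\<Sum>g\<in>perms X. f g) / card (perms X)))"
    by (simp add: proj_form_def inn_def avg_def)
  then show ?thesis by (simp add: sum_distrib_right[symmetric] power2_eq_square sum_divide_distrib[symmetric])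
qed

lemma level_full:
  assumes "(\<Sum>x\<in>perms X. f x) = 0"
  shows "level f (card X) = 0"
proof -
  have "{S. S \<subseteq> X \<and> card S = card X} = {X}"
    using finite_X card_subset_eq by blast
  then show ?thesis using assms by (simp add: level_def level_sum_def proj_form_full)
qed

lemma perms_small:
  assumes "S \<subseteq> X" "card S \<le> 1" shows "perms S = {id}"
proof -
  have "finite S" using assms finite_X finite_subset by blast
  then have "S = {} \<or> (\<exists>a. S = {a})"
    using assms by (metis card_0_eq card_1_singletonE le_neq_implies_less less_one)
  then show ?thesis by (auto simp: perms_def permutes_sing)
qed

lemma level_low:
  assumes "m \<le> 1" "m \<le> card X"
  shows "level f m = inn f f"
proof -
  have "avg {id} f = f" by (rule ext) (simp add: avg_def)
  then have "proj_form f S = inn f f" if "S \<subseteq> X" "card S = m" for S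
    using perms_small[OF that(1)] that assms by (simp add: proj_form_def)
  then have "level_sum f m = (\<Sum>S | S \<subseteq> X \<and> card S = m. inn f f)"
    unfolding level_sum_def by (intro sum.cong) auto
  then show ?thesis using assms by (simp add: level_def card_subsets)
qed

definition moved :: "('a \<Rightarrow> 'a) \<Rightarrow> 'a set" where
  "moved g = {i \<in> X. g i \<noteq> i}"

definition translate_form :: "(('a \<Rightarrow> 'a) \<Rightarrow> real) \<Rightarrow> ('a \<Rightarrow> 'a) \<Rightarrow> real" where
  "translate_form f g = inn f (\<lambda>x. f (x \<circ> g))"

definition support_form :: "(('a \<Rightarrow> 'a) \<Rightarrow> real) \<Rightarrow> nat \<Rightarrow> real" where
  "support_form f k = (\<Sum>g | g \<in> perms X \<and> card (moved g) = k. translate_form f g)"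

text \<open>
  The normalisation is chosen so that passing from these numbers to the levels is convolution with
  \<open>1 / fact j\<close>, and passing back is convolution with \<open>(-1) ^ j / fact j\<close>.
\<close>

definition support_mean :: "(('a \<Rightarrow> 'a) \<Rightarrow> real) \<Rightarrow> nat \<Rightarrow> real" where
  "support_mean f k = support_form f k * fact (card X - k) / fact (card X)"

lemma perms_moved:
  assumes S: "S \<subseteq> X"
  shows "perms S = {g. g \<in> perms X \<and> moved g \<subseteq> S}"
proof (intro equalityI subsetI)
  fix g assume g: "g \<in> perms S"
  then have "g permutes S" by (simp add: perms_def)
  then have "moved g \<subseteq> S" unfolding moved_def using permutes_not_in by fastforce
  then show "g \<in> {g. g \<in> perms X \<and> moved g \<subseteq> S}" using g perms_mono[OF S] by auto
next
  fix g assume g: "g \<in> {g. g \<in> perms X \<and> moved g \<subseteq> S}"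
  then have 1: "g permutes X" and 2: "\<And>x. x \<in> X - S \<Longrightarrow> g x = x"
    by (auto simp: perms_def moved_def)
  have "g permutes S" by (rule permutes_superset[OF 1 2])
  then show "g \<in> perms S" by (simp add: perms_def)
qed

lemma card_supersets:
  assumes D: "D \<subseteq> X" "m \<le> card X"
  shows "card {S. (S \<subseteq> X \<and> card S = m) \<and> D \<subseteq> S} =
    (if card D \<le> m then (card X - card D) choose (m - card D) else 0)"
proof (cases "card D \<le> m")
  case True
  have finD: "finite D" using D finite_X finite_subset by blast
  have "bij_betw (\<lambda>S. S - D) {S. (S \<subseteq> X \<and> card S = m) \<and> D \<subseteq> S} {S. S \<subseteq> X - D \<and> card S = m - card D}"
  proof (rule bij_betw_byWitness[where f' = "\<lambda>S. S \<union> D"])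
    show "(\<lambda>S. S - D) ` {S. (S \<subseteq> X \<and> card S = m) \<and> D \<subseteq> S} \<subseteq> {S. S \<subseteq> X - D \<and> card S = m - card D}"
      using finD by (auto simp: card_Diff_subset)
    show "(\<lambda>S. S \<union> D) ` {S. S \<subseteq> X - D \<and> card S = m - card D} \<subseteq> {S. (S \<subseteq> X \<and> card S = m) \<and> D \<subseteq> S}"
    proof (rule image_subsetI)
      fix S assume S: "S \<in> {S. S \<subseteq> X - D \<and> card S = m - card D}"
      then have "finite S" "S \<inter> D = {}" using finite_X finite_subset by auto
      then have "card (S \<union> D) = m" using S True finD by (simp add: card_Un_disjoint)
      then show "S \<union> D \<in> {S. (S \<subseteq> X \<and> card S = m) \<and> D \<subseteq> S}" using S D by auto
    qed
  qed auto
  then have "card {S. (S \<subseteq> X \<and> card S = m) \<and> D \<subseteq> S} = card {S. S \<subseteq> X - D \<and> card S = m - card D}"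
    by (rule bij_betw_same_card)
  also have "\<dots> = card (X - D) choose (m - card D)"
    using finite_X by (intro n_subsets) simp
  finally show ?thesis using True D finD by (simp add: card_Diff_subset)
next
  case False
  have "{S. (S \<subseteq> X \<and> card S = m) \<and> D \<subseteq> S} = {}"
    using False card_mono[OF finite_subset[OF _ finite_X]] by fastforce
  then show ?thesis using False by (simp del: Collect_empty_eq)
qed

text \<open>
  A permutation \<open>g\<close> permutes \<open>S\<close> iff \<open>S\<close> contains all points moved by \<open>g\<close>; it remains to count such \<open>S\<close>.
\<close>

lemma level_eq_sum_support_mean:
  assumes m: "m \<le> card X"
  shows "level f m = (\<Sum>k\<le>m. support_mean f k / fact (m - k))"
proof -
  let ?n = "card X"
  let ?S = "{S. S \<subseteq> X \<and> card S = m}"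
  define w where "w k = (if k \<le> m then real ((?n - k) choose (m - k)) else 0)" for k
  have finS: "finite ?S" using finite_X by simp
  have pf: "proj_form f S = (\<Sum>g | g \<in> perms X \<and> moved g \<subseteq> S. translate_form f g) / fact m"
    if "S \<in> ?S" for S
  proof -
    have "finite S" "S \<subseteq> X" "card S = m" using that finite_X finite_subset by auto
    then have cp: "card (perms S) = fact m" by (simp add: perms_def card_permutations)
    have "avg (perms S) f = (\<lambda>x. (1 / fact m) * (\<Sum>g\<in>perms S. f (x \<circ> g)))"
      by (auto simp: avg_def cp)
    then have "proj_form f S = (1 / fact m) * (\<Sum>g\<in>perms S. translate_form f g)"
      unfolding proj_form_def translate_form_def by (simp only: inn_bilinear)
    then show ?thesis using perms_moved[OF \<open>S \<subseteq> X\<close>] by simp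
  qed
  have moved_card: "card (moved g) \<le> ?n" for g
    using finite_X by (intro card_mono) (auto simp: moved_def)
  have "level_sum f m = (\<Sum>S\<in>?S. \<Sum>g | g \<in> perms X \<and> moved g \<subseteq> S. translate_form f g) / fact m"
    unfolding level_sum_def sum_divide_distrib[where A = ?S] using pf by (intro sum.cong refl) auto
  also have "(\<Sum>S\<in>?S. \<Sum>g | g \<in> perms X \<and> moved g \<subseteq> S. translate_form f g) =
    (\<Sum>g\<in>perms X. \<Sum>S | S \<in> ?S \<and> moved g \<subseteq> S. translate_form f g)"
    using finS finite_X by (intro sum.swap_restrict) auto
  also have "\<dots> = (\<Sum>g\<in>perms X. w (card (moved g)) * translate_form f g)"
  proof (intro sum.cong refl)
    fix g
    have "moved g \<subseteq> X" by (auto simp: moved_def)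
    then show "(\<Sum>S | S \<in> ?S \<and> moved g \<subseteq> S. translate_form f g) = w (card (moved g)) * translate_form f g"
      using card_supersets[of "moved g" m] m by (simp add: w_def)
  qed
  also have "\<dots> = (\<Sum>k\<le>?n. \<Sum>g | g \<in> perms X \<and> card (moved g) = k. w (card (moved g)) * translate_form f g)"
    using finite_X moved_card by (intro sum.group[symmetric]) auto
  also have "\<dots> = (\<Sum>k\<le>?n. w k * support_form f k)"
    unfolding support_form_def sum_distrib_left by (intro sum.cong refl) auto
  also have "\<dots> = (\<Sum>k\<le>m. w k * support_form f k)"
    using m by (intro sum.mono_neutral_right) (auto simp: w_def)
  finally have "level f m = (\<Sum>k\<le>m. w k * support_form f k / fact m / real (?n choose m))"
    by (simp add: level_def sum_divide_distrib)
  also have "\<dots> = (\<Sum>k\<le>m. support_mean f k / fact (m - k))"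
  proof (intro sum.cong refl)
    fix k assume "k \<in> {..m}"
    then have k: "k \<le> m" by simp
    have 1: "real ((?n - k) choose (m - k)) = fact (?n - k) / (fact (m - k) * fact (?n - m))"
      using k m binomial_fact[of "m - k" "?n - k", where 'a = real] by simp
    have 2: "real (?n choose m) = fact ?n / (fact m * fact (?n - m))"
      using m by (rule binomial_fact)
    show "w k * support_form f k / fact m / real (?n choose m) = support_mean f k / fact (m - k)"
      using k unfolding w_def support_mean_def 1 2 by (simp add: field_simps)
  qed
  finally show ?thesis .
qed

lemma alternating_exp_convolution:
  "(\<Sum>j\<le>r. (-1) ^ j / (fact j * fact (r - j))) = (if r = 0 then 1 else (0::real))"
proof -
  have "(\<Sum>j\<le>r. (-1) ^ j / (fact j * fact (r - j))) = (\<Sum>j\<le>r. (-1) ^ j * real (r choose j)) / fact r"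
    unfolding sum_divide_distrib by (intro sum.cong refl) (simp add: binomial_fact)
  then show ?thesis using choose_alternating_sum[of r, where 'a = real] by auto
qed

theorem support_mean_eq_sum_level:
  assumes k: "k \<le> card X"
  shows "support_mean f k = (\<Sum>j\<le>k. (-1) ^ j / fact j * level f (k - j))"
proof -
  have "(\<Sum>j\<le>k. (-1) ^ j / fact j * level f (k - j)) =
    (\<Sum>j\<le>k. \<Sum>i\<le>k - j. (-1) ^ j / fact j * (support_mean f i / fact (k - j - i)))"
    using k by (simp add: level_eq_sum_support_mean sum_distrib_left)
  also have "\<dots> = (\<Sum>j\<in>{..k}. \<Sum>i | i \<in> {..k} \<and> i + j \<le> k. (-1) ^ j / fact j * (support_mean f i / fact (k - j - i)))"
    by (intro sum.cong refl) auto
  also have "\<dots> = (\<Sum>i\<in>{..k}. \<Sum>j | j \<in> {..k} \<and> i + j \<le> k. (-1) ^ j / fact j * (support_mean f i / fact (k - j - i)))"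
    by (intro sum.swap_restrict) auto
  also have "\<dots> = (\<Sum>i\<in>{..k}. support_mean f i * (\<Sum>j\<le>k - i. (-1) ^ j / (fact j * fact (k - i - j))))"
    unfolding sum_distrib_left by (intro sum.cong refl) (auto simp: diff_diff_eq add.commute)
  also have "\<dots> = (\<Sum>i\<in>{..k}. if i = k then support_mean f i else 0)"
    unfolding alternating_exp_convolution by (intro sum.cong refl) auto
  finally show ?thesis by simp
qed

end


section \<open>Derangement numbers and convex sequences\<close>

text \<open>
  The proportion of derangements among the permutations of \<open>i\<close> points.
\<close>

definition derange_ratio :: "nat \<Rightarrow> real" where
  "derange_ratio i = (\<Sum>j\<le>i. (-1) ^ j / fact j)"

lemma derange_ratio_Suc: "derange_ratio (Suc i) = derange_ratio i + (-1) ^ Suc i / fact (Suc i)"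
  by (simp add: derange_ratio_def)

lemma derange_ratio_0 [simp]: "derange_ratio 0 = 1"
  by (simp add: derange_ratio_def)

lemma derange_ratio_1 [simp]: "derange_ratio (Suc 0) = 0"
  by (simp add: derange_ratio_Suc)

lemma derange_ratio_2: "derange_ratio 2 = 1 / 2"
  by (simp add: derange_ratio_def numeral_eq_Suc)

lemma derange_ratio_3: "derange_ratio 3 = 1 / 3"
  by (simp add: derange_ratio_def numeral_eq_Suc)

lemma derange_ratio_4: "derange_ratio 4 = 3 / 8"
  by (simp add: derange_ratio_def numeral_eq_Suc)

lemma derange_ratio_5: "derange_ratio 5 = 11 / 30"
  by (simp add: derange_ratio_def numeral_eq_Suc)

lemma derange_ratio_recurrence:
  "real (k + 2) * derange_ratio (k + 2) = real (k + 1) * derange_ratio (k + 1) + derange_ratio k"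
proof -
  have f: "fact (Suc (Suc k)) = real (k + 2) * fact (Suc k)" by (simp add: algebra_simps)
  have gen: "x * (b + s / (x * F)) = x * b + s / F" if "x \<noteq> 0" for x b s F :: real
    using that by (simp add: field_simps)
  have "real (k + 2) * derange_ratio (k + 2) =
    real (k + 2) * derange_ratio (k + 1) + (-1) ^ k / fact (Suc k)"
    unfolding add_2_eq_Suc' derange_ratio_Suc[of "Suc k"] f
    using gen[of "real (k + 2)" "derange_ratio (Suc k)" "(-1) ^ k" "fact (Suc k)"]
    by (simp del: fact_Suc)
  moreover have "derange_ratio (k + 1) = derange_ratio k - (-1) ^ k / fact (Suc k)"
    by (simp add: derange_ratio_Suc)
  ultimately show ?thesis by (simp add: algebra_simps)
qed

lemma derange_ratio_ge_odd:
  assumes a: "odd a"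
  shows "derange_ratio a \<le> derange_ratio (a + 2 * r) \<and> derange_ratio a \<le> derange_ratio (a + 2 * r + 1)"
proof (induction r)
  case 0
  then show ?case using a by (simp add: derange_ratio_Suc)
next
  case (Suc r)
  let ?b = "a + 2 * r"
  have "odd ?b" using a by simp
  have "(1::real) / fact (Suc (Suc ?b)) \<le> 1 / fact (Suc ?b)"
    by (intro divide_left_mono fact_mono mult_pos_pos) auto
  then have 1: "derange_ratio ?b \<le> derange_ratio (Suc (Suc ?b))"
    using \<open>odd ?b\<close> by (simp only: derange_ratio_Suc) simp
  have 2: "derange_ratio (Suc (Suc ?b)) \<le> derange_ratio (Suc (Suc (Suc ?b)))"
    using \<open>odd ?b\<close> by (simp only: derange_ratio_Suc[of "Suc (Suc ?b)"]) simp
  show ?case using 1 2 Suc by simp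
qed

lemma derange_ratio_ge:
  assumes "odd a" "a \<le> i" shows "derange_ratio a \<le> derange_ratio i"
proof (cases "even (i - a)")
  case True
  then obtain r where "i - a = 2 * r" by (elim evenE)
  then have "i = a + 2 * r" using assms by simp
  then show ?thesis using derange_ratio_ge_odd[OF assms(1)] by blast
next
  case False
  then obtain r where "i - a = 2 * r + 1" by (elim oddE)
  then have "i = a + 2 * r + 1" using assms by simp
  then show ?thesis using derange_ratio_ge_odd[OF assms(1)] by blast
qed

lemma derange_ratio_ge_third: "2 \<le> i \<Longrightarrow> derange_ratio i \<ge> 1 / 3"
  using derange_ratio_ge[of 3 i] by (cases "i = 2") (auto simp: derange_ratio_2 derange_ratio_3)

lemma derange_ratio_ge_11_30: "4 \<le> i \<Longrightarrow> derange_ratio i \<ge> 11 / 30"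
  using derange_ratio_ge[of 5 i] by (cases "i = 4") (auto simp: derange_ratio_4 derange_ratio_5)

lemma derange_ratio_nonneg: "derange_ratio i \<ge> 0"
  using derange_ratio_ge[of 1 i] by (cases "i = 0") auto

lemma fact_ge_3_Suc: "4 \<le> j \<Longrightarrow> (fact j :: real) \<ge> 3 * (real j + 1)"
proof (induction j rule: dec_induct)
  case base
  then show ?case by (simp add: fact_numeral)
next
  case (step j)
  have "3 * (real (Suc j) + 1) \<le> 5 * (3 * (real j + 1))" by simp
  also have "\<dots> \<le> (real j + 1) * (3 * (real j + 1))" using step(1) by (intro mult_right_mono) auto
  also have "\<dots> \<le> (real j + 1) * fact j" using step.IH by (intro mult_left_mono) auto
  finally show ?case by (simp add: algebra_simps)
qed

text \<open>
  For \<open>j = 2\<close> this fails: \<open>j * derange_ratio j / (j + 1)\<close> is \<open>1/3\<close> at 2, drops to \<open>1/4\<close> at 3 and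
  increases from there on.
\<close>

lemma derange_ratio_scaled_step:
  assumes j: "3 \<le> j"
  shows "real j * derange_ratio j / (real j + 1) \<le> real (j + 1) * derange_ratio (j + 1) / (real j + 2)"
proof (cases "j = 3")
  case True
  then show ?thesis by (simp add: derange_ratio_3 derange_ratio_4)
next
  case False
  define b where "b = derange_ratio j"
  define e where "e = (real j + 1)\<^sup>2 / fact (Suc j)"
  have j4: "4 \<le> j" using j False by simp
  have "fact (Suc j) = (real j + 1) * fact j" by simp
  then have "e = (real j + 1) / fact j" by (simp add: e_def power2_eq_square del: fact_Suc)
  also have "\<dots> \<le> 1 / 3" using fact_ge_3_Suc[OF j4] by (simp add: field_simps)
  also have "\<dots> \<le> b" unfolding b_def using j by (intro derange_ratio_ge_third) simp
  finally have e: "e \<le> b" .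
  have "derange_ratio (j + 1) \<ge> b - 1 / fact (Suc j)"
    unfolding b_def by (cases "even j") (simp_all add: derange_ratio_Suc)
  then have "(real j + 1)\<^sup>2 * derange_ratio (j + 1) \<ge> (real j + 1)\<^sup>2 * (b - 1 / fact (Suc j))"
    by (intro mult_left_mono) auto
  also have "(real j + 1)\<^sup>2 * (b - 1 / fact (Suc j)) = (real j + 1)\<^sup>2 * b - e"
    unfolding e_def by (simp add: algebra_simps del: fact_Suc)
  finally have "(real j + 1)\<^sup>2 * derange_ratio (j + 1) \<ge> real j * (real j + 2) * b"
    using e by (simp add: power2_eq_square algebra_simps)
  then show ?thesis unfolding b_def[symmetric]
    by (simp add: divide_simps power2_eq_square) (simp add: algebra_simps)
qed

lemma derange_ratio_scaled_mono:
  assumes "3 \<le> j" "j \<le> k"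
  shows "real j * derange_ratio j / (real j + 1) \<le> real k * derange_ratio k / (real k + 1)"
  using assms(2,1)
proof (induction k rule: dec_induct)
  case (step k)
  then show ?case using derange_ratio_scaled_step[of k] by (simp add: add.commute)
qed simp

text \<open>
  The sum subtracted in \<open>alternating_sum_by_parts\<close>, for a sequence whose differences
  \<open>q m - q (Suc m)\<close> are 1 for \<open>1 \<le> m \<le> s\<close> and 0 otherwise.
\<close>

definition deficiency :: "nat \<Rightarrow> nat \<Rightarrow> real" where
  "deficiency k s = (\<Sum>m\<in>{1..s}. if m < k then derange_ratio (k - 1 - m) else 0)"

text \<open>
  The terms telescope by the derangement recurrence.
\<close>

lemma deficiency_le:
  assumes "s \<le> k" "k \<ge> 1"
  shows "deficiency k s = real k * derange_ratio k - real (k - s) * derange_ratio (k - s)"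
  using assms(1)
proof (induction s)
  case 0
  then show ?case by (simp add: deficiency_def)
next
  case (Suc s)
  have S: "deficiency k (Suc s) = deficiency k s + (if Suc s < k then derange_ratio (k - 1 - Suc s) else 0)"
    by (simp add: deficiency_def)
  show ?case
  proof (cases "Suc s < k")
    case True
    then obtain r where r: "k = r + 2 + s" using less_iff_Suc_add[of "Suc s" k] by auto
    have "k - s = r + 2" "k - Suc s = r + 1" "k - 1 - Suc s = r" using r by simp_all
    then show ?thesis using S Suc derange_ratio_recurrence[of r] True by simp
  next
    case False
    then have "k - s = 1" using Suc.prems by simp
    then show ?thesis using S Suc False by simp
  qed
qed

lemma deficiency_ge:
  assumes "k \<le> s" "k \<ge> 1"
  shows "deficiency k s = real k * derange_ratio k"
proof -
  have "deficiency k s = deficiency k k"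
    unfolding deficiency_def using assms by (intro sum.mono_neutral_right) auto
  then show ?thesis using deficiency_le[of k k] assms by simp
qed

text \<open>
  Equality at \<open>s = n - 1\<close> corresponds to the standard representation, whose levels decrease linearly
  from 1 to \<open>n\<close>.  In the excluded case, \<open>s = 1\<close> corresponds to the sign representation, on which the
  3-cycles act trivially.  With \<open>j = k - s\<close>, the closed form of the deficiency turns the claim into a
  comparison of \<open>derange_ratio k\<close> with \<open>derange_ratio j\<close>.  For \<open>j \<ge> 3\<close> it follows from monotonicity of the
  scaled ratios.  For \<open>j = 2\<close> and \<open>k \<ge> 10\<close> it follows from \<open>derange_ratio k \<ge> 11 / 30\<close>; for smaller \<open>k\<close>
  the distance from \<open>k\<close> to \<open>n\<close> has to help, which is the reason for \<open>12 \<le> n\<close>.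
\<close>

lemma deficiency_bound:
  assumes n: "12 \<le> n" and k: "2 \<le> k" "k \<le> n - 2" and s: "1 \<le> s" "s \<le> n - 1"
    and no: "\<not> (k = 3 \<and> s = 1)"
  shows "real s * (real k * derange_ratio k) / (real n - 1) \<le> deficiency k s"
proof (cases "k \<le> s")
  case True
  have "real s / (real n - 1) * (real k * derange_ratio k) \<le> 1 * (real k * derange_ratio k)"
    using s n derange_ratio_nonneg[of k] by (intro mult_right_mono) (auto simp: field_simps of_nat_diff)
  then show ?thesis using deficiency_ge[OF True] k by simp
next
  case False
  define j where "j = k - s"
  define d where "d = n - 1 - k"
  have j: "1 \<le> j" "j < k" and sj: "real s = real k - real j" using False s by (auto simp: j_def)
  have d: "1 \<le> d" and nd: "real n - 1 = real k + real d" using k n by (auto simp: d_def)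
  define P where "P = real k * derange_ratio k"
  define Q where "Q = real j * derange_ratio j"
  have def: "deficiency k s = P - Q"
    using deficiency_le[of s k] False k by (simp add: P_def Q_def j_def)
  have P0: "P \<ge> 0" by (simp add: P_def derange_ratio_nonneg)
  have main: "(real k + real d) * Q \<le> P * (real d + real j)"
  proof -
    consider "j = 1" | "j = 2" | "3 \<le> j" using j by linarith
    then show ?thesis
    proof cases
      case 1
      then show ?thesis using P0 by (simp add: Q_def)
    next
      case 2
      have k4: "4 \<le> k" using 2 j no False by (auto simp: j_def)
      have P: "P \<ge> real k * (11 / 30)"
        unfolding P_def by (intro mult_left_mono derange_ratio_ge_11_30 k4) auto
      have "30 * (real k + real d) \<le> 11 * real k * (real d + 2)"
      proof (cases "k \<ge> 10")
        case True
        have "0 \<le> (11 * real k - 30) * (real d - 1)" using d True by (intro mult_nonneg_nonneg) auto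
        then show ?thesis using True by (simp add: algebra_simps)
      next
        case False
        then have "k = 4 \<or> k = 5 \<or> k = 6 \<or> k = 7 \<or> k = 8 \<or> k = 9" using k4 by auto
        moreover have "real d \<ge> 11 - real k" using n nd by simp
        ultimately show ?thesis by auto
      qed
      then have "real k + real d \<le> real k * (11 / 30) * (real d + 2)" by simp
      also have "\<dots> \<le> P * (real d + 2)" using P by (intro mult_right_mono) auto
      finally show ?thesis using 2 by (simp add: Q_def derange_ratio_2)
    next
      case 3
      have "Q / (real j + 1) \<le> P / (real k + 1)"
        unfolding P_def Q_def using derange_ratio_scaled_mono[OF 3, of k] j by simp
      then have QP: "Q * (real k + 1) \<le> P * (real j + 1)" by (simp add: field_simps)
      have "(real d - 1) * (real k - real j) \<ge> 0" using d j by (intro mult_nonneg_nonneg) auto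
      then have le: "(real k + real d) * (real j + 1) \<le> (real k + 1) * (real d + real j)"
        by (simp add: algebra_simps)
      have "(real j + 1) * ((real k + real d) * Q) = ((real k + real d) * (real j + 1)) * Q" by simp
      also have "\<dots> \<le> ((real k + 1) * (real d + real j)) * Q"
        using le by (intro mult_right_mono) (simp_all add: Q_def derange_ratio_nonneg)
      also have "\<dots> = (Q * (real k + 1)) * (real d + real j)" by simp
      also have "\<dots> \<le> (P * (real j + 1)) * (real d + real j)" using QP by (intro mult_right_mono) auto
      also have "\<dots> = (real j + 1) * (P * (real d + real j))" by simp
      finally show ?thesis by simp
    qed
  qed
  have pos: "real k + real d > 0" using k by simp
  have "(real k - real j) * P \<le> (P - Q) * (real k + real d)" using main by (simp add: algebra_simps)
  then show ?thesis unfolding def nd sj P_def[symmetric] using pos by (simp only: pos_divide_le_eq)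
qed

text \<open>
  At \<open>s = 1\<close>, where the bound fails for support size 3, every support size \<open>k \<ge> 4\<close> has a surplus.
\<close>

lemma deficiency_compensation:
  assumes n: "12 \<le> n" and k: "4 \<le> k" "k \<le> n - 2"
  shows "1 / 6 \<le> (real n - 1) * deficiency k 1 - real k * derange_ratio k"
proof -
  define r where "r = k - 2"
  then have r: "k = r + 2" "2 \<le> r" using k by auto
  have def: "deficiency k 1 = derange_ratio r"
    using r by (simp add: deficiency_def)
  have f: "fact (Suc (Suc r)) = (real r + 2) * fact (Suc r)" by (simp add: algebra_simps)
  have diff: "real k * (derange_ratio r - derange_ratio k) = (-1) ^ r * (real r + 1) / fact (Suc r)"
    unfolding r(1) add_2_eq_Suc' derange_ratio_Suc f by (simp add: divide_simps) (simp add: algebra_simps)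
  have diff': "real k * (derange_ratio r - derange_ratio k) = (-1) ^ r / fact r"
    unfolding diff by (simp add: divide_simps)
  have low: "1 / 6 \<le> derange_ratio r + (-1) ^ r / fact r"
  proof (cases "r = 2")
    case True
    then show ?thesis by (simp add: derange_ratio_2)
  next
    case False
    then have "3 \<le> r" using r by simp
    then have "(fact 3 :: real) \<le> fact r" by (intro fact_mono)
    then have "(1::real) / fact r \<le> 1 / 6" by (simp add: fact_numeral field_simps)
    moreover have "(-1) ^ r / fact r \<ge> - ((1::real) / fact r)" by (cases "even r") simp_all
    ultimately show ?thesis using derange_ratio_ge_third[OF r(2)] by linarith
  qed
  have "(real k + 1) * derange_ratio r \<le> (real n - 1) * derange_ratio r"
    using k n derange_ratio_nonneg[of r] by (intro mult_right_mono) auto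
  then show ?thesis using low diff' unfolding def by (simp add: algebra_simps)
qed

text \<open>
  A nonnegative decreasing sequence is a nonnegative combination of the indicators of the segments
  \<open>{1..s}\<close>, so it is enough to test the linear functional \<open>L\<close> on these.
\<close>

lemma abel_nonneg:
  fixes a L :: "nat \<Rightarrow> real"
  assumes "\<And>s. 1 \<le> s \<Longrightarrow> s \<le> N \<Longrightarrow> (\<Sum>m\<in>{1..s}. L m) \<ge> 0"
    and "\<And>m. 1 \<le> m \<Longrightarrow> m < N \<Longrightarrow> a (Suc m) \<le> a m" and "1 \<le> N" "a N \<ge> 0"
  shows "(\<Sum>m\<in>{1..N}. a m * L m) \<ge> 0"
proof -
  have "a s * (\<Sum>m\<in>{1..s}. L m) \<le> (\<Sum>m\<in>{1..s}. a m * L m)" if "1 \<le> s" "s \<le> N" for s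
    using that
  proof (induction s rule: dec_induct)
    case (step s)
    have "a (Suc s) * (\<Sum>m\<in>{1..Suc s}. L m) = a (Suc s) * (\<Sum>m\<in>{1..s}. L m) + a (Suc s) * L (Suc s)"
      by (simp add: algebra_simps)
    also have "\<dots> \<le> a s * (\<Sum>m\<in>{1..s}. L m) + a (Suc s) * L (Suc s)"
      using step assms(1)[of s] assms(2)[of s] by (intro add_right_mono mult_right_mono) auto
    also have "\<dots> \<le> (\<Sum>m\<in>{1..Suc s}. a m * L m)" using step by simp
    finally show ?case .
  qed simp
  from this[OF assms(3) order_refl] show ?thesis
    using assms(1)[of N] assms(3,4) mult_nonneg_nonneg[of "a N" "\<Sum>m\<in>{1..N}. L m"] by linarith
qed

lemma alternating_sum_by_parts:
  "(\<Sum>j\<le>k. (-1) ^ j / fact j * q (k - j)) =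
    derange_ratio k * q 0 - (\<Sum>m<k. (q m - q (Suc m)) * derange_ratio (k - 1 - m))"
proof -
  have q: "q i = q 0 - (\<Sum>m<i. q m - q (Suc m))" for i by (induction i) auto
  have "(\<Sum>j\<le>k. (-1) ^ j / fact j * q (k - j)) =
    (\<Sum>j\<le>k. (-1) ^ j / fact j * q 0) - (\<Sum>j\<le>k. \<Sum>m<k - j. (-1) ^ j / fact j * (q m - q (Suc m)))"
    by (subst q) (simp only: right_diff_distrib sum_subtractf sum_distrib_left)
  also have "(\<Sum>j\<le>k. \<Sum>m<k - j. (-1) ^ j / fact j * (q m - q (Suc m))) =
    (\<Sum>j\<in>{..k}. \<Sum>m | m \<in> {..<k} \<and> j + m < k. (-1) ^ j / fact j * (q m - q (Suc m)))"
    by (intro sum.cong refl) auto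
  also have "\<dots> = (\<Sum>m\<in>{..<k}. \<Sum>j | j \<in> {..k} \<and> j + m < k. (-1) ^ j / fact j * (q m - q (Suc m)))"
    by (intro sum.swap_restrict) auto
  also have "\<dots> = (\<Sum>m<k. (q m - q (Suc m)) * derange_ratio (k - 1 - m))"
    unfolding derange_ratio_def sum_distrib_left
    by (intro sum.cong refl) (auto simp: mult.commute)
  finally show ?thesis by (simp add: derange_ratio_def sum_distrib_right)
qed

text \<open>
  The differences of \<open>q\<close> decrease and sum to \<open>q 1\<close>, so by \<open>abel_nonneg\<close> the claim reduces to sequences
  with constant differences up to \<open>s\<close>.  For these it is \<open>deficiency_bound\<close>, one \<open>k\<close> at a time, unless
  \<open>3 \<in> I\<close> and \<open>s = 1\<close>.  In that case the loss for \<open>k = 3\<close> is exactly \<open>n (n - 2)\<close>.  The gain of \<open>k = 2\<close> is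
  the same number, and every \<open>k \<ge> 4\<close> gains at least as much; this is where \<open>I \<noteq> {3}\<close> is used.
\<close>

theorem convex_levels_bound:
  fixes q :: "nat \<Rightarrow> real"
  assumes n: "12 \<le> n" and I: "I \<subseteq> {2..n - 2}" "I \<noteq> {}" "I \<noteq> {3}"
    and conv: "\<And>m. 1 \<le> m \<Longrightarrow> m + 2 \<le> n \<Longrightarrow> q m - 2 * q (m + 1) + q (m + 2) \<ge> 0"
    and q: "q 0 = q 1" "q n = 0" "\<And>m. q m \<ge> 0"
  defines "w \<equiv> \<lambda>k. fact n / fact (n - k)"
  shows "(\<Sum>k\<in>I. w k * (\<Sum>j\<le>k. (-1) ^ j / fact j * q (k - j))) \<le>
    (\<Sum>k\<in>I. w k * derange_ratio k * (1 - real k / (real n - 1))) * q 1"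
proof -
  define a where "a m = q m - q (Suc m)" for m
  define c where "c k m = (if m < k then derange_ratio (k - 1 - m) else 0) - real k * derange_ratio k / (real n - 1)"
    for k m
  define L where "L m = (\<Sum>k\<in>I. w k * c k m)" for m
  have finI: "finite I" using I(1) finite_subset by blast
  have kI: "2 \<le> k" "k \<le> n - 2" if "k \<in> I" for k using I(1) that by auto
  have wpos: "w k > 0" for k by (simp add: w_def)
  have a0: "a 0 = 0" using q by (simp add: a_def)
  have tele: "(\<Sum>m\<in>{1..n - 1}. a m) = q 1"
  proof -
    have "(\<Sum>m\<in>{1..N}. a m) = q 1 - q (Suc N)" for N by (induction N) (auto simp: a_def)
    then show ?thesis using n q(2) by simp
  qed
  have lam: "(\<Sum>m\<in>{1..s}. L m) = (\<Sum>k\<in>I. w k * (deficiency k s - real s * (real k * derange_ratio k) / (real n - 1)))" for s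
  proof -
    have "(\<Sum>m\<in>{1..s}. L m) = (\<Sum>k\<in>I. w k * (\<Sum>m\<in>{1..s}. c k m))"
      unfolding L_def by (subst sum.swap) (simp add: sum_distrib_left)
    then show ?thesis by (simp add: c_def sum_subtractf deficiency_def)
  qed
  have part: "(\<Sum>m\<in>{1..s}. L m) \<ge> 0" if s: "1 \<le> s" "s \<le> n - 1" for s
  proof (cases "s = 1 \<and> 3 \<in> I")
    case False
    show ?thesis unfolding lam
    proof (intro sum_nonneg mult_nonneg_nonneg)
      fix k assume "k \<in> I"
      then show "0 \<le> deficiency k s - real s * (real k * derange_ratio k) / (real n - 1)"
        using deficiency_bound[OF n, of k s] kI[of k] s False by auto
    qed (use wpos less_imp_le in auto)
  next
    case True
    \<comment> \<open>Only \<open>h 3\<close> is negative, and one further term makes up for it.\<close>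
    define h where "h k = w k * (deficiency k 1 - (real k * derange_ratio k) / (real n - 1))" for k
    obtain k where k: "k \<in> I" "k \<noteq> 3" using I True by blast
    have w3: "w 3 = real n * (real n - 1) * (real n - 2)"
    proof -
      obtain r where "n = r + 3" using n nat_le_iff_add[of 3 n] by (auto simp: add.commute)
      then show ?thesis by (simp add: w_def numeral_3_eq_3 field_simps)
    qed
    have h3: "h 3 = - (real n * (real n - 2))"
      using n w3 by (simp add: h_def deficiency_def derange_ratio_3)
    have hk: "h k \<ge> real n * (real n - 2)"
    proof (cases "k = 2")
      case True
      obtain r where "n = r + 2" using n nat_le_iff_add[of 2 n] by (auto simp: add.commute)
      then have w2: "w 2 = real n * (real n - 1)" by (simp add: w_def field_simps)
      have "h k = w 2 * (1 - 1 / (real n - 1))"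
        using True by (simp add: h_def deficiency_def derange_ratio_2)
      also have "\<dots> = real n * (real n - 1) - real n"
        unfolding w2 using n by (simp add: field_simps)
      finally show ?thesis by (simp add: algebra_simps)
    next
      case False
      then have k4: "4 \<le> k" "k \<le> n - 2" using k kI[of k] by auto
      have red: "fact (n - i) = (real n - real i) * fact (n - Suc i)" if "i < n" for i
        using that fact_reduce[of "n - i", where 'a = real] by (simp add: of_nat_diff)
      have "fact n = real n * (real n - 1) * (real n - 2) * (real n - 3) * fact (n - 4)"
        using red[of 0] red[of 1] red[of 2] red[of 3] n by (simp add: numeral_eq_Suc)
      then have "w 4 = real n * (real n - 1) * (real n - 2) * (real n - 3)" by (simp add: w_def)
      moreover have "w 4 \<le> w k"
        unfolding w_def using k4 by (intro divide_left_mono fact_mono mult_pos_pos) auto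
      ultimately have wk: "real n * (real n - 1) * (real n - 2) * (real n - 3) \<le> w k" by simp
      have "real n * (real n - 2) * 6 \<le> real n * (real n - 2) * (real n - 3)"
        using n by (intro mult_left_mono) auto
      also have "\<dots> = (real n * (real n - 1) * (real n - 2) * (real n - 3)) / (real n - 1)"
        using n by simp
      also have "\<dots> \<le> w k / (real n - 1)" using wk n by (intro divide_right_mono) auto
      finally have six: "real n * (real n - 2) * 6 \<le> w k / (real n - 1)" .
      have "x \<le> y * (1 / 6)" if "x * 6 \<le> y" for x y :: real using that by simp
      from this[OF six] have "real n * (real n - 2) \<le> w k / (real n - 1) * (1 / 6)" .
      also have "\<dots> \<le> w k / (real n - 1) * ((real n - 1) * deficiency k 1 - real k * derange_ratio k)"
        using deficiency_compensation[OF n k4] wpos[of k] n by (intro mult_left_mono) auto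
      also have "\<dots> = h k" using n by (simp add: h_def field_simps)
      finally show ?thesis .
    qed
    have "(\<Sum>i\<in>I. h i) = h 3 + (\<Sum>i\<in>I - {3}. h i)"
      using True finI by (simp add: sum.remove)
    also have "(\<Sum>i\<in>I - {3}. h i) = h k + (\<Sum>i\<in>I - {3} - {k}. h i)"
      using k finI by (simp add: sum.remove)
    also have "(\<Sum>i\<in>I - {3} - {k}. h i) \<ge> 0"
    proof (intro sum_nonneg)
      fix i assume "i \<in> I - {3} - {k}"
      then show "0 \<le> h i"
        using deficiency_bound[OF n, of i 1] kI[of i] n wpos[of i] by (auto simp: h_def)
    qed
    ultimately have "(\<Sum>i\<in>I. h i) \<ge> 0" using h3 hk by linarith
    then show ?thesis unfolding lam h_def using True by simp
  qed
  have "0 \<le> (\<Sum>m\<in>{1..n - 1}. a m * L m)"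
  proof (rule abel_nonneg)
    show "a (Suc m) \<le> a m" if "1 \<le> m" "m < n - 1" for m
    proof -
      have "m + 2 \<le> n" using that by linarith
      from conv[OF that(1) this] show ?thesis by (simp add: a_def)
    qed
    show "a (n - 1) \<ge> 0" using q(2) q(3)[of "n - 1"] n by (simp add: a_def)
  qed (use part n in auto)
  also have "\<dots> = (\<Sum>k\<in>I. w k * (\<Sum>m\<in>{1..n - 1}. a m * c k m))"
    unfolding L_def sum_distrib_left by (subst sum.swap) (simp add: mult_ac)
  also have "\<dots> = (\<Sum>k\<in>I. w k * (derange_ratio k * (1 - real k / (real n - 1)) * q 1 -
    (\<Sum>j\<le>k. (-1) ^ j / fact j * q (k - j))))"
  proof (intro sum.cong refl arg_cong[where f = "\<lambda>t. _ * t"])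
    fix k assume k: "k \<in> I"
    have "(\<Sum>m<k. a m * derange_ratio (k - 1 - m)) = (\<Sum>m\<in>{1..<k}. a m * derange_ratio (k - 1 - m))"
      using a0 by (intro sum.mono_neutral_right) (auto simp: not_less_eq_eq)
    also have "\<dots> = (\<Sum>m\<in>{1..n - 1}. a m * (if m < k then derange_ratio (k - 1 - m) else 0))"
      using kI[OF k] by (intro sum.mono_neutral_cong_left) auto
    finally have 1: "(\<Sum>m<k. a m * derange_ratio (k - 1 - m)) =
      (\<Sum>m\<in>{1..n - 1}. a m * (if m < k then derange_ratio (k - 1 - m) else 0))" .
    have "(\<Sum>m\<in>{1..n - 1}. a m * c k m) = (\<Sum>m\<in>{1..n - 1}. a m * (if m < k then derange_ratio (k - 1 - m) else 0))
      - (\<Sum>m\<in>{1..n - 1}. a m) * (real k * derange_ratio k / (real n - 1))"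
      unfolding c_def by (simp only: right_diff_distrib sum_subtractf sum_distrib_right)
    then show "(\<Sum>m\<in>{1..n - 1}. a m * c k m) = derange_ratio k * (1 - real k / (real n - 1)) * q 1 -
      (\<Sum>j\<le>k. (-1) ^ j / fact j * q (k - j))"
      unfolding tele 1[symmetric] alternating_sum_by_parts a_def[symmetric] q(1)
      by (simp add: algebra_simps)
  qed
  also have "\<dots> = (\<Sum>k\<in>I. w k * (derange_ratio k * (1 - real k / (real n - 1)) * q 1)) -
    (\<Sum>k\<in>I. w k * (\<Sum>j\<le>k. (-1) ^ j / fact j * q (k - j)))"
    by (subst sum_subtractf[symmetric], intro sum.cong refl) (rule right_diff_distrib)
  also have "(\<Sum>k\<in>I. w k * (derange_ratio k * (1 - real k / (real n - 1)) * q 1)) =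
    (\<Sum>k\<in>I. w k * derange_ratio k * (1 - real k / (real n - 1))) * q 1"
    unfolding sum_distrib_right by (intro sum.cong refl) (simp only: mult.assoc)
  finally show ?thesis by linarith
qed


section \<open>The sign character and 3-cycles\<close>

context perm_functions
begin

text \<open>
  Conjugated by this involution, the average over the permutations of \<open>S\<close> becomes the projection to
  the functions on which these permutations act by their sign.
\<close>

definition twist :: "(('a \<Rightarrow> 'a) \<Rightarrow> real) \<Rightarrow> ('a \<Rightarrow> 'a) \<Rightarrow> real" where
  "twist f = (\<lambda>x. real_of_int (sign x) * f x)"

lemma sign_square [simp]: "real_of_int (sign x) * real_of_int (sign x) = 1"
  by (simp add: sign_def)

lemma inn_twist: "inn (twist f) h = inn f (twist h)"
  by (simp add: inn_def twist_def mult_ac)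

lemma twist_twist [simp]: "twist (twist f) = f"
  by (simp add: twist_def mult.assoc[symmetric] fun_eq_iff)

lemma sign_comp: "x \<in> perms X \<Longrightarrow> g \<in> perms X \<Longrightarrow> sign (x \<circ> g) = sign x * sign g"
  using finite_X by (intro sign_compose) (auto simp: perms_def permutation_permutes)

lemma translate_form_twist:
  assumes g: "g \<in> perms X"
  shows "translate_form (twist f) g = sign g * translate_form f g"
proof -
  have "real_of_int (sign x) * f x * (real_of_int (sign (x \<circ> g)) * f (x \<circ> g)) =
    real_of_int (sign g) * (f x * f (x \<circ> g))" if x: "x \<in> perms X" for x
    using sign_square[of x] by (simp add: sign_comp[OF x g] mult_ac)
  then show ?thesis
    unfolding translate_form_def inn_def twist_def sum_distrib_left by (intro sum.cong refl) auto
qed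

lemma sign_moved_2:
  assumes g: "g \<in> perms X" "card (moved g) = 2"
  shows "sign g = -1"
proof -
  obtain a b where ab: "moved g = {a, b}" "a \<noteq> b" using g(2) card_2_iff by metis
  have "g \<in> perms {a, b}" using perms_moved[of "{a, b}"] g ab by (auto simp: moved_def)
  then have "g permutes {a, b}" by (simp add: perms_def)
  moreover have "g a \<noteq> a" using ab by (auto simp: moved_def)
  ultimately have "g = Transposition.transpose a b" by (auto simp: permutes_doubleton_iff)
  then show ?thesis using ab by (simp add: sign_swap_id)
qed

text \<open>
  Composing \<open>g\<close> with a transposition so that one of the three moved points becomes fixed leaves a
  permutation that moves two points.
\<close>

lemma sign_moved_3:
  assumes g: "g \<in> perms X" "card (moved g) = 3"
  shows "sign g = 1"
proof -
  have gX: "g permutes X" using g by (simp add: perms_def)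
  have mX: "moved g \<subseteq> X" by (auto simp: moved_def)
  obtain a where a: "a \<in> moved g" using g(2) by fastforce
  define b where "b = g a"
  have ab: "a \<noteq> b" "a \<in> X" using a by (auto simp: b_def moved_def)
  have bX: "b \<in> X" using ab(2) gX permutes_in_image by (simp add: b_def permutes_in_image)
  let ?t = "Transposition.transpose a b"
  define h where "h = ?t \<circ> g"
  have t: "?t \<in> perms X" using ab bX by (simp add: perms_def permutes_swap_id)
  have h: "h \<in> perms X" unfolding h_def using t gX by (auto simp: perms_def intro: permutes_compose)
  have bm: "g b \<noteq> b"
  proof
    assume "g b = b"
    then have "g b = g a" by (simp add: b_def)
    then show False using ab permutes_inj[OF gX] by (simp add: inj_eq)
  qed
  have "h a = a" by (simp add: h_def b_def)
  have "moved h \<subseteq> moved g - {a}"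
  proof
    fix i assume i: "i \<in> moved h"
    then have iX: "i \<in> X" "h i \<noteq> i" by (auto simp: moved_def)
    have "i \<noteq> a" using iX \<open>h a = a\<close> by auto
    moreover have "g i \<noteq> i"
    proof
      assume gi: "g i = i"
      then have "i \<noteq> b" using bm by auto
      then show False using iX gi \<open>i \<noteq> a\<close> by (simp add: h_def transpose_def)
    qed
    ultimately show "i \<in> moved g - {a}" using iX by (simp add: moved_def)
  qed
  moreover have "finite (moved g)" using mX finite_X finite_subset by blast
  ultimately have "card (moved h) \<le> 2" using card_mono[of "moved g - {a}" "moved h"] a g(2) by simp
  moreover have "moved h \<noteq> {}"
  proof
    assume "moved h = {}"
    then have "h = id" using perms_moved[of "{}"] h by (auto simp: perms_def)
    then have "?t \<circ> (?t \<circ> g) = ?t" by (simp add: h_def)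
    then have "g = ?t" by (simp add: o_assoc)
    then have "moved g \<subseteq> {a, b}" by (auto simp: moved_def transpose_def)
    then have "card (moved g) \<le> card {a, b}" by (intro card_mono) auto
    then show False using g(2) ab by simp
  qed
  moreover have "card (moved h) \<noteq> 1"
  proof
    assume "card (moved h) = 1"
    then obtain c where c: "moved h = {c}" by (rule card_1_singletonE)
    then have "h \<in> perms {c}" using perms_moved[of "{c}"] h by (auto simp: moved_def)
    then have "h = id" by (simp add: perms_def permutes_sing)
    then show False using c by (auto simp: moved_def)
  qed
  moreover have "finite (moved h)" using finite_X by (simp add: moved_def)
  ultimately have "card (moved h) = 2" by (cases "card (moved h)") (auto simp: le_Suc_eq numeral_2_eq_2)
  then have "sign h = -1" using sign_moved_2[OF h] by simp
  moreover have "sign h = sign ?t * sign g" unfolding h_def by (rule sign_comp[OF t g(1)])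
  ultimately show ?thesis using ab by (simp add: sign_swap_id)
qed

lemma support_mean_twist_2: "support_mean (twist f) 2 = - support_mean f 2"
  unfolding support_mean_def support_form_def
  by (simp add: translate_form_twist sign_moved_2 sum_negf cong: conj_cong)

lemma support_mean_twist_3: "support_mean (twist f) 3 = support_mean f 3"
  unfolding support_mean_def support_form_def
  by (simp add: translate_form_twist sign_moved_3 cong: conj_cong)

lemma inn_twist_self: "inn (twist f) (twist f) = inn f f"
  by (simp add: inn_twist)

lemma support_mean_2: "2 \<le> card X \<Longrightarrow> support_mean f 2 = level f 2 - inn f f / 2"
  using level_low[of 0 f] level_low[of 1 f]
  by (simp add: support_mean_eq_sum_level numeral_2_eq_2)

lemma support_mean_3: "3 \<le> card X \<Longrightarrow> support_mean f 3 = level f 3 - level f 2 + inn f f / 3"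
  using level_low[of 0 f] level_low[of 1 f]
  by (simp add: support_mean_eq_sum_level numeral_3_eq_3 numeral_2_eq_2)

text \<open>
  The transposition of \<open>a\<close> and \<open>b\<close> fixes the first function and negates the second.
\<close>

lemma avg_perms_orthogonal_twist:
  assumes S: "S \<subseteq> X" "S' \<subseteq> X" and ab: "a \<in> S \<inter> S'" "b \<in> S \<inter> S'" "a \<noteq> b"
  shows "inn (avg (perms S) f) (twist (avg (perms S') h)) = 0"
proof -
  let ?t = "Transposition.transpose a b"
  have t: "?t \<in> perms X" "?t \<in> perms S" "?t \<in> perms S'"
    using S ab by (auto simp: perms_def intro!: permutes_swap_id)
  have inv: "avg (perms R) k (x \<circ> ?t) = avg (perms R) k x" if "?t \<in> perms R" for R k x
  proof -
    have tR: "?t permutes R" using that by (simp add: perms_def)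
    have "(\<Sum>g\<in>perms R. k (x \<circ> ?t \<circ> g)) = (\<Sum>g\<in>(\<circ>) ?t ` perms R. k (x \<circ> g))"
      by (subst sum.reindex[OF inj_on_comp[OF tR]]) (simp add: o_assoc)
    then show ?thesis unfolding image_comp_perms[OF that] by (simp add: avg_def)
  qed
  have "inn (avg (perms S) f) (twist (avg (perms S') h)) =
    inn (\<lambda>x. avg (perms S) f (x \<circ> ?t)) (twist (avg (perms S') h))"
    by (simp add: inv[OF t(2)])
  also have "\<dots> = inn (avg (perms S) f) (\<lambda>x. twist (avg (perms S') h) (x \<circ> Hilbert_Choice.inv ?t))"
    by (rule inn_translate[OF t(1)])
  also have "\<dots> = (\<Sum>x\<in>perms X. - (avg (perms S) f x * twist (avg (perms S') h) x))"
    unfolding inn_def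
  proof (rule sum.cong[OF refl])
    fix x assume x: "x \<in> perms X"
    have "sign (x \<circ> ?t) = - sign x" using sign_comp[OF x t(1)] ab by (simp add: sign_swap_id)
    then show "avg (perms S) f x * twist (avg (perms S') h) (x \<circ> Hilbert_Choice.inv ?t) =
      - (avg (perms S) f x * twist (avg (perms S') h) x)"
      by (simp add: twist_def inv[OF t(3)])
  qed
  also have "\<dots> = - inn (avg (perms S) f) (twist (avg (perms S') h))"
    by (simp add: inn_def sum_negf)
  finally show ?thesis by simp
qed

definition removal_excess :: "'a set \<Rightarrow> (('a \<Rightarrow> 'a) \<Rightarrow> real) \<Rightarrow> ('a \<Rightarrow> 'a) \<Rightarrow> real" where
  "removal_excess R f = (\<lambda>x. \<Sum>i\<in>R. avg (perms (R - {i})) f x - avg (perms R) f x)"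

text \<open>
  Together, the first and the third equation say that \<open>1 - 1 / card R\<close> times the map \<open>removal_excess R\<close>
  is an orthogonal projection; the second one says that its range is orthogonal to the functions
  invariant under the permutations of \<open>R\<close>.
\<close>

lemma removal_excess_facts:
  fixes f :: "('a \<Rightarrow> 'a) \<Rightarrow> real"
  assumes R: "R \<subseteq> X" and M: "2 \<le> card R"
  defines "K \<equiv> (\<Sum>i\<in>R. proj_form f (R - {i}) - proj_form f R)"
  shows "inn f (removal_excess R f) = K"
    and "inn (avg (perms R) f) (removal_excess R f) = 0"
    and "inn (removal_excess R f) (removal_excess R f) = real (card R) / (real (card R) - 1) * K"
proof -
  interpret perm_functions_on X R f using R by unfold_locales
  let ?M = "real (card R)"
  have eq: "removal_excess R f = (\<lambda>x. \<Sum>i\<in>R. centred i i x)"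
    unfolding removal_excess_def centred_def by (intro ext sum.cong refl) (simp add: perms_remove)
  have K: "K = (\<Sum>i\<in>R. kappa i i)" by (simp add: K_def kappa_diag)
  show "inn f (removal_excess R f) = K"
    unfolding eq inn_sum_right K by (simp add: kappa_def)
  show "inn (avg (perms R) f) (removal_excess R f) = 0"
    unfolding eq inn_sum_right by (simp add: inn_centred_avg_perms)
  have off: "(\<Sum>k\<in>R - {i}. kappa i k) = - kappa i i" if "i \<in> R" for i
    using sum_kappa[OF that] that finite_R by (simp add: sum_diff1)
  have "inn (removal_excess R f) (removal_excess R f) = (\<Sum>i\<in>R. \<Sum>k\<in>R. inn (centred i i) (centred k k))"
    unfolding eq inn_sum_left inn_sum_right ..
  also have "\<dots> = (\<Sum>i\<in>R. kappa i i + kappa i i / (?M - 1))"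
  proof (intro sum.cong refl)
    fix i assume i: "i \<in> R"
    have "(\<Sum>k\<in>R. inn (centred i i) (centred k k)) =
      kappa i i + (\<Sum>k\<in>R - {i}. inn (centred i i) (centred k k))"
      using i finite_R by (simp add: sum.remove inn_centred)
    also have "(\<Sum>k\<in>R - {i}. inn (centred i i) (centred k k)) = (\<Sum>k\<in>R - {i}. (- 1 / (?M - 1)) * kappa i k)"
      using i by (intro sum.cong refl) (auto simp: inn_centred)
    also have "\<dots> = kappa i i / (?M - 1)" unfolding sum_distrib_left[symmetric] off[OF i] by simp
    finally show "(\<Sum>k\<in>R. inn (centred i i) (centred k k)) = kappa i i + kappa i i / (?M - 1)" .
  qed
  also have "\<dots> = (1 + 1 / (?M - 1)) * K"
    unfolding K sum_distrib_left by (intro sum.cong refl) (simp add: distrib_right)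
  also have "1 + 1 / (?M - 1) = ?M / (?M - 1)" using M by (simp add: field_simps)
  finally show "inn (removal_excess R f) (removal_excess R f) = ?M / (?M - 1) * K" .
qed

text \<open>
  Two points may be removed from \<open>R\<close>, and the remaining ones still have to admit a transposition; this
  needs \<open>4 \<le> card R\<close>.
\<close>

lemma removal_excess_orthogonal_twist:
  assumes R: "R \<subseteq> X" and M: "4 \<le> card R"
  shows "inn (avg (perms R) f) (twist (avg (perms R) h)) = 0"
    and "inn (avg (perms R) f) (twist (removal_excess R h)) = 0"
    and "inn (removal_excess R f) (twist (avg (perms R) h)) = 0"
    and "inn (removal_excess R f) (twist (removal_excess R h)) = 0"
proof -
  have finR: "finite R" using R finite_X finite_subset by blast
  have orth: "inn (avg (perms (R - A)) f) (twist (avg (perms (R - B)) h)) = 0"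
    if "card (A \<union> B) \<le> 2" "finite A" "finite B" for A B
  proof -
    have "card (R - (A \<union> B)) \<ge> 2"
      using diff_card_le_card_Diff[of "A \<union> B" R] that M by simp
    then obtain D where "D \<subseteq> R - (A \<union> B)" "card D = 2"
      using obtain_subset_with_card_n by metis
    then obtain a b where "{a, b} \<subseteq> R - (A \<union> B)" "a \<noteq> b" by (auto simp: card_2_iff)
    then show ?thesis using R by (intro avg_perms_orthogonal_twist[of _ _ a b]) auto
  qed
  have tw: "twist (removal_excess R h) = (\<lambda>x. \<Sum>i\<in>R. twist (avg (perms (R - {i})) h) x - twist (avg (perms R) h) x)"
    unfolding twist_def removal_excess_def sum_distrib_left right_diff_distrib ..
  have 0: "inn (avg (perms R) f) (twist (avg (perms R) h)) = 0" using orth[of "{}" "{}"] by simp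
  have 1: "inn (avg (perms R) f) (twist (avg (perms (R - {i})) h)) = 0" for i using orth[of "{}" "{i}"] by simp
  have 2: "inn (avg (perms (R - {i})) f) (twist (avg (perms R) h)) = 0" for i using orth[of "{i}" "{}"] by simp
  have 3: "inn (avg (perms (R - {i})) f) (twist (avg (perms (R - {j})) h)) = 0" for i j
    using orth[of "{i}" "{j}"] by (simp add: card_insert_if)
  show "inn (avg (perms R) f) (twist (avg (perms R) h)) = 0" by (rule 0)
  show "inn (avg (perms R) f) (twist (removal_excess R h)) = 0"
    unfolding tw inn_bilinear by (simp add: 0 1)
  show "inn (removal_excess R f) (twist (avg (perms R) h)) = 0"
    unfolding removal_excess_def inn_bilinear by (simp add: 0 2)
  show "inn (removal_excess R f) (twist (removal_excess R h)) = 0"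
    unfolding tw unfolding removal_excess_def inn_bilinear by (simp add: 0 1 2 3)
qed

text \<open>
  Bessel's inequality for four mutually orthogonal projections: the average over the permutations of
  \<open>R\<close>, the scaled removal excess, and the twists of these two.  It is sharper than the sum of the two
  inequalities for \<open>f\<close> and for \<open>twist f\<close>, and the sharp form is what the 3-cycles need.
\<close>

lemma four_projections_bessel:
  assumes R: "R \<subseteq> X" and M: "4 \<le> card R"
  defines "K \<equiv> \<lambda>f. \<Sum>i\<in>R. proj_form f (R - {i}) - proj_form f R"
  shows "(real (card R) - 1) * (K f + K (twist f)) \<le>
    real (card R) * (inn f f - proj_form f R - proj_form (twist f) R)"
proof -
  let ?M = "real (card R)"
  \<comment> \<open>the factor that makes \<open>removal_excess\<close> idempotent\<close>
  define \<gamma> where "\<gamma> = (?M - 1) / ?M"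
  define f' where "f' = twist f"
  define p where "p = avg (perms R) f"
  define p' where "p' = avg (perms R) f'"
  define z where "z = removal_excess R f"
  define z' where "z' = removal_excess R f'"
  have M2: "2 \<le> card R" using M by simp
  have M0: "?M > 0" "?M - 1 > 0" using M by simp_all
  note facts = removal_excess_facts[OF R M2]
  note orth = removal_excess_orthogonal_twist[OF R M, of f f', folded p_def p'_def z_def z'_def]
  have a: "inn f p = proj_form f R" "inn f z = K f" "inn p z = 0" "inn z z = ?M / (?M - 1) * K f"
    "inn p p = proj_form f R"
    using facts[of f] proj_form_eq_norm[OF R, of f] by (simp_all add: proj_form_def p_def z_def K_def)
  have b: "inn f (twist p') = proj_form f' R" "inn f (twist z') = K f'" "inn (twist p') (twist z') = 0"
    "inn (twist z') (twist z') = ?M / (?M - 1) * K f'" "inn (twist p') (twist p') = proj_form f' R"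
    using facts[of f'] proj_form_eq_norm[OF R, of f'] inn_twist[of f p'] inn_twist[of f z']
    by (simp_all add: proj_form_def p'_def z'_def K_def f'_def[symmetric] inn_twist)
  note c = inn_commute[of z p] inn_commute[of "twist z'" "twist p'"] inn_commute[of "twist p'" p]
    inn_commute[of "twist z'" p] inn_commute[of "twist p'" z] inn_commute[of "twist z'" z]
  define g where "g = (\<lambda>x. (p x + twist p' x) + \<gamma> * (z x + twist z' x))"
  have fg: "inn f g = proj_form f R + proj_form f' R + \<gamma> * (K f + K f')"
    unfolding g_def inn_bilinear a b by simp
  have "inn g g = proj_form f R + proj_form f' R + \<gamma> * (\<gamma> * (?M / (?M - 1) * (K f + K f')))"
    unfolding g_def inn_bilinear c a b orth by (simp add: algebra_simps add_divide_distrib)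
  also have "\<gamma> * (?M / (?M - 1) * (K f + K f')) = K f + K f'"
    using M0 by (simp add: \<gamma>_def)
  finally have gg: "inn g g = proj_form f R + proj_form f' R + \<gamma> * (K f + K f')" .
  have "0 \<le> inn (\<lambda>x. f x - g x) (\<lambda>x. f x - g x)" by (rule inn_nonneg)
  also have "\<dots> = inn f f - (proj_form f R + proj_form f' R + \<gamma> * (K f + K f'))"
    unfolding inn_bilinear inn_commute[of g f] fg gg by simp
  finally have "\<gamma> * (K f + K f') \<le> inn f f - proj_form f R - proj_form f' R" by simp
  then have "?M * (\<gamma> * (K f + K f')) \<le> ?M * (inn f f - proj_form f R - proj_form f' R)"
    using M0 by (intro mult_left_mono) auto
  then show ?thesis using M0 by (simp add: \<gamma>_def f'_def)
qed

lemma sum_removal_excess_levels: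
  assumes "Suc m \<le> card X"
  shows "(\<Sum>R | R \<subseteq> X \<and> card R = Suc m. \<Sum>i\<in>R. proj_form f (R - {i}) - proj_form f R) =
    real (Suc m) * real (card X choose Suc m) * (level f m - level f (Suc m))"
proof -
  have "(\<Sum>R | R \<subseteq> X \<and> card R = Suc m. \<Sum>i\<in>R. proj_form f (R - {i}) - proj_form f R) =
    (\<Sum>R | R \<subseteq> X \<and> card R = Suc m. \<Sum>i\<in>R. proj_form f (R - {i})) -
    (\<Sum>R | R \<subseteq> X \<and> card R = Suc m. real (Suc m) * proj_form f R)"
    by (simp add: sum_subtractf)
  also have "(\<Sum>R | R \<subseteq> X \<and> card R = Suc m. real (Suc m) * proj_form f R) = real (Suc m) * level_sum f (Suc m)"
    unfolding level_sum_def sum_distrib_left ..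
  finally show ?thesis
    using sum_sum_proj_form[of m f] level_sum_eq[of "Suc m" f] assms by (simp add: algebra_simps)
qed

lemma level_twist_step:
  assumes m: "3 \<le> m" "Suc m \<le> card X"
  shows "real m * (level f m + level (twist f) m - (level f (Suc m) + level (twist f) (Suc m))) \<le>
    inn f f - (level f (Suc m) + level (twist f) (Suc m))"
proof -
  let ?R = "{R. R \<subseteq> X \<and> card R = Suc m}"
  let ?B = "real (card X choose Suc m)"
  let ?D = "\<lambda>f. level f m - level f (Suc m)"
  have B: "?B > 0" using m by simp
  define K where "K f R = (\<Sum>i\<in>R. proj_form f (R - {i}) - proj_form f R)" for f R
  have "(\<Sum>R\<in>?R. real m * (K f R + K (twist f) R)) \<le>
    (\<Sum>R\<in>?R. real (Suc m) * (inn f f - proj_form f R - proj_form (twist f) R))"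
  proof (rule sum_mono)
    fix R assume "R \<in> ?R"
    then show "real m * (K f R + K (twist f) R) \<le> real (Suc m) * (inn f f - proj_form f R - proj_form (twist f) R)"
      using four_projections_bessel[of R f] m by (simp add: K_def)
  qed
  also have "(\<Sum>R\<in>?R. real m * (K f R + K (twist f) R)) = real m * ((\<Sum>R\<in>?R. K f R) + (\<Sum>R\<in>?R. K (twist f) R))"
    unfolding sum_distrib_left[symmetric] sum.distrib ..
  also have "\<dots> = real m * (real (Suc m) * ?B * (?D f + ?D (twist f)))"
    unfolding K_def sum_removal_excess_levels[OF m(2)] by (simp add: algebra_simps)
  also have "(\<Sum>R\<in>?R. real (Suc m) * (inn f f - proj_form f R - proj_form (twist f) R)) =
    real (Suc m) * (?B * inn f f - level_sum f (Suc m) - level_sum (twist f) (Suc m))"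
    unfolding sum_distrib_left[symmetric] sum_subtractf level_sum_def by (simp add: card_subsets)
  also have "\<dots> = real (Suc m) * ?B * (inn f f - level f (Suc m) - level (twist f) (Suc m))"
    using level_sum_eq[OF m(2)] by (simp add: algebra_simps)
  finally have "(real (Suc m) * ?B) * (real m * (?D f + ?D (twist f))) \<le>
    (real (Suc m) * ?B) * (inn f f - level f (Suc m) - level (twist f) (Suc m))"
    by (simp add: mult_ac)
  then have "real m * (?D f + ?D (twist f)) \<le> inn f f - level f (Suc m) - level (twist f) (Suc m)"
    using mult_le_cancel_left_pos[of "real (Suc m) * ?B"] B by simp
  then show ?thesis by (simp add: algebra_simps)
qed

text \<open>
  Twisting by the sign preserves the form of the 3-cycles and negates that of the transpositions,
  which makes \<open>w 3\<close> below twice the difference of the levels 2 and 3.  By \<open>level_twist_step\<close> the quotient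
  \<open>w m / (m - 1)\<close> decreases, and at \<open>m = card X\<close> both levels vanish by the two orthogonality assumptions.
\<close>

theorem support_mean_3_bound:
  assumes n: "4 \<le> card X"
    and triv: "(\<Sum>x\<in>perms X. f x) = 0" and sgn: "(\<Sum>x\<in>perms X. twist f x) = 0"
  shows "support_mean f 3 \<le> (1 / 3 - 1 / (real (card X) - 1)) * inn f f"
proof -
  let ?n = "card X"
  define w where "w m = inn f f - (level f m + level (twist f) m)" for m
  have decr: "w (Suc m) / real m \<le> w m / (real m - 1)" if m: "3 \<le> m" "Suc m \<le> ?n" for m
  proof -
    have "w (Suc m) - w m = level f m + level (twist f) m - (level f (Suc m) + level (twist f) (Suc m))"
      by (simp add: w_def)
    then have "real m * (w (Suc m) - w m) \<le> w (Suc m)"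
      using level_twist_step[OF m, of f] by (simp only: w_def)
    then have "w (Suc m) * (real m - 1) \<le> w m * real m" by (simp add: algebra_simps)
    then show ?thesis using m by (simp add: field_simps)
  qed
  have "w ?n / (real ?n - 1) \<le> w 3 / 2"
  proof -
    have "w (Suc m) / real m \<le> w 3 / 2" if "3 \<le> m" "Suc m \<le> ?n" for m
      using that
    proof (induction m rule: dec_induct)
      case base
      then show ?case using decr[of 3] by simp
    next
      case (step m)
      have "w (Suc (Suc m)) / real (Suc m) \<le> w (Suc m) / real m"
        using decr[of "Suc m"] step by simp
      also have "\<dots> \<le> w 3 / 2" using step by simp
      finally show ?case .
    qed
    from this[of "?n - 1"] show ?thesis using n by (simp add: of_nat_diff)
  qed
  moreover have "w ?n = inn f f" using level_full[OF triv] level_full[OF sgn] by (simp add: w_def)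
  moreover have "w 3 = 2 * (level f 2 - level f 3)"
  proof -
    have "level f 2 + level (twist f) 2 = inn f f"
      using support_mean_twist_2[of f] n by (simp add: support_mean_2 inn_twist_self)
    moreover have "level (twist f) 3 - level (twist f) 2 = level f 3 - level f 2"
      using support_mean_twist_3[of f] n by (simp add: support_mean_3 inn_twist_self)
    ultimately show ?thesis by (simp add: w_def)
  qed
  ultimately show ?thesis using support_mean_3[of f] n by (simp add: left_diff_distrib)
qed

end


section \<open>The standard representation\<close>

text \<open>
  Constants of the locale \<open>perm_functions\<close> occur here with the parameter \<open>{1..n}\<close>, which the simplifier
  would rewrite to \<open>{Suc 0..n}\<close>.
\<close>

declare One_nat_def [simp del]

lemma carrier_sym_group_perms: "carrier (sym_group n) = perms {1..n}"
  by (auto simp: sym_group_carrier perms_def)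

lemma card_perms_interval: "card (perms {1..n}) = fact n"
  by (simp add: perms_def card_permutations)

lemma comp_in_perms: "x \<in> perms R \<Longrightarrow> y \<in> perms R \<Longrightarrow> x \<circ> y \<in> perms R"
  by (auto simp: perms_def intro: permutes_compose)

lemma T_subset: "T n I \<subseteq> perms {1..n}"
  by (auto simp: T_def carrier_sym_group_perms)

lemma finite_T: "finite (T n I)"
  by (rule finite_subset[OF T_subset]) simp

lemma T_all: "T n {..n} = perms {1..n}"
proof -
  have "card (perm_support n s) \<le> card {1..n}" for s
    by (intro card_mono) (auto simp: perm_support_def)
  then show ?thesis by (auto simp: T_def carrier_sym_group_perms)
qed

lemma moved_interval: "perm_functions.moved {1..n} g = perm_support n g"
proof -
  interpret perm_functions "{1..n}" by unfold_locales simp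
  show ?thesis by (simp add: moved_def perm_support_def)
qed

lemma id_notin_T: "I \<subseteq> {2..n} \<Longrightarrow> id \<notin> T n I"
  by (auto simp: T_def perm_support_def)

lemma T_inverse:
  assumes "I \<subseteq> {2..n}" "s \<in> T n I" shows "Hilbert_Choice.inv s \<in> T n I"
proof -
  have "s permutes {1..n}" using assms(2) T_subset by (auto simp: perms_def)
  from sym_group_inv_eq[OF this] show ?thesis
    using T_is_normal_connection_set[OF assms(1)] assms(2)
    unfolding is_normal_connection_set_def by metis
qed

lemma T_conjugate:
  assumes "I \<subseteq> {2..n}" "s \<in> T n I" "g \<in> perms {1..n}"
  shows "g \<circ> s \<circ> Hilbert_Choice.inv g \<in> T n I"
  using T_is_normal_connection_set[OF assms(1)] sym_group_inv_eq[of g n] assms(2,3)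
  by (simp add: is_normal_connection_set_def carrier_sym_group_perms sym_group_mult perms_def)

lemma neighbour_sum_cayley:
  assumes S: "S \<subseteq> perms {1..n}" and inv: "\<And>s. s \<in> S \<Longrightarrow> Hilbert_Choice.inv s \<in> S"
    and x: "x \<in> perms {1..n}"
  shows "neighbour_sum (cayley_graph (sym_group n) S) f x = (\<Sum>s\<in>S. f (x \<circ> s))"
proof -
  let ?V = "perms {1..n}" and ?E = "snd (cayley_graph (sym_group n) S)"
  have E: "?E = {{g, g \<circ> s} | g s. g \<in> ?V \<and> s \<in> S}"
    by (simp add: cayley_graph_def sym_group_mult carrier_sym_group_perms)
  have xp: "x permutes {1..n}" using x by (simp add: perms_def)
  have adj: "{x, y} \<in> ?E \<longleftrightarrow> y \<in> (\<circ>) x ` S" for y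
  proof
    assume "{x, y} \<in> ?E"
    then obtain g s where gs: "{x, y} = {g, g \<circ> s}" "s \<in> S" unfolding E by auto
    then consider "x = g" "y = g \<circ> s" | "x = g \<circ> s" "y = g" by (auto simp: doubleton_eq_iff)
    then show "y \<in> (\<circ>) x ` S"
    proof cases
      case 1
      then show ?thesis using gs by blast
    next
      case 2
      have "s permutes {1..n}" using S gs by (auto simp: perms_def)
      then have "y = x \<circ> Hilbert_Choice.inv s" using 2 by (simp add: comp_assoc permutes_inv_o)
      then show ?thesis using inv[OF gs(2)] by blast
    qed
  next
    assume "y \<in> (\<circ>) x ` S"
    then show "{x, y} \<in> ?E" unfolding E using x by blast
  qed
  have sub: "(\<circ>) x ` S \<subseteq> ?V" using S x comp_in_perms by blast
  have "neighbour_sum (cayley_graph (sym_group n) S) f x = (\<Sum>y\<in>?V. of_bool (y \<in> (\<circ>) x ` S) * f y)"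
    unfolding neighbour_sum_def adj by (simp add: cayley_graph_def carrier_sym_group_perms)
  also have "\<dots> = (\<Sum>y\<in>(\<circ>) x ` S. f y)"
    using sub by (intro sum.mono_neutral_cong_right) auto
  also have "\<dots> = (\<Sum>s\<in>S. f (x \<circ> s))"
    by (subst sum.reindex[OF inj_on_comp[OF xp]]) (simp add: o_def)
  finally show ?thesis .
qed

definition moving :: "nat \<Rightarrow> nat \<Rightarrow> (nat \<Rightarrow> nat) set" where
  "moving n k = {g \<in> perms {1..n}. card (perm_support n g) = k}"

lemma sum_T: "finite I \<Longrightarrow> (\<Sum>s\<in>T n I. f s) = (\<Sum>k\<in>I. \<Sum>s\<in>moving n k. f s)"
proof -
  assume I: "finite I"
  have "T n I = (\<Union>k\<in>I. moving n k)" by (auto simp: T_def moving_def carrier_sym_group_perms)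
  then show ?thesis using I by (simp only:) (subst sum.UNION_disjoint; auto simp: moving_def)
qed

text \<open>
  The inversion formula applied to the constant function, all of whose levels are equal.
\<close>

lemma card_moving:
  assumes k: "k \<le> n"
  shows "real (card (moving n k)) = fact n / fact (n - k) * derange_ratio k"
proof -
  interpret perm_functions "{1..n}" by unfold_locales simp
  define one :: "(nat \<Rightarrow> nat) \<Rightarrow> real" where "one = (\<lambda>x. 1)"
  have i1: "inn one one = fact n" by (simp add: inn_def one_def card_perms_interval)
  have "proj_form one S = fact n" if "S \<subseteq> {1..n}" for S
  proof -
    have "finite S" using that finite_subset by blast
    then have "avg (perms S) one = one" using card_perms_pos[of S] by (auto simp: avg_def one_def)
    then show ?thesis by (simp add: proj_form_def i1)
  qed
  then have lev: "level one m = fact n" if "m \<le> n" for m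
    using that card_subsets[of m] by (simp add: level_def level_sum_def)
  have "support_mean one k = fact n * derange_ratio k"
    using support_mean_eq_sum_level[of k one] k lev
    by (simp add: derange_ratio_def sum_distrib_left mult.commute)
  moreover have "support_form one k = card (moving n k) * fact n"
    unfolding support_form_def moving_def moved_interval translate_form_def
    using i1 by (simp add: one_def)
  ultimately have "real (card (moving n k)) * fact n * fact (n - k) = fact n * derange_ratio k * fact n"
    by (simp add: support_mean_def field_simps)
  then show ?thesis by (simp add: field_simps)
qed

text \<open>
  The summands are the values of the standard character divided by its degree: a permutation with
  support size \<open>k\<close> has \<open>n - k\<close> fixed points, and \<open>(n - k - 1) / (n - 1) = 1 - k / (n - 1)\<close>.
\<close>

definition std_value :: "nat \<Rightarrow> nat set \<Rightarrow> real" where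
  "std_value n I = (\<Sum>s\<in>T n I. 1 - real (card (perm_support n s)) / (real n - 1))"

lemma std_value_eq:
  assumes I: "I \<subseteq> {..n}"
  shows "std_value n I = (\<Sum>k\<in>I. fact n / fact (n - k) * derange_ratio k * (1 - real k / (real n - 1)))"
proof -
  have "finite I" using I finite_subset by blast
  then have "std_value n I = (\<Sum>k\<in>I. \<Sum>s\<in>moving n k. 1 - real (card (perm_support n s)) / (real n - 1))"
    unfolding std_value_def by (rule sum_T)
  also have "\<dots> = (\<Sum>k\<in>I. \<Sum>s\<in>moving n k. 1 - real k / (real n - 1))"
    by (intro sum.cong refl) (simp add: moving_def)
  also have "\<dots> = (\<Sum>k\<in>I. fact n / fact (n - k) * derange_ratio k * (1 - real k / (real n - 1)))"
    using I by (intro sum.cong refl) (auto simp: card_moving)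
  finally show ?thesis .
qed

definition sends :: "(nat \<Rightarrow> nat) set \<Rightarrow> nat \<Rightarrow> nat \<Rightarrow> nat" where
  "sends S a b = card {s \<in> S. s a = b}"

text \<open>
  Conjugation by \<open>t\<close> preserves the connection set.
\<close>

lemma sends_conjugate_le:
  assumes I: "I \<subseteq> {2..n}" and t: "t \<in> perms {1..n}"
  shows "sends (T n I) a b \<le> sends (T n I) (t a) (t b)"
  unfolding sends_def
proof (rule card_inj_on_le)
  have tp: "t permutes {1..n}" using t by (simp add: perms_def)
  show "(\<lambda>s. t \<circ> s \<circ> Hilbert_Choice.inv t) ` {s \<in> T n I. s a = b} \<subseteq> {s \<in> T n I. s (t a) = t b}"
    using T_conjugate[OF I _ t] permutes_inverses(2)[OF tp] by auto
  show "inj_on (\<lambda>s. t \<circ> s \<circ> Hilbert_Choice.inv t) {s \<in> T n I. s a = b}"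
  proof (rule inj_onI)
    fix s s' assume "t \<circ> s \<circ> Hilbert_Choice.inv t = t \<circ> s' \<circ> Hilbert_Choice.inv t"
    then have "Hilbert_Choice.inv t \<circ> (t \<circ> s \<circ> Hilbert_Choice.inv t) \<circ> t =
      Hilbert_Choice.inv t \<circ> (t \<circ> s' \<circ> Hilbert_Choice.inv t) \<circ> t" by simp
    then show "s = s'"
      by (simp add: fun_eq_iff permutes_inverses[OF tp])
  qed
qed (use finite_T in auto)

lemma two_transitive:
  assumes "a \<in> R" "b \<in> R" "c \<in> R" "d \<in> R" "a = b \<longleftrightarrow> c = d"
  obtains t where "t \<in> perms R" "t a = c" "t b = d"
proof -
  \<comment> \<open>\<open>?t1\<close> settles \<open>a\<close>; the second transposition takes \<open>?t1 b\<close> to \<open>d\<close> without touching \<open>c\<close> unless \<open>a = b\<close>.\<close>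
  let ?t1 = "Transposition.transpose a c"
  let ?t = "Transposition.transpose (?t1 b) d \<circ> ?t1"
  have "?t1 b \<in> R" using assms by (auto simp: transpose_def)
  then have "?t \<in> perms R"
    using assms by (intro comp_in_perms) (auto simp: perms_def permutes_swap_id)
  moreover have "?t a = c" "?t b = d" using assms(5) by (auto simp: transpose_def)
  ultimately show ?thesis using that by blast
qed

lemma sends_eq:
  assumes I: "I \<subseteq> {2..n}" and ab: "a \<in> {1..n}" "b \<in> {1..n}" "c \<in> {1..n}" "d \<in> {1..n}" "a = b \<longleftrightarrow> c = d"
  shows "sends (T n I) a b = sends (T n I) c d"
proof (rule antisym)
  obtain t where "t \<in> perms {1..n}" "t a = c" "t b = d"
    using two_transitive[OF ab] by blast
  then show "sends (T n I) a b \<le> sends (T n I) c d" using sends_conjugate_le[OF I] by blast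
  obtain t where "t \<in> perms {1..n}" "t c = a" "t d = b"
    using two_transitive[OF ab(3,4,1,2) ab(5)[symmetric]] by blast
  then show "sends (T n I) c d \<le> sends (T n I) a b" using sends_conjugate_le[OF I] by blast
qed

lemma sends_total:
  assumes S: "S \<subseteq> perms {1..n}" and a: "a \<in> {1..n}"
  shows "card S = (\<Sum>b\<in>{1..n}. sends S a b)"
proof -
  have "finite S" by (rule finite_subset[OF S]) simp
  have "s a \<in> {1..n}" if "s \<in> S" for s
  proof -
    have "s permutes {1..n}" using that S by (auto simp: perms_def)
    then show ?thesis using a permutes_in_image by metis
  qed
  then have "S = (\<Union>b\<in>{1..n}. {s \<in> S. s a = b})" by blast
  then have "card S = card (\<Union>b\<in>{1..n}. {s \<in> S. s a = b})" by simp
  also have "\<dots> = (\<Sum>b\<in>{1..n}. card {s \<in> S. s a = b})"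
    using \<open>finite S\<close> by (intro card_UN_disjoint) auto
  finally show ?thesis by (simp add: sends_def)
qed

lemma sum_sends_fixed:
  assumes S: "S \<subseteq> perms {1..n}"
  shows "(\<Sum>a\<in>{1..n}. real (sends S a a)) = (\<Sum>s\<in>S. real n - card (perm_support n s))"
proof -
  have fin: "finite S" by (rule finite_subset[OF S]) simp
  have "(\<Sum>a\<in>{1..n}. real (sends S a a)) = (\<Sum>a\<in>{1..n}. \<Sum>s | s \<in> S \<and> s a = a. 1)"
    by (simp add: sends_def)
  also have "\<dots> = (\<Sum>s\<in>S. \<Sum>a | a \<in> {1..n} \<and> s a = a. 1)"
    using fin by (intro sum.swap_restrict) auto
  also have "\<dots> = (\<Sum>s\<in>S. real n - card (perm_support n s))"
  proof (intro sum.cong refl)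
    fix s
    have "{a. a \<in> {1..n} \<and> s a = a} = {1..n} - perm_support n s" by (auto simp: perm_support_def)
    moreover have "card ({1..n} - perm_support n s) = n - card (perm_support n s)"
      by (subst card_Diff_subset) (auto simp: perm_support_def)
    moreover have "card (perm_support n s) \<le> card {1..n}" by (intro card_mono) (auto simp: perm_support_def)
    ultimately show "(\<Sum>a | a \<in> {1..n} \<and> s a = a. 1) = real n - card (perm_support n s)"
      by (simp add: of_nat_diff)
  qed
  finally show ?thesis .
qed

text \<open>
  The symmetric group acts doubly transitively and \<open>T n I\<close> is closed under conjugation, so the number
  of elements that send \<open>a\<close> to \<open>b\<close> depends only on whether \<open>a = b\<close>.
\<close>

lemma std_value_sends:
  assumes I: "I \<subseteq> {2..n}" and n: "2 \<le> n"
  shows "std_value n I = real (sends (T n I) 1 1) - real (sends (T n I) 1 2)"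
    and "real (card (T n I)) = real (sends (T n I) 1 1) + (real n - 1) * real (sends (T n I) 1 2)"
proof -
  let ?S = "T n I" and ?F = "real (sends (T n I) 1 1)" and ?G = "real (sends (T n I) 1 2)"
  have "real (card ?S) = (\<Sum>b\<in>{1..n}. real (sends ?S 1 b))"
    using sends_total[OF T_subset, of 1 n I] n by simp
  also have "\<dots> = ?F + (\<Sum>b\<in>{1..n} - {1}. real (sends ?S 1 b))"
    using n by (subst sum.remove[of _ 1]) auto
  also have "(\<Sum>b\<in>{1..n} - {1}. real (sends ?S 1 b)) = (\<Sum>b\<in>{1..n} - {1}. ?G)"
    using n by (intro sum.cong refl arg_cong[where f = real] sends_eq[OF I]) auto
  also have "\<dots> = (real n - 1) * ?G" using n by (simp add: of_nat_diff)
  finally show card: "real (card ?S) = ?F + (real n - 1) * ?G" .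
  have "(\<Sum>s\<in>?S. real n - card (perm_support n s)) = (\<Sum>a\<in>{1..n}. real (sends ?S a a))"
    by (rule sum_sends_fixed[OF T_subset, symmetric])
  also have "\<dots> = (\<Sum>a\<in>{1..n}. ?F)"
    using n by (intro sum.cong refl arg_cong[where f = real] sends_eq[OF I]) auto
  finally have F: "(\<Sum>s\<in>?S. real n - card (perm_support n s)) = real n * ?F" by simp
  have "(real n - 1) * std_value n I = (\<Sum>s\<in>?S. real n - card (perm_support n s)) - (\<Sum>s\<in>?S. 1)"
    unfolding std_value_def sum_distrib_left sum_subtractf[symmetric]
    using n by (intro sum.cong refl) (simp add: field_simps)
  also have "\<dots> = (real n - 1) * (?F - ?G)" unfolding F using card by (simp add: algebra_simps)
  finally show "std_value n I = ?F - ?G" using n by simp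
qed

lemma standard_rep_sum_scalar:
  assumes I: "I \<subseteq> {2..n}" and n: "2 \<le> n"
  shows "standard_rep_sum n (T n I) = complex_of_real (std_value n I) \<cdot>\<^sub>m 1\<^sub>m (n - 1)"
proof (rule eq_matI)
  fix i j assume "i < dim_row (complex_of_real (std_value n I) \<cdot>\<^sub>m 1\<^sub>m (n - 1))"
    "j < dim_col (complex_of_real (std_value n I) \<cdot>\<^sub>m 1\<^sub>m (n - 1))"
  then have ij: "i < n - 1" "j < n - 1" by auto
  let ?S = "T n I"
  have count: "(\<Sum>\<sigma>\<in>?S. of_bool (\<sigma> a = b)) = (of_nat (sends ?S a b) :: complex)" for a b
    using finite_T by (simp add: sends_def of_bool_def sum.If_cases Int_def conj_commute)
  have "standard_rep_sum n ?S $$ (i, j) = of_nat (sends ?S (j + 2) (i + 2)) - of_nat (sends ?S 1 (i + 2))"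
    using ij by (simp add: standard_rep_sum_def standard_rep_def sum_subtractf count)
  also have "sends ?S 1 (i + 2) = sends ?S 1 2"
    using ij n by (intro sends_eq[OF I]) auto
  also have "sends ?S (j + 2) (i + 2) = sends ?S 1 (if i = j then 1 else 2)"
    using ij n by (intro sends_eq[OF I]) auto
  finally show "standard_rep_sum n ?S $$ (i, j) =
    (complex_of_real (std_value n I) \<cdot>\<^sub>m 1\<^sub>m (n - 1)) $$ (i, j)"
    using ij std_value_sends(1)[OF I n] by auto
qed (auto simp: standard_rep_sum_def)

lemma largest_eigenvalue_scalar:
  assumes n: "0 < m"
  shows "largest_eigenvalue (complex_of_real c \<cdot>\<^sub>m 1\<^sub>m m) = c"
proof -
  let ?A = "complex_of_real c \<cdot>\<^sub>m 1\<^sub>m m"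
  have A: "?A *\<^sub>v v = complex_of_real c \<cdot>\<^sub>v v" if "v \<in> carrier_vec m" for v
    using that by (intro eq_vecI) auto
  have "eigenvalue ?A (complex_of_real x) \<longleftrightarrow> x = c" for x
  proof
    assume "eigenvalue ?A (complex_of_real x)"
    then obtain v where v: "v \<in> carrier_vec m" "v \<noteq> 0\<^sub>v m"
      "complex_of_real c \<cdot>\<^sub>v v = complex_of_real x \<cdot>\<^sub>v v"
      using A unfolding eigenvalue_def eigenvector_def by fastforce
    then obtain i where "i < m" "v $ i \<noteq> 0" by (metis carrier_vecD eq_vecI index_zero_vec)
    moreover have "(complex_of_real c \<cdot>\<^sub>v v) $ i = (complex_of_real x \<cdot>\<^sub>v v) $ i" using v(3) by simp
    ultimately show "x = c" using v(1) by simp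
  next
    assume "x = c"
    then have "eigenvector ?A (unit_vec m 0) (complex_of_real x)"
      using n A[of "unit_vec m 0"] by (auto simp: eigenvector_def)
    then show "eigenvalue ?A (complex_of_real x)" unfolding eigenvalue_def by blast
  qed
  then have "{x. eigenvalue ?A (complex_of_real x)} = {c}" by auto
  then show ?thesis by (simp add: largest_eigenvalue_def)
qed

lemma std_eigenfunction:
  assumes I: "I \<subseteq> {2..n}" and n: "2 \<le> n" and x: "x \<in> perms {1..n}"
  defines "g \<equiv> \<lambda>x :: nat \<Rightarrow> nat. of_bool (x 1 = 1) - 1 / real n"
  shows "(\<Sum>s\<in>T n I. g (x \<circ> s)) = std_value n I * g x"
proof -
  let ?S = "T n I"
  have xp: "x permutes {1..n}" using x by (simp add: perms_def)
  let ?b = "Hilbert_Choice.inv x 1"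
  have b: "x y = 1 \<longleftrightarrow> y = ?b" for y using permutes_inv_eq[OF xp] by metis
  have bX: "?b \<in> {1..n}" using n permutes_in_image[OF permutes_inv[OF xp], of 1] by simp
  have "(\<Sum>s\<in>?S. g (x \<circ> s)) = real (sends ?S 1 ?b) - real (card ?S) / real n"
    using finite_T by (simp add: g_def b sum_subtractf sends_def of_bool_def sum.If_cases Int_def conj_commute)
  also have "sends ?S 1 ?b = (if x 1 = 1 then sends ?S 1 1 else sends ?S 1 2)"
  proof (cases "x 1 = 1")
    case True
    then show ?thesis using b[of 1] by simp
  next
    case False
    then have "?b \<noteq> 1" using b[of 1] by auto
    then show ?thesis using False n bX by (simp, intro sends_eq[OF I]) auto
  qed
  finally have sum: "(\<Sum>s\<in>?S. g (x \<circ> s)) =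
    real (if x 1 = 1 then sends ?S 1 1 else sends ?S 1 2) - real (card ?S) / real n" .
  show ?thesis
    unfolding sum std_value_sends(1)[OF I n] std_value_sends(2)[OF I n]
    using n by (cases "x 1 = 1") (simp_all add: g_def field_simps)
qed

lemma sum_translate_forms:
  assumes "finite I"
  shows "(\<Sum>x\<in>perms {1..n}. f x * (\<Sum>s\<in>T n I. f (x \<circ> s))) =
    (\<Sum>k\<in>I. perm_functions.support_form {1..n} f k)"
proof -
  interpret perm_functions "{1..n}" by unfold_locales simp
  have "(\<Sum>x\<in>perms {1..n}. f x * (\<Sum>s\<in>T n I. f (x \<circ> s))) = (\<Sum>s\<in>T n I. translate_form f s)"
    unfolding sum_distrib_left translate_form_def inn_def by (rule sum.swap)
  also have "\<dots> = (\<Sum>k\<in>I. support_form f k)"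
    by (simp add: sum_T[OF assms] support_form_def moving_def moved_interval)
  finally show ?thesis .
qed

text \<open>
  By \<open>level_convex\<close> the levels of \<open>f\<close> are convex, and orthogonality to the constants makes the last one
  vanish; so \<open>convex_levels_bound\<close> applies.
\<close>

theorem standard_gap:
  assumes n: "12 \<le> n" and I: "I \<subseteq> {2..n - 2}" "I \<noteq> {}" "I \<noteq> {3}"
    and f: "(\<Sum>x\<in>perms {1..n}. f x) = 0"
  shows "(\<Sum>x\<in>perms {1..n}. f x * (\<Sum>s\<in>T n I. f (x \<circ> s))) \<le>
    std_value n I * (\<Sum>x\<in>perms {1..n}. f x * f x)"
proof -
  interpret perm_functions "{1..n}" by unfold_locales simp
  have finI: "finite I" using I(1) finite_subset by blast
  have form: "support_form f k = fact n / fact (n - k) * (\<Sum>j\<le>k. (-1) ^ j / fact j * level f (k - j))"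
    if "k \<in> I" for k
  proof -
    have "k \<le> n" using subsetD[OF I(1) that] by auto
    then show ?thesis
      unfolding support_mean_eq_sum_level[of k f, simplified, symmetric]
      using support_mean_eq_sum_level[of k f] by (simp add: support_mean_def field_simps)
  qed
  have l1: "level f 0 = level f 1" "level f 1 = inn f f" using level_low[of 0 f] level_low[of 1 f] n by auto
  have "(\<Sum>k\<in>I. support_form f k) =
    (\<Sum>k\<in>I. fact n / fact (n - k) * (\<Sum>j\<le>k. (-1) ^ j / fact j * level f (k - j)))"
    by (intro sum.cong refl form)
  also have "\<dots> \<le> (\<Sum>k\<in>I. fact n / fact (n - k) * derange_ratio k * (1 - real k / (real n - 1))) * level f 1"
    using level_convex[of _ f] level_full[OF f] level_nonneg[of f] l1(1)
    by (intro convex_levels_bound[OF n I]) auto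
  also have "\<dots> = std_value n I * inn f f"
  proof -
    have "I \<subseteq> {..n}" by (rule order_trans[OF I(1)]) auto
    from std_value_eq[OF this] show ?thesis by (simp add: l1(2))
  qed
  finally show ?thesis unfolding sum_translate_forms[OF finI] by (simp add: inn_def)
qed

theorem three_cycle_gap:
  assumes n: "4 \<le> n" and f: "(\<Sum>x\<in>perms {1..n}. f x) = 0"
    and sgn: "(\<Sum>x\<in>perms {1..n}. f x * of_int (sign x)) = 0"
  shows "(\<Sum>x\<in>perms {1..n}. f x * (\<Sum>s\<in>T n {3}. f (x \<circ> s))) \<le>
    std_value n {3} * (\<Sum>x\<in>perms {1..n}. f x * f x)"
proof -
  interpret perm_functions "{1..n}" by unfold_locales simp
  have "(\<Sum>x\<in>perms {1..n}. twist f x) = 0" using sgn by (simp add: twist_def mult.commute)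
  from support_mean_3_bound[OF _ f this]
  have "support_mean f 3 \<le> (1 / 3 - 1 / (real n - 1)) * inn f f" using n by simp
  then have "fact n / fact (n - 3) * support_mean f 3 \<le>
    fact n / fact (n - 3) * ((1 / 3 - 1 / (real n - 1)) * inn f f)"
    by (intro mult_left_mono) auto
  also have "fact n / fact (n - 3) * support_mean f 3 = support_form f 3"
    by (simp add: support_mean_def)
  also have "fact n / fact (n - 3) * ((1 / 3 - 1 / (real n - 1)) * inn f f) = std_value n {3} * inn f f"
  proof -
    have "(1 / 3) * (1 - 3 / (real n - 1)) = 1 / 3 - 1 / (real n - 1)"
      using n by (simp add: field_simps)
    moreover have "std_value n {3} = fact n / fact (n - 3) * ((1 / 3) * (1 - 3 / (real n - 1)))"
      using n std_value_eq[of "{3}" n] by (simp add: derange_ratio_3 mult.assoc)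
    ultimately show ?thesis by (simp only: mult.assoc)
  qed
  finally show ?thesis using sum_translate_forms[of "{3}" f n] by (simp add: inn_def)
qed


section \<open>The Aldous property\<close>

text \<open>
  The \<open>\<chi> j\<close> are linear characters that are trivial on the connection set, hence on the subgroup \<open>H\<close>
  generated by it.  The index of \<open>H\<close> can be read off from the gap: the function
  \<open>f x = of_bool (x \<in> H) - c * (\<Sum>j<t. \<chi> j x)\<close> with \<open>c = card H / fact n\<close> is orthogonal to all \<open>\<chi> j\<close> and is
  an eigenfunction for the degree, so it vanishes, and \<open>f id = 0\<close> means \<open>t * card H = fact n\<close>.
\<close>

theorem aldous_criterion:
  fixes \<chi> :: "nat \<Rightarrow> (nat \<Rightarrow> nat) \<Rightarrow> real"
  assumes n: "2 \<le> n" and I: "I \<subseteq> {2..n}"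
    and mult: "\<And>j x y. j < t \<Longrightarrow> x \<in> perms {1..n} \<Longrightarrow> y \<in> perms {1..n} \<Longrightarrow> \<chi> j (x \<circ> y) = \<chi> j x * \<chi> j y"
    and unit: "\<And>j. j < t \<Longrightarrow> \<chi> j id = 1"
    and one: "\<And>j s. j < t \<Longrightarrow> s \<in> T n I \<Longrightarrow> \<chi> j s = 1"
    and orth: "\<And>i j. i < t \<Longrightarrow> j < t \<Longrightarrow> (\<Sum>x\<in>perms {1..n}. \<chi> i x * \<chi> j x) = fact n * of_bool (i = j)"
    and gap: "\<And>f. (\<And>j. j < t \<Longrightarrow> (\<Sum>x\<in>perms {1..n}. f x * \<chi> j x) = 0) \<Longrightarrow>
      (\<Sum>x\<in>perms {1..n}. f x * (\<Sum>s\<in>T n I. f (x \<circ> s))) \<le> std_value n I * (\<Sum>x\<in>perms {1..n}. f x * f x)"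
    and lt: "std_value n I < card (T n I)"
  shows "aldous_property n (T n I)"
proof -
  let ?G = "sym_group n" and ?V = "perms {1..n}" and ?S = "T n I"
  let ?H = "generate ?G ?S"
  let ?N = "fact n :: real"
  interpret group ?G by (rule sym_group_is_group)
  have V: "carrier ?G = ?V" by (rule carrier_sym_group_perms)
  have finV: "finite ?V" by simp
  have sub: "subgroup ?H ?G" using T_subset V by (intro generate_is_subgroup) simp
  have HV: "?H \<subseteq> ?V" using subgroup.subset[OF sub] V by simp
  have finH: "finite ?H" using finite_subset[OF HV finV] .
  have SH: "s \<in> ?H" if "s \<in> ?S" for s using that by (rule generate.incl)
  have idH: "id \<in> ?H" using subgroup.one_closed[OF sub] by (simp add: sym_group_one)
  have Hstep: "x \<circ> s \<in> ?H \<longleftrightarrow> x \<in> ?H" if x: "x \<in> ?V" and s: "s \<in> ?S" for x s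
  proof
    assume "x \<in> ?H"
    then show "x \<circ> s \<in> ?H" using subgroup.m_closed[OF sub _ SH[OF s]] by (simp add: sym_group_mult)
  next
    assume xs: "x \<circ> s \<in> ?H"
    have "Hilbert_Choice.inv s \<in> ?H" using SH[OF T_inverse[OF I s]] .
    from subgroup.m_closed[OF sub xs this]
    have "x \<circ> (s \<circ> Hilbert_Choice.inv s) \<in> ?H" by (simp add: sym_group_mult o_assoc)
    moreover have "s permutes {1..n}" using s T_subset by (auto simp: perms_def)
    ultimately show "x \<in> ?H" by (simp add: permutes_inv_o)
  qed
  have chi_step: "\<chi> j (x \<circ> s) = \<chi> j x" if "j < t" "x \<in> ?V" "s \<in> ?S" for j x s
    using that mult[of j x s] one[of j s] T_subset by auto
  have chi_H: "\<chi> j h = 1" if j: "j < t" and h: "h \<in> ?H" for j h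
    using h
  proof (induction rule: generate.induct)
    case one
    show ?case unfolding sym_group_one by (rule unit[OF j])
  next
    case (incl h)
    then show ?case using assms(5)[OF j] by simp
  next
    case (inv h)
    then have "h permutes {1..n}" using T_subset by (auto simp: perms_def)
    then show ?case
      using assms(5)[OF j T_inverse[OF I inv]] sym_group_inv_eq by metis
  next
    case (eng h1 h2)
    then have "h1 \<in> ?V" "h2 \<in> ?V" using HV by auto
    then show ?case unfolding sym_group_mult mult[OF j \<open>h1 \<in> ?V\<close> \<open>h2 \<in> ?V\<close>] using eng by simp
  qed
  let ?\<Gamma> = "cayley_graph ?G ?S"
  have fst: "fst ?\<Gamma> = ?V" by (simp add: cayley_graph_def V)
  have fin: "finite (fst ?\<Gamma>)" by (simp add: fst)
  have nb: "neighbour_sum ?\<Gamma> f x = (\<Sum>s\<in>?S. f (x \<circ> s))" if "x \<in> ?V" for f x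
    by (rule neighbour_sum_cayley[OF T_subset T_inverse[OF I] that])
  have index: "card (rcosets\<^bsub>?G\<^esub> ?H) = t"
  proof -
    define c where "c = real (card ?H) / ?N"
    define f where "f x = of_bool (x \<in> ?H) - c * (\<Sum>j<t. \<chi> j x)" for x
    have "(\<Sum>x\<in>?V. f x * \<chi> j x) = 0" if j: "j < t" for j
    proof -
      have 1: "(\<Sum>x\<in>?V. of_bool (x \<in> ?H) * \<chi> j x) = real (card ?H)"
      proof -
        have "(\<Sum>x\<in>?V. of_bool (x \<in> ?H) * \<chi> j x) = (\<Sum>x\<in>?H. 1)"
          using HV by (intro sum.mono_neutral_cong_right) (auto simp: chi_H[OF j])
        then show ?thesis by simp
      qed
      have 2: "(\<Sum>x\<in>?V. (\<Sum>i<t. \<chi> i x) * \<chi> j x) = ?N"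
      proof -
        have "(\<Sum>x\<in>?V. (\<Sum>i<t. \<chi> i x) * \<chi> j x) = (\<Sum>i<t. \<Sum>x\<in>?V. \<chi> i x * \<chi> j x)"
          unfolding sum_distrib_right by (rule sum.swap)
        also have "\<dots> = (\<Sum>i<t. if i = j then ?N else 0)"
          using j by (intro sum.cong refl) (auto simp: orth)
        finally show ?thesis using j by simp
      qed
      have "(\<Sum>x\<in>?V. f x * \<chi> j x) = (\<Sum>x\<in>?V. of_bool (x \<in> ?H) * \<chi> j x) - c * (\<Sum>x\<in>?V. (\<Sum>i<t. \<chi> i x) * \<chi> j x)"
        unfolding f_def left_diff_distrib sum_subtractf
        by (simp only: sum_distrib_left[where A = ?V] mult.assoc)
      then show ?thesis unfolding 1 2 by (simp add: c_def)
    qed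
    from gap[OF this]
    have "(\<Sum>x\<in>?V. f x * (\<Sum>s\<in>?S. f (x \<circ> s))) \<le> std_value n I * (\<Sum>x\<in>?V. f x * f x)" .
    moreover have "(\<Sum>s\<in>?S. f (x \<circ> s)) = card ?S * f x" if "x \<in> ?V" for x
      using that by (simp add: f_def Hstep chi_step)
    then have "(\<Sum>x\<in>?V. f x * (\<Sum>s\<in>?S. f (x \<circ> s))) = card ?S * (\<Sum>x\<in>?V. f x * f x)"
      by (simp add: sum_distrib_left mult_ac)
    moreover have nonneg: "(\<Sum>x\<in>?V. f x * f x) \<ge> 0" by (intro sum_nonneg) simp
    ultimately have "(card ?S - std_value n I) * (\<Sum>x\<in>?V. f x * f x) \<le> 0" by (simp add: left_diff_distrib)
    then have "(\<Sum>x\<in>?V. f x * f x) = 0" using lt nonneg by (simp add: mult_le_0_iff)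
    then have "f id = 0" using finV by (subst (asm) sum_nonneg_eq_0_iff) auto
    then have "c * real t = 1" using idH by (simp add: f_def unit)
    then have "real (t * card ?H) = ?N" by (simp add: c_def field_simps)
    moreover have "card (rcosets\<^bsub>?G\<^esub> ?H) * card ?H = fact n"
      using lagrange[OF sub] card_perms_interval by (simp add: Coset.order_def V mult.commute)
    then have "real (card (rcosets\<^bsub>?G\<^esub> ?H) * card ?H) = ?N" by (metis of_nat_fact)
    ultimately have "t * card ?H = card (rcosets\<^bsub>?G\<^esub> ?H) * card ?H" by (metis of_nat_eq_iff)
    moreover have "card ?H > 0" using finH idH by (auto simp: card_gt_0_iff)
    ultimately show ?thesis by simp
  qed
  have "graph_eigenvalue ?\<Gamma> (t + 1) = std_value n I"
  proof (rule graph_eigenvalue_after_top[OF fin, where u = "\<lambda>j x. \<chi> j x / sqrt ?N" and d = "card ?S"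
        and g = "\<lambda>x. of_bool (x 1 = 1) - 1 / real n" and z = id], unfold fst)
    fix i j assume "i < t" "j < t"
    from orth[OF this]
    show "(\<Sum>x\<in>?V. \<chi> i x / sqrt ?N * (\<chi> j x / sqrt ?N)) = of_bool (i = j)"
      by (simp add: sum_divide_distrib[symmetric])
  next
    fix j x assume "j < t" "x \<in> ?V"
    then show "neighbour_sum ?\<Gamma> (\<lambda>x. \<chi> j x / sqrt ?N) x = real (card ?S) * (\<chi> j x / sqrt ?N)"
      by (simp add: nb chi_step)
  next
    fix f assume f: "\<And>j. j < t \<Longrightarrow> (\<Sum>x\<in>?V. f x * (\<chi> j x / sqrt ?N)) = 0"
    have "(\<Sum>x\<in>?V. f x * \<chi> j x) = 0" if "j < t" for j
      using f[OF that] by (simp add: sum_divide_distrib[symmetric])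
    then show "(\<Sum>x\<in>?V. f x * neighbour_sum ?\<Gamma> f x) \<le> std_value n I * (\<Sum>x\<in>?V. f x * f x)"
      using gap[of f] by (simp add: nb)
  next
    fix x assume "x \<in> ?V"
    then show "neighbour_sum ?\<Gamma> (\<lambda>x. of_bool (x 1 = 1) - 1 / real n) x =
      std_value n I * (of_bool (x 1 = 1) - 1 / real n)"
      using std_eigenfunction[OF I n] by (simp add: nb)
  qed (use lt n in \<open>auto simp: field_simps\<close>)
  then show ?thesis
    using n unfolding aldous_property_def Let_def index standard_rep_sum_scalar[OF I n]
    by (simp add: largest_eigenvalue_scalar)
qed

lemma std_value_less_card:
  assumes n: "2 \<le> n" and I: "I \<subseteq> {2..n}" "I \<noteq> {}"
  shows "std_value n I < card (T n I)"
proof -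
  have In: "I \<subseteq> {..n}" using I by auto
  have fin: "finite I" using I(1) finite_subset by blast
  have "real (card (T n I)) = (\<Sum>s\<in>T n I. 1)" by simp
  also have "\<dots> = (\<Sum>k\<in>I. fact n / fact (n - k) * derange_ratio k)"
    unfolding sum_T[OF fin] using In by (intro sum.cong refl) (auto simp: card_moving)
  finally have c: "real (card (T n I)) = (\<Sum>k\<in>I. fact n / fact (n - k) * derange_ratio k)" .
  show ?thesis unfolding c std_value_eq[OF In]
  proof (rule sum_strict_mono[OF fin I(2)])
    fix k assume "k \<in> I"
    then have k: "2 \<le> k" using I by auto
    have "(1::real) - real k / (real n - 1) < 1" using k n by simp
    moreover have "fact n / fact (n - k) * derange_ratio k > 0"
      using derange_ratio_ge_third[OF k] by (intro mult_pos_pos divide_pos_pos) auto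
    ultimately have "fact n / fact (n - k) * derange_ratio k * (1 - real k / (real n - 1)) <
      fact n / fact (n - k) * derange_ratio k * 1" by (rule mult_strict_left_mono)
    then show "fact n / fact (n - k) * derange_ratio k * (1 - real k / (real n - 1)) <
      fact n / fact (n - k) * derange_ratio k" by (simp only: mult_1_right)
  qed
qed

lemma sum_sign_perms:
  fixes n :: nat
  assumes "2 \<le> n" shows "(\<Sum>x\<in>perms {1..n}. real_of_int (sign x)) = 0"
proof -
  interpret perm_functions "{1..n}" by unfold_locales simp
  have c: "avg (perms {1..n}) (\<lambda>x. 1) = (\<lambda>x. 1)"
    using card_perms_pos[of "{1..n}"] by (auto simp: avg_def)
  show ?thesis
    using avg_perms_orthogonal_twist[of "{1..n}" "{1..n}" 1 2 "\<lambda>x. 1" "\<lambda>x. 1"] assms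
    by (simp add: c inn_def twist_def)
qed

text \<open>
  The 3-cycles are even, so for \<open>I = {3}\<close> the sign is a second character that is trivial on the
  connection set, and \<open>t = 2\<close>.  In all other cases the constant function is enough.
\<close>

theorem aldous_property_T:
  assumes n: "12 \<le> n" and I: "I \<subseteq> {2..n - 2}" "I \<noteq> {}"
  shows "aldous_property n (T n I)"
proof -
  have I': "I \<subseteq> {2..n}" by (rule order_trans[OF I(1)]) auto
  have n2: "2 \<le> n" using n by simp
  note lt = std_value_less_card[OF n2 I' I(2)]
  show ?thesis
  proof (cases "I = {3}")
    case False
    show ?thesis
    proof (rule aldous_criterion[OF n2 I', where t = 1 and \<chi> = "\<lambda>j x. 1"])
      fix f :: "(nat \<Rightarrow> nat) \<Rightarrow> real"
      assume "\<And>j :: nat. j < 1 \<Longrightarrow> (\<Sum>x\<in>perms {1..n}. f x * 1) = 0"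
      from this[of 0] have "(\<Sum>x\<in>perms {1..n}. f x) = 0" by simp
      then show "(\<Sum>x\<in>perms {1..n}. f x * (\<Sum>s\<in>T n I. f (x \<circ> s))) \<le>
        std_value n I * (\<Sum>x\<in>perms {1..n}. f x * f x)"
        by (rule standard_gap[OF n I False])
    qed (use lt card_perms_interval in auto)
  next
    case True
    interpret perm_functions "{1..n}" by unfold_locales simp
    define \<chi> :: "nat \<Rightarrow> (nat \<Rightarrow> nat) \<Rightarrow> real" where
      "\<chi> j x = (if j = 0 then 1 else real_of_int (sign x))" for j x
    show ?thesis
    proof (rule aldous_criterion[OF n2 I', where t = 2 and \<chi> = \<chi>])
      fix j x y assume "x \<in> perms {1..n}" "y \<in> perms {1..n}"
      then show "\<chi> j (x \<circ> y) = \<chi> j x * \<chi> j y" by (simp add: \<chi>_def sign_comp)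
    next
      fix j s assume "s \<in> T n I"
      then have "s \<in> perms {1..n}" "card (moved s) = 3"
        using True by (auto simp: T_def carrier_sym_group_perms moved_interval)
      then show "\<chi> j s = 1" by (simp add: \<chi>_def sign_moved_3)
    next
      fix i j :: nat assume "i < 2" "j < 2"
      then show "(\<Sum>x\<in>perms {1..n}. \<chi> i x * \<chi> j x) = fact n * of_bool (i = j)"
        using sum_sign_perms[OF n2] by (auto simp: \<chi>_def card_perms_interval less_2_cases_iff)
    next
      fix f assume "\<And>j. j < 2 \<Longrightarrow> (\<Sum>x\<in>perms {1..n}. f x * \<chi> j x) = 0"
      from this[of 0] this[of 1] show "(\<Sum>x\<in>perms {1..n}. f x * (\<Sum>s\<in>T n I. f (x \<circ> s))) \<le>
        std_value n I * (\<Sum>x\<in>perms {1..n}. f x * f x)"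
        unfolding True using n by (intro three_cycle_gap) (auto simp: \<chi>_def)
    qed (use lt in \<open>auto simp: \<chi>_def\<close>)
  qed
qed

text \<open>
  The sum of all permutations acts as 0 in the standard representation.
\<close>

lemma std_value_all: "2 \<le> n \<Longrightarrow> std_value n {..n} = 0"
proof -
  assume n: "2 \<le> n"
  let ?V = "perms {1..n}"
  have s: "real (sends ?V a a) = fact n / real n" if a: "a \<in> {1..n}" for a
  proof -
    have "{s \<in> ?V. s a = a} = sending {1..n} a a" by (auto simp: sending_def perms_def)
    then have "n * sends ?V a a = fact n"
      using card_sending[of "{1..n}" a a] a by (simp add: sends_def card_perms_interval)
    then have "real n * real (sends ?V a a) = fact n" by (metis of_nat_fact of_nat_mult)
    then show ?thesis using n by (simp add: field_simps)
  qed
  have "(\<Sum>s\<in>?V. real n - card (perm_support n s)) = (\<Sum>a\<in>{1..n}. real (sends ?V a a))"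
    by (rule sum_sends_fixed[symmetric]) simp
  also have "\<dots> = fact n" using n by (simp add: s)
  finally have "(\<Sum>s\<in>?V. real (card (perm_support n s))) = real n * fact n - fact n"
    by (simp add: sum_subtractf card_perms_interval algebra_simps)
  then have "(\<Sum>s\<in>?V. real (card (perm_support n s)) / (real n - 1)) = fact n"
    unfolding sum_divide_distrib[symmetric] using n by (simp add: field_simps)
  then show ?thesis
    unfolding std_value_def T_all by (simp add: sum_subtractf card_perms_interval)
qed

text \<open>
  The connection set contains more than half of the group, because at least a third of all
  permutations move every point and as many move all points but one; so it generates, and the second
  eigenvalue is the relevant one.  Let \<open>J\<close> be the complement of \<open>I\<close> in \<open>{2..n}\<close>.  All permutations
  together act as 0 in the standard representation, so the value for \<open>I\<close> is \<open>- 1\<close> minus the value for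
  \<open>J\<close>, which is nonnegative as \<open>J \<subseteq> {2..n - 2}\<close>.  Hence that value is at most \<open>- 1\<close>, whereas the vanishing
  trace makes the second eigenvalue larger than \<open>- 1\<close>, since \<open>J\<close> is nonempty.
\<close>

theorem not_aldous_property_T:
  assumes n: "12 \<le> n" and I: "I \<subset> {2..n}" "n - 1 \<in> I" "n \<in> I"
  shows "\<not> aldous_property n (T n I)"
proof
  assume aldous: "aldous_property n (T n I)"
  let ?G = "sym_group n" and ?V = "perms {1..n}" and ?S = "T n I"
  let ?H = "generate ?G ?S"
  let ?\<Gamma> = "cayley_graph ?G ?S"
  interpret group ?G by (rule sym_group_is_group)
  have n2: "2 \<le> n" using n by simp
  have I2: "I \<subseteq> {2..n}" using I(1) by auto
  have V: "carrier ?G = ?V" by (rule carrier_sym_group_perms)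
  have finV: "finite ?V" by simp
  have sub: "subgroup ?H ?G" using T_subset V by (intro generate_is_subgroup) simp
  have HV: "?H \<subseteq> ?V" using subgroup.subset[OF sub] V by simp
  have finH: "finite ?H" using finite_subset[OF HV finV] .
  have lag: "card (rcosets\<^bsub>?G\<^esub> ?H) * card ?H = fact n"
    using lagrange[OF sub] card_perms_interval by (simp add: Coset.order_def V mult.commute)
  have "real (card (moving n n)) + real (card (moving n (n - 1))) = real (card (moving n n \<union> moving n (n - 1)))"
    using n finite_subset[OF _ finV] by (subst card_Un_disjoint) (auto simp: moving_def)
  also have "\<dots> \<le> real (card ?H)"
  proof -
    have "moving n n \<union> moving n (n - 1) \<subseteq> ?S" using I by (auto simp: moving_def T_def V)
    moreover have "?S \<subseteq> ?H" by (rule subsetI) (rule generate.incl)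
    ultimately have "moving n n \<union> moving n (n - 1) \<subseteq> ?H" by (rule order_trans)
    then show ?thesis using finH by (simp add: card_mono)
  qed
  finally have "fact n * (derange_ratio n + derange_ratio (n - 1)) \<le> real (card ?H)"
    using n by (simp add: card_moving algebra_simps fact_1)
  moreover have "derange_ratio n \<ge> 1 / 3" "derange_ratio (n - 1) \<ge> 1 / 3"
    using n by (intro derange_ratio_ge_third; simp)+
  then have "(fact n :: real) * (2 / 3) \<le> fact n * (derange_ratio n + derange_ratio (n - 1))"
    by (intro mult_left_mono) auto
  ultimately have H: "(fact n :: real) * (2 / 3) \<le> real (card ?H)" by linarith
  have index: "card (rcosets\<^bsub>?G\<^esub> ?H) = 1"
  proof (rule ccontr)
    assume "card (rcosets\<^bsub>?G\<^esub> ?H) \<noteq> 1"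
    moreover have "card (rcosets\<^bsub>?G\<^esub> ?H) \<noteq> 0" using lag by (metis fact_nonzero mult_0)
    ultimately have "2 \<le> card (rcosets\<^bsub>?G\<^esub> ?H)" by linarith
    from mult_le_mono1[OF this, of "card ?H"] have "2 * card ?H \<le> fact n" unfolding lag .
    then have "2 * real (card ?H) \<le> fact n" by (metis of_nat_fact of_nat_le_iff of_nat_mult of_nat_numeral)
    moreover have "(fact n :: real) > 0" by simp
    ultimately show False using H by linarith
  qed
  have lam: "graph_eigenvalue ?\<Gamma> 2 = std_value n I"
    using aldous n unfolding aldous_property_def Let_def index standard_rep_sum_scalar[OF I2 n2]
    by (simp add: largest_eigenvalue_scalar one_add_one)
  have fst: "fst ?\<Gamma> = ?V" by (simp add: cayley_graph_def V)
  have nb: "neighbour_sum ?\<Gamma> f x = (\<Sum>s\<in>?S. f (x \<circ> s))" if "x \<in> ?V" for f x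
    by (rule neighbour_sum_cayley[OF T_subset T_inverse[OF I2] that])
  have "0 \<le> real (card ?S) + (real (card (fst ?\<Gamma>)) - 1) * graph_eigenvalue ?\<Gamma> 2"
  proof (rule trace_bound_second_eigenvalue)
    fix x assume x: "x \<in> fst ?\<Gamma>"
    show "{x} \<notin> snd ?\<Gamma>"
    proof
      assume "{x} \<in> snd ?\<Gamma>"
      then obtain g s where gs: "{x} = {g, g \<circ> s}" "s \<in> ?S" "g \<in> ?V"
        by (auto simp: cayley_graph_def sym_group_mult V)
      then have "g \<circ> s = g" by auto
      then have "Hilbert_Choice.inv g \<circ> (g \<circ> s) = Hilbert_Choice.inv g \<circ> g" by simp
      then have "s = id" using gs(3) by (simp add: perms_def o_assoc permutes_inv_o)
      then show False using id_notin_T[OF I2] gs(2) by simp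
    qed
    show "neighbour_sum ?\<Gamma> (\<lambda>y. 1) x = real (card ?S)" using x by (simp add: fst nb)
  next
    have "fact 2 \<le> (fact n :: nat)" using n by (intro fact_mono) auto
    then show "2 \<le> card (fst ?\<Gamma>)" by (simp add: fst card_perms_interval)
  qed (simp add: fst)
  then have ineq: "0 \<le> real (card ?S) + (fact n - 1) * std_value n I"
    unfolding lam by (simp add: fst card_perms_interval)
  define J where "J = {2..n} - I"
  have J: "J \<subseteq> {2..n - 2}" "J \<noteq> {}"
  proof -
    have "k \<le> n - 2" if "k \<in> J" for k
    proof -
      have "k \<noteq> n" "k \<noteq> n - 1" "k \<le> n" using that I by (auto simp: J_def)
      then show ?thesis by linarith
    qed
    then show "J \<subseteq> {2..n - 2}" by (auto simp: J_def)
    show "J \<noteq> {}" using I(1) by (auto simp: J_def)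
  qed
  \<comment> \<open>\<open>W k\<close> is the number of permutations with support size \<open>k\<close>.\<close>
  define W where "W k = fact n / fact (n - k) * derange_ratio k" for k
  have W0: "W 0 = 1" "W 1 = 0" using n by (simp_all add: W_def One_nat_def)
  have Wpos: "W k > 0" if "2 \<le> k" for k
    unfolding W_def using derange_ratio_ge_third[OF that] by (intro mult_pos_pos divide_pos_pos) auto
  have split: "(\<Sum>k\<in>{..n}. h k) = h 0 + h 1 + ((\<Sum>k\<in>I. h k) + (\<Sum>k\<in>J. h k))" for h :: "nat \<Rightarrow> real"
  proof -
    have "{..n} = {0, 1} \<union> ({2..n})" using n by auto
    then have "(\<Sum>k\<in>{..n}. h k) = (\<Sum>k\<in>{0, 1}. h k) + (\<Sum>k\<in>{2..n}. h k)"
      by (simp only:) (rule sum.union_disjoint; auto)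
    moreover have "(\<Sum>k\<in>{2..n}. h k) = (\<Sum>k\<in>I. h k) + (\<Sum>k\<in>J. h k)"
      using I2 by (simp add: J_def sum.subset_diff add.commute)
    ultimately show ?thesis by simp
  qed
  have cardT: "real (card (T n K)) = (\<Sum>k\<in>K. W k)" if "K \<subseteq> {..n}" for K
  proof -
    have "finite K" using that finite_subset by blast
    then have "real (card (T n K)) = (\<Sum>k\<in>K. real (card (moving n k)))"
      using sum_T[of K "\<lambda>s. 1 :: real" n] by simp
    also have "\<dots> = (\<Sum>k\<in>K. W k)" using that by (intro sum.cong refl) (auto simp: card_moving W_def)
    finally show ?thesis .
  qed
  have Tall: "card (T n {..n}) = fact n" by (simp add: T_all card_perms_interval)
  have IJn: "I \<subseteq> {..n}" "J \<subseteq> {..n}" using I2 by (auto simp: J_def)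
  have "fact n = W 0 + W 1 + ((\<Sum>k\<in>I. W k) + (\<Sum>k\<in>J. W k))"
    using cardT[of "{..n}"] Tall split[of W] by (metis of_nat_fact order_refl)
  then have cS: "real (card ?S) = fact n - 1 - (\<Sum>k\<in>J. W k)" using cardT[OF IJn(1)] W0 by simp
  have sv: "std_value n K = (\<Sum>k\<in>K. W k * (1 - real k / (real n - 1)))" if "K \<subseteq> {..n}" for K
    unfolding std_value_eq[OF that] W_def ..
  have "0 = 1 + (std_value n I + std_value n J)"
    using std_value_all[OF n2] split[of "\<lambda>k. W k * (1 - real k / (real n - 1))"] W0
    by (simp add: sv[OF order_refl] sv[OF IJn(1)] sv[OF IJn(2)])
  then have sI: "std_value n I = - 1 - std_value n J" by simp
  have "std_value n J \<ge> 0"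
    unfolding sv[OF IJn(2)]
  proof (intro sum_nonneg mult_nonneg_nonneg)
    fix k assume "k \<in> J"
    then have "2 \<le> k" "k \<le> n - 2" using J by auto
    then show "W k \<ge> 0" "0 \<le> 1 - real k / (real n - 1)" using Wpos[of k] n by (auto simp: field_simps)
  qed
  then have "(fact n - 1) * std_value n J \<ge> 0" by (intro mult_nonneg_nonneg) auto
  moreover have "(\<Sum>k\<in>J. W k) > 0"
    using J Wpos finite_subset[OF IJn(2)] by (intro sum_pos) auto
  ultimately show False using ineq unfolding cS sI by (simp add: algebra_simps)
qed

theorem theorem1p3:
  shows "\<exists>N::nat. N > 0 \<and>
    (\<forall>n\<ge>N. \<forall>I::nat set.
       I \<noteq> {} \<and> I \<subset> {2..n} \<and> card (I \<inter> {n - 1, n}) \<noteq> 1 \<longrightarrow>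
       (aldous_property n (T n I) \<longleftrightarrow> I \<inter> {n - 1, n} = {}))"
proof (intro exI[of _ 12] conjI allI impI)
  \<comment> \<open>12 comes from \<open>deficiency_bound\<close>.\<close>
  fix n :: nat and I :: "nat set"
  assume n: "12 \<le> n" and "I \<noteq> {} \<and> I \<subset> {2..n} \<and> card (I \<inter> {n - 1, n}) \<noteq> 1"
  then have I: "I \<noteq> {}" "I \<subset> {2..n}" "card (I \<inter> {n - 1, n}) \<noteq> 1" by auto
  show "aldous_property n (T n I) \<longleftrightarrow> I \<inter> {n - 1, n} = {}"
  proof (cases "I \<inter> {n - 1, n} = {}")
    case True
    have "k \<le> n - 2" if "k \<in> I" for k
    proof -
      have "k \<noteq> n" "k \<noteq> n - 1" "k \<le> n" using that I True by auto
      then show ?thesis by linarith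
    qed
    then have "I \<subseteq> {2..n - 2}" using I(2) by auto
    then show ?thesis using aldous_property_T[OF n _ I(1)] True by simp
  next
    case False
    have "n - 1 \<in> I \<and> n \<in> I"
    proof (rule ccontr)
      assume "\<not> (n - 1 \<in> I \<and> n \<in> I)"
      then have "I \<inter> {n - 1, n} = {n - 1} \<or> I \<inter> {n - 1, n} = {n}" using False by auto
      then show False using I(3) by auto
    qed
    then show ?thesis using not_aldous_property_T[OF n I(2)] False by blast
  qed
qed simp

end
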